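(* Let $T$ be a bounded linear operator on a complex separable Banach space $X$. (a) Assume that $T$ has a perfectly spanning set of unimodular eigenvectors, and that the periodic eigenvectors of $T$ are dense in the set of all unimodular eigenvectors of $T$. Then $\overline{\mathcal F}_T(HC(T))$ is a dense $G_\delta$ subset of $\overline{\mathcal F}_T(X)$. (b) Assume only that $T$ has a perfectly spanning set of unimodular eigenvectors. Then $\overline{\mathcal S}_T(HC(T))$ is a dense $G_\delta$ subset of $\overline{\mathcal S}_T(X)$.
   Context: $\mathcal P(X)$ is the space of Borel probability measures on $X$ with the Prokhorov (weak) topology generated by bounded continuous functions; for Borel $A\subset X$, $\mathcal P(A)=\{m\in\mathcal P(X): m(A)=1\}$. $HC(T)$ is the set of vectors with dense $T$-orbit. A unimodular eigenvector is an eigenvector with eigenvalue in $\mathbb T$; a periodic eigenvector is one whose eigenvalue is a root of unity. $T$ has a perfectly spanning set of unimodular eigenvectors if for every countable $D\subset\mathbb T$, $\overline{\mathrm{span}}[\ker(T-\lambda I):\lambda\in\mathbb T\setminus D]=X$. A periodic measure for $T$ is $\frac1N\sum_{n=0}^{N-1}\delta_{T^na}$ with $N\ge1$, $T^Na=a$; $\mathcal F_T(X)$ is the convex hull of all periodic measures, $\overline{\mathcal F}_T(X)$ its closure in $\mathcal P(X)$, and $\overline{\mathcal F}_T(A)=\overline{\mathcal F}_T(X)\cap\mathcal P(A)$. A Steinhaus measure for $T$ is the distribution of a random variable $\sum_{j\in J}\chi_jx_j$, $J$ finite, $x_j$ unimodular eigenvectors of $T$, $(\chi_j)$ independent random variables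 uniformly distributed on $\mathbb T$; $\mathcal S_T(X)$ is the set of these, $\overline{\mathcal S}_T(X)$ its closure in $\mathcal P(X)$, and $\overline{\mathcal S}_T(A)=\overline{\mathcal S}_T(X)\cap\mathcal P(A)$. *)

theory Defs
  imports "HOL-Analysis.Analysis" "HOL-Probability.Probability"
begin

text \<open>HOL-Analysis has no class of complex normed spaces; a complex Banach space is
modelled as a real Banach space type together with a complex scalar multiplication
extending the real one and compatible with the norm.\<close>

definition complex_scalar :: "(complex \<Rightarrow> 'a::real_normed_vector \<Rightarrow> 'a) \<Rightarrow> bool" where
  "complex_scalar cm \<longleftrightarrow>
     (\<forall>x. cm 1 x = x) \<and>
     (\<forall>a b x. cm a (cm b x) = cm (a * b) x) \<and>
     (\<forall>a b x. cm (a + b) x = cm a x + cm b x) \<and>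
     (\<forall>a x y. cm a (x + y) = cm a x + cm a y) \<and>
     (\<forall>r x. cm (complex_of_real r) x = scaleR r x) \<and>
     (\<forall>a x. norm (cm a x) = cmod a * norm x)"

definition complex_bounded_linear ::
  "(complex \<Rightarrow> 'a::real_normed_vector \<Rightarrow> 'a) \<Rightarrow> ('a \<Rightarrow> 'a) \<Rightarrow> bool" where
  "complex_bounded_linear cm T \<longleftrightarrow> bounded_linear T \<and> (\<forall>c x. T (cm c x) = cm c (T x))"

definition cspan :: "(complex \<Rightarrow> 'a::real_normed_vector \<Rightarrow> 'a) \<Rightarrow> 'a set \<Rightarrow> 'a set" where
  "cspan cm S = {\<Sum>i\<in>I. cm (c i) (v i) | (I::nat set) c v. finite I \<and> v ` I \<subseteq> S}"

definition eigenspace :: "(complex \<Rightarrow> 'a \<Rightarrow> 'a) \<Rightarrow> ('a \<Rightarrow> 'a) \<Rightarrow> complex \<Rightarrow> 'a set" where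
  "eigenspace cm T l = {x. T x = cm l x}"

definition unimodular_eigenvectors :: "(complex \<Rightarrow> 'a::zero \<Rightarrow> 'a) \<Rightarrow> ('a \<Rightarrow> 'a) \<Rightarrow> 'a set" where
  "unimodular_eigenvectors cm T = {x. x \<noteq> 0 \<and> (\<exists>l. cmod l = 1 \<and> T x = cm l x)}"

definition periodic_eigenvectors :: "(complex \<Rightarrow> 'a::zero \<Rightarrow> 'a) \<Rightarrow> ('a \<Rightarrow> 'a) \<Rightarrow> 'a set" where
  "periodic_eigenvectors cm T =
     {x. x \<noteq> 0 \<and> (\<exists>l. (\<exists>n::nat. n > 0 \<and> l ^ n = 1) \<and> T x = cm l x)}"

definition perfectly_spanning :: "(complex \<Rightarrow> 'a::real_normed_vector \<Rightarrow> 'a) \<Rightarrow> ('a \<Rightarrow> 'a) \<Rightarrow> bool" where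
  "perfectly_spanning cm T \<longleftrightarrow>
     (\<forall>D::complex set. countable D \<longrightarrow>
        closure (cspan cm (\<Union>l\<in>{z. cmod z = 1} - D. eigenspace cm T l)) = UNIV)"

definition HC :: "('a::topological_space \<Rightarrow> 'a) \<Rightarrow> 'a set" where
  "HC T = {x. closure (range (\<lambda>n. (T ^^ n) x)) = UNIV}"

definition Pr :: "'a::topological_space measure set" where
  "Pr = {m. prob_space m \<and> sets m = sets borel}"

definition Pr_on :: "'a::topological_space set \<Rightarrow> 'a measure set" where
  "Pr_on A = {m \<in> Pr. emeasure m A = 1}"

definition weak_subbasis :: "'a::topological_space measure set set" where
  "weak_subbasis = {{m \<in> Pr. (\<integral>x. f x \<partial>m) \<in> U} | (f :: 'a \<Rightarrow> real) U.
                      continuous_on UNIV f \<and> bounded (range f) \<and> open U}"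

definition weak_top :: "'a::topological_space measure topology" where
  "weak_top = subtopology (topology_generated_by weak_subbasis) Pr"

definition mixture :: "nat set \<Rightarrow> (nat \<Rightarrow> real) \<Rightarrow> (nat \<Rightarrow> 'a::topological_space measure) \<Rightarrow> 'a measure" where
  "mixture I c m = measure_of UNIV (sets borel) (\<lambda>A. \<Sum>i\<in>I. ennreal (c i) * emeasure (m i) A)"

definition periodic_measures :: "('a::topological_space \<Rightarrow> 'a) \<Rightarrow> 'a measure set" where
  "periodic_measures T =
     {mixture {..<N} (\<lambda>_. 1 / real N) (\<lambda>n. return borel ((T ^^ n) a)) | N a.
        N \<ge> 1 \<and> (T ^^ N) a = a}"

definition FT :: "('a::topological_space \<Rightarrow> 'a) \<Rightarrow> 'a measure set" where
  "FT T = {mixture I c m | I c m. finite I \<and> (\<forall>i\<in>I. c i \<ge> 0) \<and> (\<Sum>i\<in>I. c i) = 1 \<and>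
                               (\<forall>i\<in>I. m i \<in> periodic_measures T)}"

definition circle_uniform :: "complex measure" where
  "circle_uniform = distr (uniform_measure lborel {0..1::real}) borel (\<lambda>t. cis (2 * pi * t))"

definition steinhaus :: "(complex \<Rightarrow> 'a::real_normed_vector \<Rightarrow> 'a) \<Rightarrow> nat set \<Rightarrow> (nat \<Rightarrow> 'a) \<Rightarrow> 'a measure" where
  "steinhaus cm J x = distr (PiM J (\<lambda>_. circle_uniform)) borel (\<lambda>\<omega>. \<Sum>j\<in>J. cm (\<omega> j) (x j))"

definition ST :: "(complex \<Rightarrow> 'a::real_normed_vector \<Rightarrow> 'a) \<Rightarrow> ('a \<Rightarrow> 'a) \<Rightarrow> 'a measure set" where
  "ST cm T = {steinhaus cm J x | J x. finite J \<and> (\<forall>j\<in>J. x j \<in> unimodular_eigenvectors cm T)}"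

definition FT_closure_on :: "('a::topological_space \<Rightarrow> 'a) \<Rightarrow> 'a set \<Rightarrow> 'a measure set" where
  "FT_closure_on T A = (weak_top closure_of FT T) \<inter> Pr_on A"

definition ST_closure_on ::
  "(complex \<Rightarrow> 'a::real_normed_vector \<Rightarrow> 'a) \<Rightarrow> ('a \<Rightarrow> 'a) \<Rightarrow> 'a set \<Rightarrow> 'a measure set" where
  "ST_closure_on cm T A = (weak_top closure_of ST cm T) \<inter> Pr_on A"

definition dense_gdelta_in :: "'b topology \<Rightarrow> 'b set \<Rightarrow> 'b set \<Rightarrow> bool" where
  "dense_gdelta_in X B A \<longleftrightarrow>
     A \<subseteq> B \<and> gdelta_in (subtopology X B) A \<and> B \<subseteq> X closure_of A"

end

theory Submission
  imports Defs
begin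

text \<open>
  Density is shown by a Baire-type construction carried out with random variables instead of
  measures. A measure in the given class is realised as the law of some \<open>Z\<close>. For every nonempty
  open \<open>V\<close> one adds to \<open>Z\<close> a perturbation of small expected norm, staying in the class, such that
  almost every orbit visits \<open>V\<close>. Running through a countable base and choosing the perturbations
  small enough not to destroy earlier visits, one obtains an almost sure limit with values in
  \<open>HC T\<close>, whose law is a weak limit of laws in the class and is close to the law of \<open>Z\<close>.

  Perfect spanning provides a spanning set of eigenvectors \<open>e\<close> each of which is approximated by
  eigenvectors \<open>e\<^sub>1, \<dots>, e\<^sub>n\<close> with distinct (even rationally independent) eigenvalues. The
  perturbation is built from averages \<open>(\<chi>\<^sub>1 e\<^sub>1 + \<dots> + \<chi>\<^sub>n e\<^sub>n) / n\<close> with orthogonal unimodular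
  \<open>\<chi>\<^sub>s\<close>: its expected norm is of order \<open>1 / sqrt n\<close>, whereas it takes values close to \<open>e\<close> when the
  \<open>\<chi>\<^sub>s\<close> are aligned. For periodic measures the alignment is imposed at the base point of the orbit;
  for Steinhaus measures it is reached along every orbit by Kronecker's theorem.
\<close>

section \<open>The weak topology\<close>

text \<open>Almost sure convergence on a fixed probability space replaces any appeal to completeness
  or metrizability of the weak topology; closure points are only ever exhibited as limits of
  sequences. The price is that the members of a class must be coupled on one space. For orbit
  measures the perturbed period is a multiple of the old one, so the times have to be rearranged;
  the convex hull is reached afterwards, by mixing approximations of the single components. For
  Steinhaus measures the correction leading from \<open>Z\<close> to \<open>V\<close> has
  coefficients that depend on the random point, while a Steinhaus sum has fixed vectors. Hence each
  coefficient is set to a fixed upper bound and only the phases adapt: a number in the unit disc is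
  the average of two unimodular ones. The phases already in \<open>Z\<close> must return while the
  new ones are steered, and the old angles may satisfy arbitrary rational relations. This is why
  Kronecker's theorem is taken relative to given angles and why the new angles avoid countable
  rational spans, which uncountability of the nearby eigenvalues permits.\<close>

lemma topspace_weak_top [simp]: "topspace (weak_top :: 'a::topological_space measure topology) = Pr"
proof -
  have "Pr \<in> (weak_subbasis :: 'a measure set set)"
    unfolding weak_subbasis_def
    by (intro CollectI exI[of _ "\<lambda>_. 0"] exI[of _ UNIV]) auto
  moreover have "\<Union> weak_subbasis \<subseteq> (Pr :: 'a measure set)"
    by (auto simp: weak_subbasis_def)
  ultimately show ?thesis
    unfolding weak_top_def by auto
qed

lemma openin_weak_top_integral:
  fixes f :: "'a::topological_space \<Rightarrow> real"
  assumes "continuous_on UNIV f" "bounded (range f)" "open U"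
  shows "openin weak_top {m \<in> Pr. (\<integral>x. f x \<partial>m) \<in> U}"
proof -
  have "{m \<in> Pr. (\<integral>x. f x \<partial>m) \<in> U} \<in> weak_subbasis"
    using assms by (auto simp: weak_subbasis_def)
  then have "openin (topology_generated_by weak_subbasis) {m \<in> Pr. (\<integral>x. f x \<partial>m) \<in> U}"
    by (rule topology_generated_by_Basis)
  then show ?thesis
    unfolding weak_top_def openin_subtopology by blast
qed

text \<open>Eventual membership is inherited by finite intersections and arbitrary unions, so it is
  enough to test subbasic sets, that is, integrals of bounded continuous functions.\<close>

lemma limitin_weak_top:
  fixes ms :: "nat \<Rightarrow> 'a::topological_space measure"
  assumes m: "m \<in> Pr" and ms: "\<And>s. ms s \<in> Pr"
    and lim: "\<And>f :: 'a \<Rightarrow> real. continuous_on UNIV f \<Longrightarrow> bounded (range f) \<Longrightarrow>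
                (\<lambda>s. \<integral>x. f x \<partial>ms s) \<longlonglongrightarrow> (\<integral>x. f x \<partial>m)"
  shows "limitin weak_top ms m sequentially"
proof -
  have "eventually (\<lambda>s. ms s \<in> U) sequentially"
    if "generate_topology_on weak_subbasis U" "m \<in> U" for U
    using that
  proof (induction rule: generate_topology_on.induct)
    case (Int a b)
    then show ?case by (auto intro: eventually_conj)
  next
    case (UN K)
    then obtain k where "k \<in> K" "m \<in> k" by auto
    with UN have "eventually (\<lambda>s. ms s \<in> k) sequentially" by auto
    then show ?case by eventually_elim (use \<open>k \<in> K\<close> in auto)
  next
    case (Basis S)
    then obtain f :: "'a \<Rightarrow> real" and U where S: "S = {m \<in> Pr. (\<integral>x. f x \<partial>m) \<in> U}"
      and f: "continuous_on UNIV f" "bounded (range f)" "open U"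
      by (auto simp: weak_subbasis_def)
    have "eventually (\<lambda>s. (\<integral>x. f x \<partial>ms s) \<in> U) sequentially"
      using lim[OF f(1,2)] f(3) Basis S by (auto simp: tendsto_def)
    then show ?case by eventually_elim (use S ms in auto)
  qed auto
  then have "limitin (topology_generated_by weak_subbasis) ms m sequentially"
    using m topspace_weak_top
    by (auto simp: limitin_def openin_topology_generated_by_iff weak_top_def)
  then show ?thesis
    unfolding weak_top_def limitin_subtopology using m ms by auto
qed

lemma limitin_sequentially_imp_closure_of:
  assumes "limitin X f l sequentially" "\<And>n. f n \<in> S"
  shows "l \<in> X closure_of S"
  unfolding in_closure_of
  using assms by (auto simp: limitin_sequentially) blast

text \<open>The indicator of an open set is a pointwise limit from below of continuous cut-offs, so
  the set is a union of subbasic ones. This is the lower semicontinuity in the portmanteau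
  theorem.\<close>

lemma openin_weak_top_measure_gt:
  fixes O' :: "'a::metric_space set"
  assumes "open O'"
  shows "openin weak_top {m \<in> Pr. measure m O' > c}"
\<comment> \<open>For \<open>O' = UNIV\<close> the complement is empty and \<open>infdist\<close> to
  it is 0, so the cut-offs of the other case would vanish identically.\<close>
proof (cases "O' = UNIV")
  case True
  have "measure m O' = 1" if "m \<in> Pr" for m
    using that True prob_space.prob_space[of m] sets_eq_imp_space_eq[of m borel] by (simp add: Pr_def)
  then have "{m \<in> Pr. measure m O' > c} = (if 1 > c then Pr else {})" by auto
  then show ?thesis
    by (metis openin_empty openin_topspace topspace_weak_top)
next
  case False
  define f where "f = (\<lambda>(j::nat) x. min 1 (real j * infdist x (- O')))"
  have cont: "continuous_on UNIV (f j)" for j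
    unfolding f_def by (intro continuous_intros)
  have fb: "0 \<le> f j x" "f j x \<le> 1" for j x
    by (auto simp: f_def infdist_nonneg)
  have f_le: "f j x \<le> indicator O' x" for j x
    by (auto simp: f_def indicator_def infdist_nonneg)
  have bdd: "bounded (range (f j))" for j
    unfolding bounded_iff using fb by (intro exI[of _ 1]) (auto simp: abs_le_iff intro: order_trans[of _ 0])
  have f_lim: "(\<lambda>j. f j x) \<longlonglongrightarrow> indicator O' x" for x
  proof (cases "x \<in> O'")
    case True
    have pos: "infdist x (- O') > 0"
      using True False assms by (intro infdist_pos_not_in_closed) (auto simp: closed_Compl)
    obtain n where n: "real n * infdist x (- O') > 1"
      using pos reals_Archimedean3 by blast
    have "eventually (\<lambda>j. f j x = 1) sequentially"
      unfolding eventually_sequentially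
    proof (intro exI allI impI)
      fix j assume "n \<le> j"
      then have "real n * infdist x (- O') \<le> real j * infdist x (- O')"
        by (intro mult_right_mono) (auto simp: infdist_nonneg)
      then show "f j x = 1" using n by (auto simp: f_def)
    qed
    then show ?thesis using True by (simp add: tendsto_eventually)
  next
    case False
    then show ?thesis by (simp add: f_def infdist_zero)
  qed
  have eq: "{m \<in> Pr. measure m O' > c} = (\<Union>j. {m \<in> Pr. (\<integral>x. f j x \<partial>m) \<in> {c<..}})"
  proof (intro equalityI subsetI)
    fix m assume "m \<in> {m \<in> Pr. measure m O' > c}"
    then have m: "prob_space m" "sets m = sets borel" "measure m O' > c" and mP: "m \<in> Pr"
      by (auto simp: Pr_def)
    interpret prob_space m by fact
    note [measurable_cong] = m(2)
    have [measurable]: "f j \<in> borel_measurable m" for j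
      using borel_measurable_continuous_onI[OF cont] m(2) by simp
    have [measurable]: "O' \<in> sets m" using assms m(2) by simp
    have "(\<lambda>j. \<integral>x. f j x \<partial>m) \<longlonglongrightarrow> (\<integral>x. indicator O' x \<partial>m)"
      by (rule integral_dominated_convergence[of _ _ _ "\<lambda>_. 1"])
        (use f_lim fb in \<open>auto simp: abs_le_iff intro: order_trans[of _ 0]\<close>)
    then have "eventually (\<lambda>j. (\<integral>x. f j x \<partial>m) > c) sequentially"
      using m(3) by (intro order_tendstoD) auto
    then show "m \<in> (\<Union>j. {m \<in> Pr. (\<integral>x. f j x \<partial>m) \<in> {c<..}})"
      using mP by (auto dest: eventually_happens)
  next
    fix m assume "m \<in> (\<Union>j. {m \<in> Pr. (\<integral>x. f j x \<partial>m) \<in> {c<..}})"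
    then obtain j where m: "prob_space m" "sets m = sets borel" and mP: "m \<in> Pr" and j: "c < (\<integral>x. f j x \<partial>m)"
      by (auto simp: Pr_def)
    interpret prob_space m by fact
    have [measurable]: "f j \<in> borel_measurable m" for j
      using borel_measurable_continuous_onI[OF cont] m(2) by simp
    have [measurable]: "O' \<in> sets m" using assms m(2) by simp
    have "(\<integral>x. f j x \<partial>m) \<le> (\<integral>x. indicator O' x \<partial>m)"
      using f_le fb by (intro integral_mono integrable_const_bound[of _ 1])
         (auto simp: abs_le_iff intro: order_trans[of _ 0])
    then show "m \<in> {m \<in> Pr. measure m O' > c}" using j mP by auto
  qed
  show ?thesis
    unfolding eq using openin_weak_top_integral[OF cont bdd open_greaterThan]
    by (intro openin_Union) blast
qed

lemma gdelta_in_Pr_on_open: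
  fixes O' :: "'a::metric_space set"
  assumes "open O'"
  shows "gdelta_in weak_top (Pr_on O')"
proof -
  have "Pr_on O' = (\<Inter>k::nat. {m \<in> Pr. measure m O' > 1 - 1 / Suc k})"
  proof (intro equalityI subsetI)
    fix m assume "m \<in> Pr_on O'"
    then show "m \<in> (\<Inter>k::nat. {m \<in> Pr. measure m O' > 1 - 1 / Suc k})"
      by (auto simp: Pr_on_def measure_def)
  next
    fix m assume *: "m \<in> (\<Inter>k::nat. {m \<in> Pr. measure m O' > 1 - 1 / Suc k})"
    then interpret prob_space m by (auto simp: Pr_def)
    have "measure m O' = 1"
    proof (rule ccontr)
      assume "measure m O' \<noteq> 1"
      then have "1 - measure m O' > 0" using prob_le_1[of O'] by linarith
      then obtain k where "inverse (real (Suc k)) < 1 - measure m O'"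
        using reals_Archimedean by blast
      moreover have "measure m O' > 1 - 1 / Suc k" using * by blast
      ultimately show False by (simp add: inverse_eq_divide)
    qed
    then show "m \<in> Pr_on O'" using * by (auto simp: Pr_on_def emeasure_eq_measure)
  qed
  then show ?thesis
    using openin_weak_top_measure_gt[OF assms]
    by (auto intro!: gdelta_in_Inter intro: open_imp_gdelta_in simp del: of_nat_Suc)
qed

section \<open>Hypercyclic vectors as a countable intersection of open sets\<close>

definition visits :: "('a \<Rightarrow> 'a) \<Rightarrow> 'a set \<Rightarrow> 'a set" where
  "visits T V = (\<Union>n. (T ^^ n) -` V)"

lemma open_visits:
  fixes T :: "'a::topological_space \<Rightarrow> 'a"
  assumes "continuous_on UNIV T" "open V"
  shows "open (visits T V)"
proof -
  have "continuous_on UNIV (T ^^ n)" for n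
  proof (induction n)
    case (Suc n)
    then show ?case
      using continuous_on_compose[of UNIV "T ^^ n" T] continuous_on_subset[OF assms(1)] by simp
  qed (simp add: id_def)
  then show ?thesis unfolding visits_def
    using assms(2) by (auto intro!: open_UN open_vimage)
qed

lemma HC_eq_Inter_visits:
  fixes T :: "'a::topological_space \<Rightarrow> 'a"
  assumes "topological_basis B"
  shows "HC T = (\<Inter>V\<in>B - {{}}. visits T V)"
proof (intro equalityI subsetI)
  fix x assume "x \<in> HC T"
  then have dense: "closure (range (\<lambda>n. (T ^^ n) x)) = UNIV" by (simp add: HC_def)
  show "x \<in> (\<Inter>V\<in>B - {{}}. visits T V)"
  proof
    fix V assume V: "V \<in> B - {{}}"
    then have "open V" using assms topological_basis_open by auto
    then have "V \<inter> range (\<lambda>n. (T ^^ n) x) \<noteq> {}"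
      using V dense open_Int_closure_eq_empty[of V "range (\<lambda>n. (T ^^ n) x)"] by auto
    then show "x \<in> visits T V" by (auto simp: visits_def)
  qed
next
  fix x assume x: "x \<in> (\<Inter>V\<in>B - {{}}. visits T V)"
  have "y \<in> closure (range (\<lambda>n. (T ^^ n) x))" for y
    unfolding closure_iff_nhds_not_empty
  proof (intro allI impI)
    fix A U assume "U \<subseteq> A" "y \<in> U" "open U"
    then obtain V where V: "V \<in> B" "y \<in> V" "V \<subseteq> U"
      using assms topological_basisE by metis
    then have "x \<in> visits T V" using x by auto
    then show "range (\<lambda>n. (T ^^ n) x) \<inter> A \<noteq> {}"
      using V \<open>U \<subseteq> A\<close> by (fastforce simp: visits_def)
  qed
  then show "x \<in> HC T" by (auto simp: HC_def)
qed

text \<open>Countably many almost sure events hold simultaneously almost surely. The index set is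
  nonempty because an empty intersection on the right would be the whole type instead of
  \<open>Pr\<close>.\<close>

lemma Pr_on_countable_Inter:
  assumes "countable I" "I \<noteq> {}" "\<And>i. i \<in> I \<Longrightarrow> open (A i)"
  shows "Pr_on (\<Inter>i\<in>I. A i) = (\<Inter>i\<in>I. Pr_on (A i))"
proof -
  have "emeasure m (\<Inter>i\<in>I. A i) = 1 \<longleftrightarrow> (\<forall>i\<in>I. emeasure m (A i) = 1)" if "m \<in> Pr" for m
  proof -
    interpret prob_space m using that by (auto simp: Pr_def)
    have sets: "A i \<in> sets m" if "i \<in> I" for i using assms(3)[OF that] \<open>m \<in> Pr\<close> by (auto simp: Pr_def)
    then have "(\<Inter>i\<in>I. A i) \<in> sets m" using assms(1,2) by (intro sets.countable_INT') auto
    then have "emeasure m (\<Inter>i\<in>I. A i) = 1 \<longleftrightarrow> (AE x in m. \<forall>i\<in>I. x \<in> A i)"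
      by (simp add: emeasure_eq_measure prob_eq_1)
    also have "\<dots> \<longleftrightarrow> (\<forall>i\<in>I. AE x in m. x \<in> A i)"
      using assms(1) by (rule AE_ball_countable)
    also have "\<dots> \<longleftrightarrow> (\<forall>i\<in>I. emeasure m (A i) = 1)"
      using sets by (simp add: emeasure_eq_measure prob_eq_1)
    finally show ?thesis .
  qed
  then show ?thesis using assms(2) by (auto simp: Pr_on_def)
qed


lemma gdelta_in_Pr_on_HC:
  fixes T :: "'a::{metric_space, second_countable_topology} \<Rightarrow> 'a"
  assumes "continuous_on UNIV T"
  shows "gdelta_in weak_top (Pr_on (HC T))"
proof -
  obtain B :: "'a set set" where B: "countable B" "topological_basis B"
    using ex_countable_basis by auto
  have ne: "B - {{}} \<noteq> {}"
  proof -
    obtain V where "V \<in> B" "undefined \<in> V"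
      using topological_basisE[OF B(2) open_UNIV UNIV_I, of undefined] by auto
    then show ?thesis by auto
  qed
  have op: "open (visits T V)" if "V \<in> B - {{}}" for V
    using that assms B(2) by (intro open_visits) (auto simp: topological_basis_open)
  have "Pr_on (HC T) = (\<Inter>V\<in>B - {{}}. Pr_on (visits T V))"
    unfolding HC_eq_Inter_visits[OF B(2)] using B(1) ne op by (intro Pr_on_countable_Inter) auto
  then show ?thesis
    using B(1) ne op by (auto intro!: gdelta_in_Inter gdelta_in_Pr_on_open simp del: Diff_eq_empty_iff)
qed

text \<open>The common frame of both parts of the theorem: the G-delta property is automatic, and
  since the right-hand side of \<open>dense\<close> is closed, density only has to be checked at the
  points of \<open>C\<close> itself, which are explicit, and not at those of its closure.\<close>

lemma dense_gdelta_in_Pr_on_HC: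
  fixes T :: "'a::{metric_space, second_countable_topology} \<Rightarrow> 'a"
  assumes T: "continuous_on UNIV T"
    and dense: "C \<subseteq> weak_top closure_of ((weak_top closure_of C) \<inter> Pr_on (HC T))"
  shows "dense_gdelta_in weak_top ((weak_top closure_of C) \<inter> Pr_on UNIV) ((weak_top closure_of C) \<inter> Pr_on (HC T))"
proof -
  have "Pr_on UNIV = (Pr :: 'a measure set)"
    using prob_space.emeasure_space_1 by (fastforce simp: Pr_on_def Pr_def dest: sets_eq_imp_space_eq)
  moreover have "weak_top closure_of C \<subseteq> Pr"
    using closure_of_subset_topspace[of weak_top C] by simp
  ultimately have UNIV: "(weak_top closure_of C) \<inter> Pr_on UNIV = weak_top closure_of C" by auto
  have "gdelta_in (subtopology weak_top (weak_top closure_of C)) ((weak_top closure_of C) \<inter> Pr_on (HC T))"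
    using gdelta_in_Pr_on_HC[OF T] by (auto simp: gdelta_in_subtopology)
  then show ?thesis
    unfolding dense_gdelta_in_def UNIV using closure_of_minimal[OF dense closedin_closure_of] by auto
qed

section \<open>A Baire argument with random variables\<close>

text \<open>The neighbourhoods of the closed complement shrink to the complement, which
  \<open>Z\<close> avoids almost surely; continuity from above gives the radius. Off the exceptional
  event, a displacement by less than \<open>\<delta>\<close> cannot leave \<open>O'\<close>.\<close>

lemma (in prob_space) open_margin:
  fixes Z :: "'a \<Rightarrow> 'b::{metric_space, second_countable_topology}"
  assumes Z[measurable]: "Z \<in> borel_measurable M" and O: "open O'"
    and AE: "AE \<omega> in M. Z \<omega> \<in> O'" and "\<kappa> > 0"
  shows "\<exists>\<delta>>0. emeasure M {\<omega> \<in> space M. Z \<omega> \<in> (\<Union>y\<in>-O'. ball y \<delta>)} \<le> ennreal \<kappa>"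
proof -
  define A where "A = (\<lambda>k::nat. {\<omega> \<in> space M. Z \<omega> \<in> (\<Union>y\<in>-O'. ball y (1 / Suc k))})"
  have [measurable]: "(\<Union>y\<in>-O'. ball y r) \<in> sets borel" for r
    by (intro borel_open open_UN) auto
  have [measurable]: "O' \<in> sets borel" using O by simp
  have meas[measurable]: "A k \<in> sets M" for k
    unfolding A_def by measurable
  have dec: "decseq A"
  proof (intro decseq_SucI subsetI)
    fix k \<omega> assume "\<omega> \<in> A (Suc k)"
    moreover have "1 / real (Suc (Suc k)) \<le> 1 / real (Suc k)" by (simp add: field_simps)
    ultimately show "\<omega> \<in> A k" unfolding A_def by (fastforce simp del: of_nat_Suc)
  qed
  have "(\<Inter>k. A k) \<subseteq> {\<omega> \<in> space M. Z \<omega> \<notin> O'}"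
  proof
    fix \<omega> assume w: "\<omega> \<in> (\<Inter>k. A k)"
    have "Z \<omega> \<notin> O'"
    proof
      assume "Z \<omega> \<in> O'"
      then obtain e where e: "e > 0" "ball (Z \<omega>) e \<subseteq> O'"
        using O open_contains_ball by blast
      then obtain k where k: "inverse (real (Suc k)) < e" using reals_Archimedean by blast
      from w have "\<omega> \<in> A k" by blast
      then obtain y where "y \<notin> O'" "dist y (Z \<omega>) < 1 / Suc k" by (auto simp: A_def)
      then show False using e k by (auto simp: inverse_eq_divide dist_commute subset_iff)
    qed
    then show "\<omega> \<in> {\<omega> \<in> space M. Z \<omega> \<notin> O'}" using w by (auto simp: A_def)
  qed
  then have "prob (\<Inter>k. A k) \<le> prob {\<omega> \<in> space M. Z \<omega> \<notin> O'}"
    by (rule finite_measure_mono) measurable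
  also have "\<dots> = 0"
    using AE by (subst prob_eq_0) auto
  finally have "(\<lambda>k. prob (A k)) \<longlonglongrightarrow> 0"
    using finite_Lim_measure_decseq[OF image_subsetI[OF meas] dec] by (simp add: measure_le_0_iff)
  then have "eventually (\<lambda>k. prob (A k) < \<kappa>) sequentially"
    using \<open>\<kappa> > 0\<close> by (rule order_tendstoD)
  then obtain k where "prob (A k) < \<kappa>" by (auto dest: eventually_happens)
  then have "emeasure M (A k) \<le> ennreal \<kappa>" by (simp add: emeasure_eq_measure ennreal_leI)
  then show ?thesis
    unfolding A_def by (intro exI[of _ "1 / Suc k"]) auto
qed

text \<open>Repetition is essential: a visit secured at stage \<open>p\<close> may be lost with a
  probability of order \<open>(1/2)^p\<close>, so each basic set has to be treated again at
  arbitrarily late stages.\<close>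

lemma infinitely_often_enumeration:
  assumes "countable B" "B \<noteq> {}"
  obtains U :: "nat \<Rightarrow> 'b" where "range U \<subseteq> B" "\<And>V j. V \<in> B \<Longrightarrow> \<exists>p\<ge>j. U p = V"
proof
  let ?U = "\<lambda>p. from_nat_into B (fst (prod_decode p))"
  show "range ?U \<subseteq> B" using from_nat_into[OF assms(2)] by auto
  fix V j assume "V \<in> B"
  then have "?U (prod_encode (to_nat_on B V, j)) = V" using assms by simp
  then show "\<exists>p\<ge>j. ?U p = V" using le_prod_encode_2 by blast
qed

text \<open>The budgets at least halve, so everything that happens from stage \<open>q\<close> on
  costs at most \<open>e q * (1 + 1/2 + 1/4 + ...)\<close> in expectation.\<close>

lemma geometric_tail_nn_integral:
  fixes Zs :: "nat \<Rightarrow> 'a \<Rightarrow> 'b::{banach, second_countable_topology}"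
  assumes [measurable]: "\<And>p. Zs p \<in> borel_measurable M"
    and D: "\<And>p. (\<integral>\<^sup>+\<omega>. ennreal (norm (Zs (Suc p) \<omega> - Zs p \<omega>)) \<partial>M) \<le> ennreal (e p)"
    and e: "\<And>p. e p > 0" "\<And>p. e (Suc p) \<le> e p / 2"
  shows "(\<integral>\<^sup>+\<omega>. (\<Sum>p. ennreal (norm (Zs (Suc (p + q)) \<omega> - Zs (p + q) \<omega>))) \<partial>M) \<le> ennreal (2 * e q)"
proof -
  have le: "e (p + q) \<le> e q * (1/2) ^ p" for p
  proof (induction p)
    case (Suc p) then show ?case using e(2)[of "p + q"] by simp
  qed simp
  have "(\<integral>\<^sup>+\<omega>. (\<Sum>p. ennreal (norm (Zs (Suc (p + q)) \<omega> - Zs (p + q) \<omega>))) \<partial>M)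
      = (\<Sum>p. \<integral>\<^sup>+\<omega>. ennreal (norm (Zs (Suc (p + q)) \<omega> - Zs (p + q) \<omega>)) \<partial>M)"
    by (intro nn_integral_suminf) auto
  also have "\<dots> \<le> (\<Sum>p. ennreal (e q * (1/2) ^ p))"
    by (intro suminf_le order_trans[OF D] ennreal_leI le) auto
  also have "\<dots> = ennreal (\<Sum>p. e q * (1/2) ^ p)"
    using e(1)[of q] by (intro suminf_ennreal2) (auto intro!: summable_mult)
  also have "(\<Sum>p. e q * (1/2) ^ p) = 2 * e q"
    by (subst suminf_mult) (auto simp: suminf_geometric)
  finally show ?thesis .
qed

lemma increments_summable_limit:
  fixes z :: "nat \<Rightarrow> 'b::banach"
  assumes "(\<Sum>p. ennreal (norm (z (Suc p) - z p))) < \<infinity>"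
  shows "convergent z"
    and "ennreal (norm (lim z - z q)) \<le> (\<Sum>p. ennreal (norm (z (Suc (p + q)) - z (p + q))))"
proof -
  have "summable (\<lambda>p. norm (z (Suc p) - z p))"
    using assms by (intro summable_suminf_not_top) auto
  then have "summable (\<lambda>p. z (Suc p) - z p)" by (rule summable_norm_cancel)
  then have "convergent (\<lambda>n. \<Sum>p<n. z (Suc p) - z p)" by (rule summable_iff_convergent[THEN iffD1])
  then have "convergent (\<lambda>n. z n - z 0)" by (simp add: sum_lessThan_telescope)
  then show conv: "convergent z" using convergent_diff_const_right_iff by blast
  have "(\<lambda>n. ennreal (norm (z (n + q) - z q))) \<longlonglongrightarrow> ennreal (norm (lim z - z q))"
    using conv by (intro tendsto_intros LIMSEQ_ignore_initial_segment) (simp add: convergent_LIMSEQ_iff)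
  then show "ennreal (norm (lim z - z q)) \<le> (\<Sum>p. ennreal (norm (z (Suc (p + q)) - z (p + q))))"
  proof (rule LIMSEQ_le_const2, intro exI allI impI)
    fix n :: nat
    have "z (n + q) - z q = (\<Sum>p<n. z (Suc (p + q)) - z (p + q))"
      using sum_lessThan_telescope[of "\<lambda>p. z (p + q)" n] by simp
    then have "ennreal (norm (z (n + q) - z q)) \<le> ennreal (\<Sum>p<n. norm (z (Suc (p + q)) - z (p + q)))"
      by (intro ennreal_leI) (metis norm_sum)
    also have "\<dots> = (\<Sum>p<n. ennreal (norm (z (Suc (p + q)) - z (p + q))))"
      by (simp add: sum_ennreal)
    also have "\<dots> \<le> (\<Sum>p. ennreal (norm (z (Suc (p + q)) - z (p + q))))"
      by (intro sum_le_suminf) auto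
    finally show "ennreal (norm (z (n + q) - z q)) \<le> \<dots>" .
  qed
qed

text \<open>A change that is small in expectation can still be large on an event of small
  probability, so a visit is never protected on the whole space. What is controlled is the
  probability of losing it, and this tends to 0 along the repetitions of each basic set.\<close>

proposition (in prob_space) randomized_Baire:
  fixes T :: "'b::{banach, second_countable_topology} \<Rightarrow> 'b"
  assumes T: "continuous_on UNIV T"
    and meas: "\<And>Z. Z \<in> \<Z> \<Longrightarrow> Z \<in> borel_measurable M"
    and step: "\<And>Z V \<epsilon>. Z \<in> \<Z> \<Longrightarrow> open V \<Longrightarrow> V \<noteq> {} \<Longrightarrow> \<epsilon> > 0 \<Longrightarrow>
       \<exists>Z'\<in>\<Z>. (\<integral>\<^sup>+\<omega>. ennreal (norm (Z' \<omega> - Z \<omega>)) \<partial>M) \<le> ennreal \<epsilon> \<and> (AE \<omega> in M. Z' \<omega> \<in> visits T V)"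
    and Z: "Z \<in> \<Z>" and \<eta>: "\<eta> > 0"
  obtains W Zs where "W \<in> borel_measurable M" "\<And>p. Zs p \<in> \<Z>"
    "AE \<omega> in M. (\<lambda>p. Zs p \<omega>) \<longlonglongrightarrow> W \<omega>"
    "(\<integral>\<^sup>+\<omega>. ennreal (norm (W \<omega> - Z \<omega>)) \<partial>M) \<le> ennreal \<eta>"
    "AE \<omega> in M. W \<omega> \<in> HC T"
proof -
  obtain B :: "'b set set" where B: "countable B" "topological_basis B"
    using ex_countable_basis by auto
  have ne: "B - {{}} \<noteq> {}"
  proof -
    obtain V where "V \<in> B" "undefined \<in> V"
      using topological_basisE[OF B(2) open_UNIV UNIV_I, of undefined] by auto
    then show ?thesis by auto
  qed
  obtain U :: "nat \<Rightarrow> 'b set" where U: "range U \<subseteq> B - {{}}"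
    and U_inf: "\<And>V j. V \<in> B - {{}} \<Longrightarrow> \<exists>p\<ge>j. U p = V"
    using infinitely_often_enumeration[of "B - {{}}"] B(1) ne by auto
  have U_open: "open (U p)" "U p \<noteq> {}" for p
    using U B(2) by (auto simp: topological_basis_open image_subset_iff)
  have O_open: "open (visits T (U p))" for p
    using T U_open by (intro open_visits)
  \<comment> \<open>A state is a variable together with the budget for its next change. The new
    budget \<open>e'\<close> is fixed only after the margin \<open>\<delta>\<close> of the new visit
    is known: \<open>2 * e'\<close> bounds all later displacement in expectation, so by Markov's
    inequality a displacement by \<open>\<delta>\<close> has probability at most
    \<open>(1/2)^p\<close>.\<close>
  define Q where "Q = (\<lambda>p (Z, e::real) (Z', e'::real).
      (\<integral>\<^sup>+\<omega>. ennreal (norm (Z' \<omega> - Z \<omega>)) \<partial>M) \<le> ennreal e \<and> e' \<le> e / 2 \<and>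
      (\<exists>\<delta>>0. emeasure M {\<omega> \<in> space M. Z' \<omega> \<in> (\<Union>y\<in>- visits T (U p). ball y \<delta>)} \<le> ennreal ((1/2)^p)
         \<and> 2 * e' \<le> \<delta> * (1/2)^p))"
  \<comment> \<open>The clause for \<open>p = 0\<close> pins the starting state, which dependent
    choice leaves open. The initial budget \<open>\<eta> / 2\<close> makes the total expected
    displacement at most \<open>\<eta>\<close>.\<close>
  have "\<exists>f. \<forall>p. (\<lambda>(Z', e'). Z' \<in> \<Z> \<and> e' > 0 \<and> (p = 0 \<longrightarrow> Z' = Z \<and> e' = \<eta> / 2)) (f p) \<and> Q p (f p) (f (Suc p))"
  proof (rule dependent_nat_choice)
    show "\<exists>x. case x of (Z', e') \<Rightarrow> Z' \<in> \<Z> \<and> e' > 0 \<and> (0 = 0 \<longrightarrow> Z' = Z \<and> e' = \<eta> / 2)"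
      using Z \<eta> by (intro exI[of _ "(Z, \<eta> / 2)"]) auto
  next
    fix x :: "('a \<Rightarrow> 'b) \<times> real" and p :: nat
    obtain Z1 e1 where x: "x = (Z1, e1)" by (cases x)
    assume "case x of (Z', e') \<Rightarrow> Z' \<in> \<Z> \<and> e' > 0 \<and> (p = 0 \<longrightarrow> Z' = Z \<and> e' = \<eta> / 2)"
    then have *: "Z1 \<in> \<Z>" "e1 > 0" using x by auto
    from step[OF *(1) U_open *(2)] obtain Z2 where Z2: "Z2 \<in> \<Z>"
      "(\<integral>\<^sup>+\<omega>. ennreal (norm (Z2 \<omega> - Z1 \<omega>)) \<partial>M) \<le> ennreal e1" "AE \<omega> in M. Z2 \<omega> \<in> visits T (U p)"
      by blast
    from open_margin[OF meas[OF Z2(1)] O_open Z2(3), of "(1/2)^p"] obtain \<delta> where \<delta>: "\<delta> > 0"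
      "emeasure M {\<omega> \<in> space M. Z2 \<omega> \<in> (\<Union>y\<in>- visits T (U p). ball y \<delta>)} \<le> ennreal ((1/2)^p)"
      by auto
    define e2 where "e2 = min (e1 / 2) (\<delta> * (1/2)^p / 2)"
    have "e2 > 0" "e2 \<le> e1 / 2" "2 * e2 \<le> \<delta> * (1/2)^p"
      using * \<delta> by (auto simp: e2_def)
    with Z2 \<delta> show "\<exists>y. (case y of (Z', e') \<Rightarrow> Z' \<in> \<Z> \<and> e' > 0 \<and> (Suc p = 0 \<longrightarrow> Z' = Z \<and> e' = \<eta> / 2)) \<and> Q p x y"
      by (intro exI[of _ "(Z2, e2)"]) (auto simp: Q_def x)
  qed
  then obtain f where f0: "\<forall>p. (\<lambda>(Z', e'). Z' \<in> \<Z> \<and> e' > 0 \<and> (p = 0 \<longrightarrow> Z' = Z \<and> e' = \<eta> / 2)) (f p) \<and> Q p (f p) (f (Suc p))"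
    by (rule exE)
  note f = f0[THEN spec, THEN conjunct1] f0[THEN spec, THEN conjunct2]
  define Zs e where "Zs = (\<lambda>p. fst (f p))" and "e = (\<lambda>p. snd (f p))"
  have Zs: "Zs p \<in> \<Z>" "e p > 0" "Zs 0 = Z" "e 0 = \<eta> / 2" for p
    using f(1)[of p] f(1)[of 0] by (auto simp: Zs_def e_def split: prod.splits)
  have Zs_meas[measurable]: "Zs p \<in> borel_measurable M" for p using meas Zs by auto
  have Q: "(\<integral>\<^sup>+\<omega>. ennreal (norm (Zs (Suc p) \<omega> - Zs p \<omega>)) \<partial>M) \<le> ennreal (e p)" "e (Suc p) \<le> e p / 2"
     "\<exists>\<delta>>0. emeasure M {\<omega> \<in> space M. Zs (Suc p) \<omega> \<in> (\<Union>y\<in>- visits T (U p). ball y \<delta>)} \<le> ennreal ((1/2)^p)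
         \<and> 2 * e (Suc p) \<le> \<delta> * (1/2)^p" for p
    using f(2)[of p] by (auto simp: Zs_def e_def Q_def split: prod.splits)
  define R where "R = (\<lambda>q \<omega>. \<Sum>p. ennreal (norm (Zs (Suc (p + q)) \<omega> - Zs (p + q) \<omega>)))"
  have R_meas[measurable]: "R q \<in> borel_measurable M" for q
    unfolding R_def by measurable
  have R: "(\<integral>\<^sup>+\<omega>. R q \<omega> \<partial>M) \<le> ennreal (2 * e q)" for q
    unfolding R_def by (rule geometric_tail_nn_integral[of Zs M e, OF Zs_meas Q(1) Zs(2) Q(2)])
  have "(\<integral>\<^sup>+\<omega>. R 0 \<omega> \<partial>M) \<noteq> \<infinity>" using R[of 0] by (auto simp: top_unique)
  then have AE_R: "AE \<omega> in M. R 0 \<omega> \<noteq> \<infinity>" by (intro nn_integral_PInf_AE) auto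
  define W where "W = (\<lambda>\<omega>. lim (\<lambda>p. Zs p \<omega>))"
  have W_meas[measurable]: "W \<in> borel_measurable M"
    unfolding W_def by measurable
  have fin: "AE \<omega> in M. (\<Sum>p. ennreal (norm (Zs (Suc p) \<omega> - Zs p \<omega>))) < \<infinity>"
    using AE_R by eventually_elim (simp add: R_def less_top)
  have lim: "AE \<omega> in M. (\<lambda>p. Zs p \<omega>) \<longlonglongrightarrow> W \<omega>"
    using fin by eventually_elim (simp add: W_def convergent_LIMSEQ_iff[symmetric] increments_summable_limit(1))
  have bound: "AE \<omega> in M. \<forall>q. ennreal (norm (W \<omega> - Zs q \<omega>)) \<le> R q \<omega>"
    using fin by eventually_elim (unfold W_def R_def, intro allI increments_summable_limit(2))
  have "(\<integral>\<^sup>+\<omega>. ennreal (norm (W \<omega> - Z \<omega>)) \<partial>M) \<le> (\<integral>\<^sup>+\<omega>. R 0 \<omega> \<partial>M)"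
    using bound by (intro nn_integral_mono_AE) (elim eventually_mono, simp flip: Zs(3))
  also have "\<dots> \<le> ennreal \<eta>" using R[of 0] Zs by simp
  finally have close: "(\<integral>\<^sup>+\<omega>. ennreal (norm (W \<omega> - Z \<omega>)) \<partial>M) \<le> ennreal \<eta>" .
  have small: "emeasure M {\<omega> \<in> space M. W \<omega> \<notin> visits T (U p)} \<le> ennreal (2 * (1/2)^p)" for p
  proof -
    let ?O = "visits T (U p)"
    obtain \<delta> where \<delta>: "\<delta> > 0"
      "emeasure M {\<omega> \<in> space M. Zs (Suc p) \<omega> \<in> (\<Union>y\<in>- ?O. ball y \<delta>)} \<le> ennreal ((1/2)^p)"
      "2 * e (Suc p) \<le> \<delta> * (1/2)^p" using Q(3) by blast
    let ?A = "{\<omega> \<in> space M. Zs (Suc p) \<omega> \<in> (\<Union>y\<in>- ?O. ball y \<delta>)}"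
    let ?C = "{\<omega> \<in> space M. 1 \<le> ennreal (1/\<delta>) * R (Suc p) \<omega>}"
    have [measurable]: "(\<Union>y\<in>-?O. ball y \<delta>) \<in> sets borel" "?O \<in> sets borel"
      using O_open by (auto intro!: borel_open open_UN)
    \<comment> \<open>If the limit misses the open set, then either stage \<open>Suc p\<close> was
      already within \<open>\<delta>\<close> of the complement, or the limit is at distance at least
      \<open>\<delta>\<close> from that stage.\<close>
    have "emeasure M {\<omega> \<in> space M. W \<omega> \<notin> ?O} \<le> emeasure M (?A \<union> ?C)"
    proof (rule emeasure_mono_AE)
      show "AE \<omega> in M. \<omega> \<in> {\<omega> \<in> space M. W \<omega> \<notin> ?O} \<longrightarrow> \<omega> \<in> ?A \<union> ?C"
        using bound
      proof (eventually_elim, intro impI)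
        fix \<omega> assume b: "\<forall>q. ennreal (norm (W \<omega> - Zs q \<omega>)) \<le> R q \<omega>" and w: "\<omega> \<in> {\<omega> \<in> space M. W \<omega> \<notin> ?O}"
        show "\<omega> \<in> ?A \<union> ?C"
        proof (cases "dist (W \<omega>) (Zs (Suc p) \<omega>) < \<delta>")
          case True then show ?thesis using w by auto
        next
          case False
          then have "1 \<le> (1 / \<delta>) * norm (W \<omega> - Zs (Suc p) \<omega>)"
            using \<delta>(1) by (simp add: dist_norm field_simps)
          then have "1 \<le> ennreal ((1 / \<delta>) * norm (W \<omega> - Zs (Suc p) \<omega>))"
            using ennreal_leI by fastforce
          also have "\<dots> = ennreal (1/\<delta>) * ennreal (norm (W \<omega> - Zs (Suc p) \<omega>))"
            using \<delta>(1) by (intro ennreal_mult) auto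
          also have "\<dots> \<le> ennreal (1/\<delta>) * R (Suc p) \<omega>"
            using b by (intro mult_left_mono) auto
          finally show ?thesis using w by auto
        qed
      qed
    qed measurable
    also have "\<dots> \<le> emeasure M ?A + emeasure M ?C" by (intro emeasure_subadditive) measurable
    also have "emeasure M ?C \<le> ennreal (1/\<delta>) * (\<integral>\<^sup>+\<omega>. R (Suc p) \<omega> \<partial>M)"
      using nn_integral_Markov_inequality[of "R (Suc p)" "space M" M "ennreal (1/\<delta>)"]
      by (simp cong: nn_integral_cong)
    also have "\<dots> \<le> ennreal (1/\<delta>) * ennreal (2 * e (Suc p))"
      by (intro mult_left_mono R) auto
    also have "\<dots> = ennreal (1/\<delta> * (2 * e (Suc p)))"
      using \<delta>(1) Zs(2)[of "Suc p"] by (intro ennreal_mult[symmetric]) auto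
    also have "\<dots> \<le> ennreal ((1/2)^p)"
      using \<delta> by (intro ennreal_leI) (simp add: field_simps)
    finally have "emeasure M {\<omega> \<in> space M. W \<omega> \<notin> ?O} \<le> emeasure M ?A + ennreal ((1/2)^p)"
      by (simp add: add_left_mono)
    also have "\<dots> \<le> ennreal ((1/2)^p) + ennreal ((1/2)^p)" using \<delta> by (intro add_mono) auto
    also have "\<dots> = ennreal (2 * (1/2)^p)" by (subst ennreal_plus[symmetric]) auto
    finally show ?thesis .
  qed
  have "AE \<omega> in M. \<forall>V\<in>B - {{}}. W \<omega> \<in> visits T V"
  proof (subst AE_ball_countable, use B(1) in simp, intro ballI)
    fix V assume V: "V \<in> B - {{}}"
    have O: "visits T V \<in> sets borel" using O_open U_inf[OF V] by (metis borel_open)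
    \<comment> \<open>\<open>V\<close> occurs as \<open>U p\<close> for arbitrarily large
      \<open>p\<close>, so the bound \<open>2 * (1/2)^p\<close> can be pushed below every
      \<open>r\<close>.\<close>
    have "prob {\<omega> \<in> space M. W \<omega> \<notin> visits T V} \<le> 0"
    proof (rule field_le_epsilon)
      fix r :: real assume "r > 0"
      have "(\<lambda>p. 2 * (1/2)^p) \<longlonglongrightarrow> (2 * 0 :: real)" by (intro tendsto_intros LIMSEQ_realpow_zero) auto
      then have "eventually (\<lambda>p. 2 * (1/2)^p < r) sequentially"
        using \<open>r > 0\<close> by (intro order_tendstoD) auto
      then obtain j where j: "\<And>p. p \<ge> j \<Longrightarrow> 2 * (1/2)^p < r" by (auto simp: eventually_sequentially)
      obtain p where p: "p \<ge> j" "U p = V" using U_inf[OF V] by blast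
      have "prob {\<omega> \<in> space M. W \<omega> \<notin> visits T V} \<le> 2 * (1/2)^p"
        using small[of p] p by (simp add: emeasure_eq_measure)
      then show "prob {\<omega> \<in> space M. W \<omega> \<notin> visits T V} \<le> 0 + r" using j[OF p(1)] by simp
    qed
    then have "prob {\<omega> \<in> space M. W \<omega> \<notin> visits T V} = 0" by (simp add: measure_le_0_iff)
    then show "AE \<omega> in M. W \<omega> \<in> visits T V"
      using O by (subst (asm) prob_eq_0) auto
  qed
  then have "AE \<omega> in M. W \<omega> \<in> HC T"
    by eventually_elim (auto simp: HC_eq_Inter_visits[OF B(2)])
  then show thesis using that W_meas Zs(1) lim close by blast
qed

text \<open>Kept at the level of integrals and apart from \<open>weak_top\<close>, because in this
  form convergence passes through finite mixtures by linearity.\<close>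

definition weak_lim :: "(nat \<Rightarrow> 'a::topological_space measure) \<Rightarrow> 'a measure \<Rightarrow> bool" where
  "weak_lim ms m \<longleftrightarrow> (\<forall>f :: 'a \<Rightarrow> real. continuous_on UNIV f \<longrightarrow> bounded (range f) \<longrightarrow>
     (\<lambda>s. \<integral>x. f x \<partial>ms s) \<longlonglongrightarrow> (\<integral>x. f x \<partial>m))"

lemma weak_lim_closure_of:
  assumes "weak_lim ms m" "m \<in> Pr" "\<And>s. ms s \<in> Pr" "\<And>s. ms s \<in> S"
  shows "m \<in> weak_top closure_of S"
  using limitin_sequentially_imp_closure_of[OF limitin_weak_top] assms unfolding weak_lim_def by blast

lemma (in prob_space) distr_in_Pr: "Z \<in> borel_measurable M \<Longrightarrow> distr M borel Z \<in> Pr"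
  by (simp add: Pr_def prob_space_distr)

lemma (in prob_space) AE_tendsto_imp_weak_lim:
  fixes W :: "'a \<Rightarrow> 'b::metric_space"
  assumes [measurable]: "W \<in> borel_measurable M" "\<And>p. Zs p \<in> borel_measurable M"
    and lim: "AE \<omega> in M. (\<lambda>p. Zs p \<omega>) \<longlonglongrightarrow> W \<omega>"
  shows "weak_lim (\<lambda>p. distr M borel (Zs p)) (distr M borel W)"
  unfolding weak_lim_def
proof (intro allI impI)
  fix f :: "'b \<Rightarrow> real" assume f: "continuous_on UNIV f" "bounded (range f)"
  have [measurable]: "f \<in> borel_measurable borel" using f by (intro borel_measurable_continuous_onI)
  obtain B where B: "\<And>x. norm (f x) \<le> B" using f(2) by (auto simp: bounded_iff)
  have "(\<lambda>p. \<integral>\<omega>. f (Zs p \<omega>) \<partial>M) \<longlonglongrightarrow> (\<integral>\<omega>. f (W \<omega>) \<partial>M)"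
  proof (rule integral_dominated_convergence[of _ _ _ "\<lambda>_. B"])
    show "AE \<omega> in M. (\<lambda>p. f (Zs p \<omega>)) \<longlonglongrightarrow> f (W \<omega>)"
      using lim by eventually_elim (use f(1) in \<open>auto intro: continuous_on_tendsto_compose\<close>)
  qed (use B in auto)
  then show "(\<lambda>p. \<integral>x. f x \<partial>distr M borel (Zs p)) \<longlonglongrightarrow> (\<integral>x. f x \<partial>distr M borel W)"
    by (simp add: integral_distr)
qed

text \<open>Summable expected distances make the sum of the distances almost surely finite, so its
  terms tend to 0; no passage to a subsequence occurs.\<close>

lemma AE_tendsto_of_summable_norm:
  fixes W :: "nat \<Rightarrow> 'a \<Rightarrow> 'b::{banach, second_countable_topology}"
  assumes [measurable]: "Z \<in> borel_measurable M" "\<And>r. W r \<in> borel_measurable M"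
    and close: "\<And>r. (\<integral>\<^sup>+\<omega>. ennreal (norm (W r \<omega> - Z \<omega>)) \<partial>M) \<le> ennreal ((1/2)^r)"
  shows "AE \<omega> in M. (\<lambda>r. W r \<omega>) \<longlonglongrightarrow> Z \<omega>"
proof -
  have "(\<integral>\<^sup>+\<omega>. (\<Sum>r. ennreal (norm (W r \<omega> - Z \<omega>))) \<partial>M) = (\<Sum>r. \<integral>\<^sup>+\<omega>. ennreal (norm (W r \<omega> - Z \<omega>)) \<partial>M)"
    by (intro nn_integral_suminf) auto
  also have "\<dots> \<le> (\<Sum>r. ennreal ((1/2)^r))" by (intro suminf_le close) auto
  also have "\<dots> = ennreal (\<Sum>r. (1/2)^r)" by (intro suminf_ennreal2) auto
  finally have "(\<integral>\<^sup>+\<omega>. (\<Sum>r. ennreal (norm (W r \<omega> - Z \<omega>))) \<partial>M) \<noteq> \<infinity>" by (auto simp: top_unique)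
  then have "AE \<omega> in M. (\<Sum>r. ennreal (norm (W r \<omega> - Z \<omega>))) \<noteq> \<infinity>" by (intro nn_integral_PInf_AE) auto
  then show ?thesis
  proof eventually_elim
    fix \<omega> assume "(\<Sum>r. ennreal (norm (W r \<omega> - Z \<omega>))) \<noteq> \<infinity>"
    then have "summable (\<lambda>r. norm (W r \<omega> - Z \<omega>))" by (intro summable_suminf_not_top) auto
    then have "(\<lambda>r. norm (W r \<omega> - Z \<omega>)) \<longlonglongrightarrow> 0" by (rule summable_LIMSEQ_zero)
    then show "(\<lambda>r. W r \<omega>) \<longlonglongrightarrow> Z \<omega>" by (simp add: tendsto_norm_zero_iff LIM_zero_iff)
  qed
qed

lemma borel_HC:
  fixes T :: "'a::{metric_space, second_countable_topology} \<Rightarrow> 'a"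
  assumes "continuous_on UNIV T"
  shows "HC T \<in> sets borel"
proof -
  obtain B :: "'a set set" where B: "countable B" "topological_basis B"
    using ex_countable_basis by auto
  have "open (visits T V)" if "V \<in> B" for V
    using that assms B(2) by (intro open_visits) (auto simp: topological_basis_open)
  then show ?thesis
    unfolding HC_eq_Inter_visits[OF B(2)] using B(1)
    by (intro sets.countable_INT'') (auto intro: borel_open)
qed

text \<open>Two levels of approximation: \<open>\<mu> r\<close> is the law of a limit variable
  within \<open>(1/2)^r\<close> of \<open>Z\<close> in expectation, and \<open>\<nu> r s\<close> are
  laws from the class tending to \<open>\<mu> r\<close>. Only measures are mentioned in the result,
  so that the periodic case can mix these sequences before closures are taken.\<close>

corollary (in prob_space) randomized_Baire_weak_lim:
  fixes T :: "'b::{banach, second_countable_topology} \<Rightarrow> 'b"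
  assumes T: "continuous_on UNIV T"
    and meas: "\<And>Z. Z \<in> \<Z> \<Longrightarrow> Z \<in> borel_measurable M"
    and step: "\<And>Z V \<epsilon>. Z \<in> \<Z> \<Longrightarrow> open V \<Longrightarrow> V \<noteq> {} \<Longrightarrow> \<epsilon> > 0 \<Longrightarrow>
       \<exists>Z'\<in>\<Z>. (\<integral>\<^sup>+\<omega>. ennreal (norm (Z' \<omega> - Z \<omega>)) \<partial>M) \<le> ennreal \<epsilon> \<and> (AE \<omega> in M. Z' \<omega> \<in> visits T V)"
    and Z: "Z \<in> \<Z>"
  obtains \<mu> \<nu> where "\<And>r. \<mu> r \<in> Pr_on (HC T)" "weak_lim \<mu> (distr M borel Z)"
    "\<And>r. weak_lim (\<nu> r) (\<mu> r)" "\<And>r s. \<nu> r s \<in> distr M borel ` \<Z>"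
proof -
  define P where "P = (\<lambda>r::nat. \<lambda>W Zs. W \<in> borel_measurable M \<and> (\<forall>p. Zs p \<in> \<Z>) \<and>
      (AE \<omega> in M. (\<lambda>p. Zs p \<omega>) \<longlonglongrightarrow> W \<omega>) \<and>
      (\<integral>\<^sup>+\<omega>. ennreal (norm (W \<omega> - Z \<omega>)) \<partial>M) \<le> ennreal ((1/2)^r) \<and> (AE \<omega> in M. W \<omega> \<in> HC T))"
  have "\<exists>W Zs. P r W Zs" for r
    unfolding P_def by (rule randomized_Baire[OF T meas step Z, of "(1/2)^r"]) auto
  then obtain W where "\<forall>r. \<exists>Zs. P r (W r) Zs"
    using choice[of "\<lambda>r W. \<exists>Zs. P r W Zs"] by blast
  then obtain Zs where "\<forall>r. P r (W r) (Zs r)"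
    using choice[of "\<lambda>r. P r (W r)"] by blast
  then have W: "\<And>r. W r \<in> borel_measurable M" "\<And>r p. Zs r p \<in> \<Z>"
      "\<And>r. AE \<omega> in M. (\<lambda>p. Zs r p \<omega>) \<longlonglongrightarrow> W r \<omega>"
      "\<And>r. (\<integral>\<^sup>+\<omega>. ennreal (norm (W r \<omega> - Z \<omega>)) \<partial>M) \<le> ennreal ((1/2)^r)"
      "\<And>r. AE \<omega> in M. W r \<omega> \<in> HC T" unfolding P_def by simp_all
  have "distr M borel (W r) \<in> Pr_on (HC T)" for r
  proof -
    interpret D: prob_space "distr M borel (W r)" using W(1) by (rule prob_space_distr)
    have "AE x in distr M borel (W r). x \<in> HC T"
      using W(1,5) borel_HC[OF T] by (subst AE_distr_iff) auto
    then show ?thesis using W(1) borel_HC[OF T] D.prob_eq_1[of "HC T"]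
      by (auto simp: Pr_on_def distr_in_Pr D.emeasure_eq_measure)
  qed
  moreover have "weak_lim (\<lambda>r. distr M borel (W r)) (distr M borel Z)"
    using W meas Z by (intro AE_tendsto_imp_weak_lim AE_tendsto_of_summable_norm) auto
  moreover have "weak_lim (\<lambda>p. distr M borel (Zs r p)) (distr M borel (W r))" for r
    using W meas by (intro AE_tendsto_imp_weak_lim) auto
  ultimately show thesis using that[of "\<lambda>r. distr M borel (W r)" "\<lambda>r p. distr M borel (Zs r p)"] W(2) by auto
qed

section \<open>Mixtures\<close>

context
  fixes I :: "nat set" and c :: "nat \<Rightarrow> real" and m :: "nat \<Rightarrow> 'a::topological_space measure"
  assumes I: "finite I" and c: "\<And>i. i \<in> I \<Longrightarrow> c i \<ge> 0" and m: "\<And>i. i \<in> I \<Longrightarrow> m i \<in> Pr"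
begin

lemma sets_mixture [simp]: "sets (mixture I c m) = sets borel" "space (mixture I c m) = UNIV"
  using sets.sigma_sets_eq[of "borel :: 'a measure"]
  by (simp_all add: mixture_def sets_measure_of_conv space_measure_of_conv)

lemma emeasure_mixture:
  assumes "A \<in> sets borel"
  shows "emeasure (mixture I c m) A = (\<Sum>i\<in>I. ennreal (c i) * emeasure (m i) A)"
  using mixture_def
proof (rule emeasure_measure_of)
  show "sets borel \<subseteq> Pow (UNIV :: 'a set)" by simp
  show "positive (sets (mixture I c m)) (\<lambda>A. \<Sum>i\<in>I. ennreal (c i) * emeasure (m i) A)"
    by (simp add: positive_def)
  show "A \<in> sets (mixture I c m)" using assms by simp
  show "countably_additive (sets (mixture I c m)) (\<lambda>A. \<Sum>i\<in>I. ennreal (c i) * emeasure (m i) A)"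
  proof (rule countably_additiveI)
    fix A :: "nat \<Rightarrow> 'a set" assume A: "range A \<subseteq> sets (mixture I c m)" "disjoint_family A"
    have "(\<Sum>n. \<Sum>i\<in>I. ennreal (c i) * emeasure (m i) (A n)) = (\<Sum>i\<in>I. \<Sum>n. ennreal (c i) * emeasure (m i) (A n))"
      by (intro suminf_sum) auto
    also have "\<dots> = (\<Sum>i\<in>I. ennreal (c i) * emeasure (m i) (\<Union>n. A n))"
    proof (intro sum.cong refl)
      fix i assume "i \<in> I"
      then have "sets (m i) = sets borel" using m by (auto simp: Pr_def)
      then show "(\<Sum>n. ennreal (c i) * emeasure (m i) (A n)) = ennreal (c i) * emeasure (m i) (\<Union>n. A n)"
        using A by (subst ennreal_suminf_cmult, subst suminf_emeasure) auto
    qed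
    finally show "(\<Sum>n. \<Sum>i\<in>I. ennreal (c i) * emeasure (m i) (A n)) = (\<Sum>i\<in>I. ennreal (c i) * emeasure (m i) (\<Union>n. A n))" .
  qed
qed

lemma nn_integral_mixture:
  assumes "f \<in> borel_measurable borel"
  shows "(\<integral>\<^sup>+x. f x \<partial>mixture I c m) = (\<Sum>i\<in>I. ennreal (c i) * (\<integral>\<^sup>+x. f x \<partial>m i))"
  using assms
proof (induction rule: borel_measurable_induct)
  have sm: "sets (m i) = sets borel" "space (m i) = UNIV" if "i \<in> I" for i
    using m[OF that] by (auto simp: Pr_def dest: sets_eq_imp_space_eq)
  {
    case (cong f g)
    then show ?case by (simp cong: nn_integral_cong)
  next
    case (set A)
    then show ?case using sm by (auto simp: emeasure_mixture intro!: sum.cong)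
  next
    case (mult u v)
    then have "u \<in> borel_measurable (mixture I c m)" "\<And>i. i \<in> I \<Longrightarrow> u \<in> borel_measurable (m i)"
      using sm by (auto cong: measurable_cong_sets)
    with mult show ?case by (simp add: nn_integral_cmult sum_distrib_left mult_ac)
  next
    case (add u v)
    then have "u \<in> borel_measurable (mixture I c m)" "\<And>i. i \<in> I \<Longrightarrow> u \<in> borel_measurable (m i)"
       "v \<in> borel_measurable (mixture I c m)" "\<And>i. i \<in> I \<Longrightarrow> v \<in> borel_measurable (m i)"
      using sm by (auto cong: measurable_cong_sets)
    with add show ?case by (simp add: nn_integral_add distrib_left sum.distrib)
  next
    case (seq U)
    then have U: "\<And>n. U n \<in> borel_measurable (mixture I c m)" "\<And>i n. i \<in> I \<Longrightarrow> U n \<in> borel_measurable (m i)"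
      using sm by (auto cong: measurable_cong_sets)
    have "(\<integral>\<^sup>+x. (SUP n. U n) x \<partial>mixture I c m) = (SUP n. \<integral>\<^sup>+x. U n x \<partial>mixture I c m)"
      using seq U by (simp add: image_image nn_integral_monotone_convergence_SUP)
    also have "\<dots> = (SUP n. \<Sum>i\<in>I. ennreal (c i) * (\<integral>\<^sup>+x. U n x \<partial>m i))" using seq by simp
    also have "\<dots> = (\<Sum>i\<in>I. SUP n. ennreal (c i) * (\<integral>\<^sup>+x. U n x \<partial>m i))"
      using seq by (intro ennreal_SUP_sum)
        (auto simp: incseq_def le_fun_def intro!: mult_left_mono nn_integral_mono)
    also have "\<dots> = (\<Sum>i\<in>I. ennreal (c i) * (\<integral>\<^sup>+x. (SUP n. U n) x \<partial>m i))"
      using seq U by (intro sum.cong refl) (simp add: SUP_mult_left_ennreal nn_integral_monotone_convergence_SUP image_image)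
    finally show ?case .
  }
qed

lemma mixture_in_Pr:
  assumes "(\<Sum>i\<in>I. c i) = 1"
  shows "mixture I c m \<in> Pr"
proof -
  have "emeasure (m i) UNIV = 1" if "i \<in> I" for i
    using m[OF that] prob_space.emeasure_space_1 by (fastforce simp: Pr_def dest: sets_eq_imp_space_eq)
  then have "emeasure (mixture I c m) UNIV = (\<Sum>i\<in>I. ennreal (c i))"
    by (simp add: emeasure_mixture)
  also have "\<dots> = 1" using c assms by (simp add: sum_ennreal)
  finally show ?thesis by (auto simp: Pr_def intro!: prob_spaceI)
qed

lemma mixture_in_Pr_on:
  assumes "(\<Sum>i\<in>I. c i) = 1" "\<And>i. i \<in> I \<Longrightarrow> m i \<in> Pr_on A" "A \<in> sets borel"
  shows "mixture I c m \<in> Pr_on A"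
  using mixture_in_Pr[OF assms(1)] assms c
  by (simp add: Pr_on_def emeasure_mixture sum_ennreal)

text \<open>Adding the bound \<open>B\<close> makes the integrand nonnegative and reduces the
  identity to \<open>nn_integral_mixture\<close>; as the weights sum to 1, the shift cancels on both
  sides.\<close>

lemma integral_mixture:
  fixes f :: "'a \<Rightarrow> real"
  assumes "(\<Sum>i\<in>I. c i) = 1" and f[measurable]: "f \<in> borel_measurable borel" and "bounded (range f)"
  shows "(\<integral>x. f x \<partial>mixture I c m) = (\<Sum>i\<in>I. c i * (\<integral>x. f x \<partial>m i))"
proof -
  obtain B where B: "\<And>x. \<bar>f x\<bar> \<le> B" using assms(3) by (auto simp: bounded_iff)
  have pos: "f x + B \<ge> 0" for x using B[of x] by linarith
  have shift: "(\<integral>x. f x + B \<partial>n) = (\<integral>x. f x \<partial>n) + B" "(\<integral>\<^sup>+x. ennreal (f x + B) \<partial>n) = ennreal (\<integral>x. f x + B \<partial>n)"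
    if "n \<in> Pr" for n
  proof -
    interpret prob_space n using that by (auto simp: Pr_def)
    have [measurable]: "f \<in> borel_measurable n" using that by (simp add: Pr_def cong: measurable_cong_sets)
    have int: "integrable n f" using B by (intro integrable_const_bound[of _ B]) auto
    then show "(\<integral>x. f x + B \<partial>n) = (\<integral>x. f x \<partial>n) + B" by (simp add: prob_space)
    show "(\<integral>\<^sup>+x. ennreal (f x + B) \<partial>n) = ennreal (\<integral>x. f x + B \<partial>n)"
      using int pos by (intro nn_integral_eq_integral) auto
  qed
  have nn: "(\<integral>x. f x + B \<partial>n) \<ge> 0" for n by (intro integral_nonneg_AE) (use pos in auto)
  have "ennreal (\<integral>x. f x + B \<partial>mixture I c m) = (\<integral>\<^sup>+x. ennreal (f x + B) \<partial>mixture I c m)"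
    using shift(2)[OF mixture_in_Pr[OF assms(1)]] by simp
  also have "\<dots> = (\<Sum>i\<in>I. ennreal (c i) * (\<integral>\<^sup>+x. ennreal (f x + B) \<partial>m i))"
    by (intro nn_integral_mixture) auto
  also have "\<dots> = (\<Sum>i\<in>I. ennreal (c i * (\<integral>x. f x + B \<partial>m i)))"
    using shift(2) m c nn by (intro sum.cong) (auto simp: ennreal_mult)
  also have "\<dots> = ennreal (\<Sum>i\<in>I. c i * (\<integral>x. f x + B \<partial>m i))"
    using c nn by (intro sum_ennreal) auto
  finally have "(\<integral>x. f x + B \<partial>mixture I c m) = (\<Sum>i\<in>I. c i * (\<integral>x. f x + B \<partial>m i))"
    using nn c by (subst (asm) ennreal_inj) (auto intro!: sum_nonneg)
  also have "\<dots> = (\<Sum>i\<in>I. c i * (\<integral>x. f x \<partial>m i)) + B"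
    using shift(1) m assms(1) by (simp add: distrib_left sum.distrib flip: sum_distrib_right)
  finally show ?thesis using shift(1)[OF mixture_in_Pr[OF assms(1)]] by simp
qed

end

text \<open>Integration against a mixture is a finite weighted sum. This reduces approximation in
  the convex hull to approximation of single periodic measures.\<close>

lemma weak_lim_mixture:
  assumes "finite I" "\<And>i. i \<in> I \<Longrightarrow> c i \<ge> 0" "(\<Sum>i\<in>I. c i) = 1"
    and "\<And>i. i \<in> I \<Longrightarrow> weak_lim (\<lambda>s. ms s i) (m i)"
    and "\<And>i. i \<in> I \<Longrightarrow> m i \<in> Pr" "\<And>i s. i \<in> I \<Longrightarrow> ms s i \<in> Pr"
  shows "weak_lim (\<lambda>s. mixture I c (ms s)) (mixture I c m)"
  unfolding weak_lim_def
proof (intro allI impI)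
  fix f :: "'a \<Rightarrow> real" assume f: "continuous_on UNIV f" "bounded (range f)"
  have f': "f \<in> borel_measurable borel" using f by (intro borel_measurable_continuous_onI)
  show "(\<lambda>s. \<integral>x. f x \<partial>mixture I c (ms s)) \<longlonglongrightarrow> (\<integral>x. f x \<partial>mixture I c m)"
    using assms f f' by (simp add: integral_mixture weak_lim_def) (auto intro!: tendsto_intros)
qed

section \<open>Eigenvectors with many eigenvalues nearby\<close>

text \<open>Orthogonality removes the mixed terms of the squared modulus, leaving expectation
  \<open>n\<close>. The resulting bound \<open>sqrt n\<close> gains a factor \<open>sqrt n\<close>
  over the triangle inequality, and this gain is what makes the averages small.\<close>

lemma (in prob_space) expectation_norm_sum_orthogonal:
  fixes u :: "nat \<Rightarrow> 'a \<Rightarrow> complex"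
  assumes [measurable]: "\<And>s. s < n \<Longrightarrow> u s \<in> borel_measurable M"
    and norm: "\<And>s \<omega>. s < n \<Longrightarrow> \<omega> \<in> space M \<Longrightarrow> cmod (u s \<omega>) = 1"
    and orth: "\<And>s t. s < n \<Longrightarrow> t < n \<Longrightarrow> s \<noteq> t \<Longrightarrow> expectation (\<lambda>\<omega>. u s \<omega> * cnj (u t \<omega>)) = 0"
    and "n > 0"
  shows "expectation (\<lambda>\<omega>. cmod (\<Sum>s<n. u s \<omega>)) \<le> sqrt n"
    and "integrable M (\<lambda>\<omega>. cmod (\<Sum>s<n. u s \<omega>))"
proof -
  let ?S = "\<lambda>\<omega>. \<Sum>s<n. u s \<omega>"
  have bound: "cmod (?S \<omega>) \<le> n" if "\<omega> \<in> space M" for \<omega>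
    using norm that sum_norm_le[of "{..<n}" "\<lambda>s. u s \<omega>" "\<lambda>_. 1"] by simp
  show int: "integrable M (\<lambda>\<omega>. cmod (?S \<omega>))"
    using bound by (intro integrable_const_bound[of _ n]) auto
  have int2: "integrable M (\<lambda>\<omega>. (cmod (?S \<omega>))\<^sup>2)"
    using bound by (intro integrable_const_bound[of _ "n\<^sup>2"] AE_I2) (auto intro!: power_mono)
  have [measurable]: "cnj \<in> borel_measurable borel"
    by (intro borel_measurable_continuous_onI continuous_intros)
  have intu: "integrable M (\<lambda>\<omega>. u s \<omega> * cnj (u t \<omega>))" if "s < n" "t < n" for s t
    using that norm by (intro integrable_const_bound[of _ 1] AE_I2) (auto simp: norm_mult)
  have "complex_of_real (expectation (\<lambda>\<omega>. (cmod (?S \<omega>))\<^sup>2)) = expectation (\<lambda>\<omega>. of_real ((cmod (?S \<omega>))\<^sup>2))"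
    by (rule integral_complex_of_real[symmetric])
  also have "\<dots> = expectation (\<lambda>\<omega>. \<Sum>s<n. \<Sum>t<n. u s \<omega> * cnj (u t \<omega>))"
    by (simp only: complex_norm_square sum_product cnj_sum)
  also have "\<dots> = (\<Sum>s<n. \<Sum>t<n. expectation (\<lambda>\<omega>. u s \<omega> * cnj (u t \<omega>)))"
    using intu by (subst Bochner_Integration.integral_sum)
      (auto intro!: sum.cong Bochner_Integration.integral_sum Bochner_Integration.integrable_sum)
  also have "\<dots> = (\<Sum>s<n. \<Sum>t<n. if s = t then 1 else 0)"
  proof (intro sum.cong refl)
    fix s t assume "s \<in> {..<n}" "t \<in> {..<n}"
    moreover have "expectation (\<lambda>\<omega>. u s \<omega> * cnj (u s \<omega>)) = expectation (\<lambda>\<omega>. 1)" if "s < n"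
      using norm[OF that] by (intro Bochner_Integration.integral_cong) (auto simp: complex_norm_square[symmetric])
    ultimately show "expectation (\<lambda>\<omega>. u s \<omega> * cnj (u t \<omega>)) = (if s = t then 1 else 0)"
      using orth by (auto simp: prob_space)
  qed
  also have "\<dots> = of_real n" by simp
  finally have sq: "expectation (\<lambda>\<omega>. (cmod (?S \<omega>))\<^sup>2) = n" by (simp only: of_real_eq_iff)
  have pos: "sqrt n > 0" using \<open>n > 0\<close> by simp
  \<comment> \<open>AM-GM in the form \<open>a \<le> (a\<^sup>2 / r + r) / 2\<close> with \<open>r = sqrt n\<close>\<close>
  have "expectation (\<lambda>\<omega>. cmod (?S \<omega>)) \<le> expectation (\<lambda>\<omega>. ((cmod (?S \<omega>))\<^sup>2 / sqrt n + sqrt n) / 2)"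
  proof (intro integral_mono int)
    show "integrable M (\<lambda>\<omega>. ((cmod (?S \<omega>))\<^sup>2 / sqrt n + sqrt n) / 2)" using int2 by auto
    fix \<omega>
    have "2 * cmod (?S \<omega>) * sqrt n \<le> (cmod (?S \<omega>))\<^sup>2 + (sqrt n)\<^sup>2"
      using sum_squares_bound by blast
    then show "cmod (?S \<omega>) \<le> ((cmod (?S \<omega>))\<^sup>2 / sqrt n + sqrt n) / 2"
      using pos by (simp add: field_simps power2_eq_square)
  qed
  also have "\<dots> = (n / sqrt n + sqrt n) / 2"
    using int2 sq by (simp add: prob_space)
  also have "\<dots> = sqrt n" using pos by (simp add: real_div_sqrt)
  finally show "expectation (\<lambda>\<omega>. cmod (?S \<omega>)) \<le> sqrt n" .
qed

text \<open>\<open>a i\<close> will be the norm of a block vector and \<open>c i\<close> the size of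
  its coefficient. Half of \<open>\<epsilon>\<close> is spent on the average, which forces
  \<open>n\<close> to be large, and half on the distance \<open>\<delta>\<close> to the
  approximating eigenvectors. Evenness of \<open>n\<close> lets a block be split into two halves
  with two different phases.\<close>

lemma small_block_parameters:
  fixes a c :: "nat \<Rightarrow> real"
  assumes "\<epsilon> > 0" "\<And>i. c i \<ge> 0"
  shows "\<exists>(n::nat) \<delta>. n > 0 \<and> even n \<and> \<delta> > 0 \<and>
    (\<Sum>i<m. c i * (a i / sqrt n + \<delta>)) \<le> \<epsilon> \<and> (\<Sum>i<m. c i * \<delta>) \<le> \<epsilon>"
proof -
  define A where "A = (\<Sum>i<m. c i * a i)"
  define C where "C = (\<Sum>i<m. c i)"
  have C: "C \<ge> 0" using assms by (auto simp: C_def intro: sum_nonneg)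
  obtain k :: nat where k: "k > (2 * \<bar>A\<bar> / \<epsilon>)\<^sup>2" using reals_Archimedean2 by blast
  define n where "n = 2 * (k + 1)"
  have "sqrt n > 2 * \<bar>A\<bar> / \<epsilon>"
    using k by (intro real_less_rsqrt) (auto simp: n_def)
  then have "\<bar>A\<bar> / sqrt n \<le> \<epsilon> / 2"
    using \<open>\<epsilon> > 0\<close> by (simp add: n_def field_simps)
  then have A: "A / sqrt n \<le> \<epsilon> / 2" by (smt (verit) divide_right_mono real_sqrt_ge_zero of_nat_0_le_iff)
  define \<delta> where "\<delta> = \<epsilon> / (2 * (C + 1))"
  have \<delta>: "\<delta> > 0" "C * \<delta> \<le> \<epsilon> / 2" using C \<open>\<epsilon> > 0\<close> by (auto simp: \<delta>_def field_simps)
  have "(\<Sum>i<m. c i * (a i / sqrt n + \<delta>)) = A / sqrt n + C * \<delta>"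
    by (simp add: A_def C_def distrib_left sum.distrib sum_divide_distrib sum_distrib_right)
  moreover have "A / sqrt n + C * \<delta> \<le> \<epsilon>" using A \<delta>(2) by linarith
  moreover have "(\<Sum>i<m. c i * \<delta>) \<le> \<epsilon>" using \<delta>(2) \<open>\<epsilon> > 0\<close> by (simp add: C_def flip: sum_distrib_right)
  moreover have "n > 0" "even n" by (auto simp: n_def)
  ultimately show ?thesis using \<delta>(1) by (intro exI[of _ n] exI[of _ \<delta>]) simp
qed

section \<open>Complex scalars, iterates and eigenspaces of the operator\<close>

locale complex_operator =
  fixes cm :: "complex \<Rightarrow> 'a::{banach, second_countable_topology} \<Rightarrow> 'a" and T :: "'a \<Rightarrow> 'a"
  assumes cm: "complex_scalar cm" and T: "complex_bounded_linear cm T"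
begin

lemma cm_one [simp]: "cm 1 x = x"
  and cm_cm [simp]: "cm a (cm b x) = cm (a * b) x"
  and cm_add_left: "cm (a + b) x = cm a x + cm b x"
  and cm_add_right: "cm a (x + y) = cm a x + cm a y"
  and norm_cm [simp]: "norm (cm a x) = cmod a * norm x"
  using cm by (auto simp: complex_scalar_def)

lemma norm_cm_le: "cmod a \<le> B \<Longrightarrow> norm (cm a x) \<le> B * norm x"
  by (simp add: mult_right_mono)

lemma cm_zero [simp]: "cm 0 x = 0" "cm a 0 = 0"
  using norm_cm[of 0 x] norm_cm[of a 0] by (simp_all del: norm_cm)

lemma cm_minus_left: "cm (- a) x = - cm a x"
  using cm_add_left[of a "- a" x] by (simp add: eq_neg_iff_add_eq_0 add.commute)

lemma cm_minus_right: "cm a (- x) = - cm a x"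
  using cm_add_right[of a x "- x"] by (simp add: eq_neg_iff_add_eq_0 add.commute)

lemma cm_diff_left: "cm (a - b) x = cm a x - cm b x"
  using cm_add_left[of a "- b" x] by (simp add: cm_minus_left)

lemma cm_diff_right: "cm a (x - y) = cm a x - cm a y"
  using cm_add_right[of a x "- y"] by (simp add: cm_minus_right)

lemma cm_sum_left: "cm (\<Sum>i\<in>I. f i) x = (\<Sum>i\<in>I. cm (f i) x)"
  by (induction I rule: infinite_finite_induct) (auto simp: cm_add_left)

lemma cm_sum_right: "cm a (\<Sum>i\<in>I. f i) = (\<Sum>i\<in>I. cm a (f i))"
  by (induction I rule: infinite_finite_induct) (auto simp: cm_add_right)

lemma cm_eq_iff: "x \<noteq> 0 \<Longrightarrow> cm a x = cm b x \<longleftrightarrow> a = b"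
  using norm_cm[of "a - b" x] by (auto simp: cm_diff_left simp del: norm_cm)

lemma continuous_cm: "continuous_on UNIV (\<lambda>c. cm c x)"
proof (rule continuous_on_iff[THEN iffD2], intro ballI allI impI)
  fix a :: complex and e :: real assume "e > 0"
  show "\<exists>d>0. \<forall>b\<in>UNIV. dist b a < d \<longrightarrow> dist (cm b x) (cm a x) < e"
  proof (intro exI[of _ "e / (norm x + 1)"] conjI ballI impI)
    show "0 < e / (norm x + 1)" using \<open>e > 0\<close> by (simp add: add_nonneg_pos)
    fix b assume "dist b a < e / (norm x + 1)"
    then have "cmod (b - a) * (norm x + 1) < e"
      by (simp add: dist_norm pos_less_divide_eq add_nonneg_pos)
    moreover have "cmod (b - a) * norm x \<le> cmod (b - a) * (norm x + 1)"
      by (intro mult_left_mono) auto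
    ultimately show "dist (cm b x) (cm a x) < e" by (simp add: dist_norm flip: cm_diff_left)
  qed
qed

lemma measurable_cm [measurable (raw)]:
  assumes "f \<in> borel_measurable M"
  shows "(\<lambda>\<omega>. cm (f \<omega>) x) \<in> borel_measurable M"
  using measurable_compose[OF assms borel_measurable_continuous_onI[OF continuous_cm]] .

lemma bounded_linear_T: "bounded_linear T" and T_cm: "T (cm c x) = cm c (T x)"
  using T by (auto simp: complex_bounded_linear_def)

lemma continuous_T: "continuous_on UNIV T"
  using bounded_linear_T by (simp add: linear_continuous_on)

lemma funpow_T_add: "(T ^^ n) (x + y) = (T ^^ n) x + (T ^^ n) y"
  using bounded_linear_T by (induction n) (auto simp: bounded_linear.linear linear_add)

lemma funpow_T_zero [simp]: "(T ^^ n) 0 = 0"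
  using funpow_T_add[of n 0 0] by simp

lemma funpow_T_sum: "(T ^^ n) (\<Sum>i\<in>I. f i) = (\<Sum>i\<in>I. (T ^^ n) (f i))"
  by (induction I rule: infinite_finite_induct) (auto simp: funpow_T_add)

lemma funpow_T_cm: "(T ^^ n) (cm c x) = cm c ((T ^^ n) x)"
  by (induction n) (auto simp: T_cm)

lemma funpow_T_eigenvector: "T x = cm l x \<Longrightarrow> (T ^^ n) x = cm (l ^ n) x"
  by (induction n) (auto simp: T_cm mult.commute)

lemma closed_eigenspace: "closed {x. T x = cm l x}"
proof -
  have "continuous_on UNIV (cm l)"
  proof (rule continuous_on_iff[THEN iffD2], intro ballI allI impI)
    fix x :: 'a and e :: real assume "e > 0"
    show "\<exists>d>0. \<forall>y\<in>UNIV. dist y x < d \<longrightarrow> dist (cm l y) (cm l x) < e"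
    proof (intro exI[of _ "e / (cmod l + 1)"] conjI ballI impI)
      show "0 < e / (cmod l + 1)" using \<open>e > 0\<close> by (simp add: add_nonneg_pos)
      fix y assume "dist y x < e / (cmod l + 1)"
      then have "(cmod l + 1) * norm (y - x) < e"
        by (simp add: dist_norm pos_less_divide_eq add_nonneg_pos mult.commute)
      moreover have "cmod l * norm (y - x) \<le> (cmod l + 1) * norm (y - x)"
        by (intro mult_right_mono) auto
      ultimately show "dist (cm l y) (cm l x) < e" by (simp add: dist_norm flip: cm_diff_right)
    qed
  qed
  then show ?thesis using continuous_T by (intro closed_Collect_eq)
qed

definition eigenvalues_near :: "'a set \<Rightarrow> complex set" where
  "eigenvalues_near A = {l. cmod l = 1 \<and> (\<exists>x\<in>A. x \<noteq> 0 \<and> T x = cm l x)}"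

lemma eigenvalues_near_mono: "A \<subseteq> B \<Longrightarrow> eigenvalues_near A \<subseteq> eigenvalues_near B"
  by (auto simp: eigenvalues_near_def)

text \<open>\<open>e\<close> itself is not asked to be an eigenvector: only eigenvectors close to it
  enter the constructions. Uncountability, rather than infinity, survives the removal of any
  countable set of eigenvalues, such as those with angles in a countable rational span.\<close>

definition accumulating :: "'a \<Rightarrow> bool" where
  "accumulating e \<longleftrightarrow> (\<forall>\<epsilon>>0. uncountable (eigenvalues_near (ball e \<epsilon>)))"

text \<open>Eigenspaces contain 0, which falls outside an argument about nonzero eigenvectors; it is
  removed here by dropping the zero summands.\<close>

lemma cspan_mono_nonzero:
  assumes "S - {0} \<subseteq> S'"
  shows "cspan cm S \<subseteq> cspan cm S'"
proof
  fix x assume "x \<in> cspan cm S"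
  then obtain I :: "nat set" and c v where I: "x = (\<Sum>i\<in>I. cm (c i) (v i))" "finite I" "v ` I \<subseteq> S"
    by (auto simp: cspan_def)
  have "x = (\<Sum>i\<in>{i\<in>I. v i \<noteq> 0}. cm (c i) (v i))"
    unfolding I(1) using I(2) by (intro sum.mono_neutral_right) auto
  moreover have "v ` {i\<in>I. v i \<noteq> 0} \<subseteq> S'" using I(3) assms by auto
  ultimately show "x \<in> cspan cm S'" unfolding cspan_def using I(2) by fastforce
qed

text \<open>Discarding the basic open sets that meet only countably many eigenspaces costs
  countably many eigenvalues.\<close>

lemma closure_cspan_accumulating:
  assumes "perfectly_spanning cm T"
  shows "closure (cspan cm {e. accumulating e}) = UNIV"
proof -
  obtain B :: "'a set set" where B: "countable B" "topological_basis B"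
    using ex_countable_basis by auto
  define D where "D = (\<Union>A\<in>{A\<in>B. countable (eigenvalues_near A)}. eigenvalues_near A)"
  have "countable D" unfolding D_def using B(1) by (intro countable_UN) auto
  then have dense: "closure (cspan cm (\<Union>l\<in>{z. cmod z = 1} - D. eigenspace cm T l)) = UNIV"
    using assms by (auto simp: perfectly_spanning_def)
  have "accumulating e" if e: "e \<noteq> 0" "T e = cm l e" "cmod l = 1" "l \<notin> D" for e l
    unfolding accumulating_def
  proof (intro allI impI)
    fix \<epsilon> :: real assume "\<epsilon> > 0"
    then obtain A where A: "A \<in> B" "e \<in> A" "A \<subseteq> ball e \<epsilon>"
      using topological_basisE[OF B(2) open_ball, of e e \<epsilon>] by auto
    then have "l \<in> eigenvalues_near A" using e by (auto simp: eigenvalues_near_def)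
    then have "uncountable (eigenvalues_near A)" using A e by (auto simp: D_def)
    then show "uncountable (eigenvalues_near (ball e \<epsilon>))"
      using countable_subset[OF eigenvalues_near_mono[OF A(3)]] by blast
  qed
  then have "cspan cm (\<Union>l\<in>{z. cmod z = 1} - D. eigenspace cm T l) \<subseteq> cspan cm {e. accumulating e}"
    by (intro cspan_mono_nonzero) (auto simp: eigenspace_def)
  then show ?thesis using dense closure_mono by blast
qed

text \<open>\<open>cspan\<close> is defined by indexed families, which may repeat a vector.
  Collecting equal vectors turns the coefficients into a function on a finite set, which can then be
  extended to a larger set.\<close>

lemma cspan_finite_support:
  assumes "x \<in> cspan cm S"
  obtains F c where "finite F" "F \<subseteq> S" "x = (\<Sum>e\<in>F. cm (c e) e)"
proof -
  obtain I :: "nat set" and c v where I: "x = (\<Sum>i\<in>I. cm (c i) (v i))" "finite I" "v ` I \<subseteq> S"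
    using assms by (auto simp: cspan_def)
  have "x = (\<Sum>e\<in>v ` I. \<Sum>i\<in>{i\<in>I. v i = e}. cm (c i) (v i))"
    unfolding I(1) using I(2) by (rule sum.image_gen)
  also have "\<dots> = (\<Sum>e\<in>v ` I. cm (\<Sum>i\<in>{i\<in>I. v i = e}. c i) e)"
    by (intro sum.cong refl) (auto simp: cm_sum_left intro!: sum.cong)
  finally show thesis
    using I(2,3) by (intro that[of "v ` I" "\<lambda>e. \<Sum>i\<in>{i\<in>I. v i = e}. c i"]) simp_all
qed

text \<open>A single family \<open>e\<close> serves all \<open>x j\<close> at once. In the Steinhaus
  case the target and the vectors already present must be expanded in the same vectors, so that the
  new terms can cancel the old ones coefficient by coefficient.\<close>

lemma common_approximation:
  assumes S: "closure (cspan cm S) = UNIV" and "finite J" and "\<delta> > 0"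
  shows "\<exists>(m::nat) e c. (\<forall>i<m. e i \<in> S) \<and> (\<forall>j\<in>J. norm (x j - (\<Sum>i<m. cm (c j i) (e i))) < \<delta>)"
proof -
  have "\<exists>F c. finite F \<and> F \<subseteq> S \<and> (\<forall>j\<in>J. norm (x j - (\<Sum>e\<in>F. cm (c j e) e)) < \<delta>)"
    using \<open>finite J\<close>
  proof (induction J)
    case (insert j J)
    then obtain F c where F: "finite F" "F \<subseteq> S" "\<forall>j\<in>J. norm (x j - (\<Sum>e\<in>F. cm (c j e) e)) < \<delta>" by blast
    have "x j \<in> closure (cspan cm S)" using S by simp
    then obtain y where y: "y \<in> cspan cm S" "dist y (x j) < \<delta>"
      using \<open>\<delta> > 0\<close> by (meson closure_approachable)
    obtain F' c' where F': "finite F'" "F' \<subseteq> S" "y = (\<Sum>e\<in>F'. cm (c' e) e)"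
      using cspan_finite_support[OF y(1)] by blast
    \<comment> \<open>Both expansions live on the union of the two supports, with coefficient 0 off
      their own.\<close>
    define d where "d = (\<lambda>k e. if k = j then (if e \<in> F' then c' e else 0) else (if e \<in> F then c k e else 0))"
    have "(\<Sum>e\<in>F \<union> F'. cm (d j e) e) = y"
      unfolding F'(3) using F(1) F'(1) by (intro sum.mono_neutral_cong_right) (auto simp: d_def)
    moreover have "(\<Sum>e\<in>F \<union> F'. cm (d k e) e) = (\<Sum>e\<in>F. cm (c k e) e)" if "k \<in> J" for k
      using F(1) F'(1) that insert.hyps by (intro sum.mono_neutral_cong_right) (auto simp: d_def)
    ultimately show ?case
      using F F' y by (intro exI[of _ "F \<union> F'"] exI[of _ d]) (auto simp: dist_norm norm_minus_commute)
  qed (auto intro: exI[of _ "{}"])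
  then obtain F c where F: "finite F" "F \<subseteq> S" "\<forall>j\<in>J. norm (x j - (\<Sum>e\<in>F. cm (c j e) e)) < \<delta>" by blast
  obtain h where h: "bij_betw h {..<card F} F"
    using ex_bij_betw_nat_finite[OF F(1)] by (auto simp: atLeast0LessThan)
  show ?thesis
  proof (intro exI[of _ "card F"] exI[of _ h] exI[of _ "\<lambda>j i. c j (h i)"] conjI allI ballI impI)
    show "h i \<in> S" if "i < card F" for i using that h F(2) by (auto simp: bij_betw_def)
    show "norm (x j - (\<Sum>i<card F. cm (c j (h i)) (h i))) < \<delta>" if "j \<in> J" for j
      using F(3) that sum.reindex_bij_betw[OF h, of "\<lambda>e. cm (c j e) e"] by simp
  qed
qed

text \<open>The \<open>n\<close> weights \<open>c i / n\<close> of a block have total size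
  \<open>cmod (c i)\<close>, so the error does not grow with \<open>n\<close>, and
  \<open>\<delta>\<close> can be chosen independently of it.\<close>

lemma norm_blocks_le:
  fixes m n :: nat
  assumes "n > 0" and d: "\<And>i s. i < m \<Longrightarrow> s < n \<Longrightarrow> norm (d i s) \<le> \<delta>" and z: "\<And>i s. i < m \<Longrightarrow> s < n \<Longrightarrow> cmod (z i s) = 1"
  shows "norm (\<Sum>i<m. \<Sum>s<n. cm (z i s * (c i / of_nat n)) (d i s)) \<le> (\<Sum>i<m. cmod (c i) * \<delta>)"
proof -
  have "norm (cm (z i s * (c i / of_nat n)) (d i s)) \<le> cmod (c i) / n * \<delta>" if "i < m" "s < n" for i s
    using mult_left_mono[OF d[OF that], of "cmod (c i) / n"] z[OF that] by (simp add: norm_mult norm_divide)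
  then have "norm (\<Sum>i<m. \<Sum>s<n. cm (z i s * (c i / of_nat n)) (d i s)) \<le> (\<Sum>i<m. \<Sum>s<n. cmod (c i) / n * \<delta>)"
    by (intro sum_norm_le) auto
  also have "\<dots> = (\<Sum>i<m. cmod (c i) * \<delta>)" using \<open>n > 0\<close> by simp
  finally show ?thesis .
qed

text \<open>Writing \<open>e' i s\<close> as \<open>e i\<close> plus an error of norm at most
  \<open>\<delta>\<close> turns block \<open>i\<close> into a scalar sum of orthogonal phases times
  the single vector \<open>e i\<close>. Orthogonality acts inside a block; the blocks are put
  together by the triangle inequality.\<close>

lemma blocks_expected_norm_le:
  fixes m n :: nat
  assumes "prob_space M"
    and [measurable]: "\<And>i s. i < m \<Longrightarrow> s < n \<Longrightarrow> u i s \<in> borel_measurable M"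
    and norm: "\<And>i s \<omega>. i < m \<Longrightarrow> s < n \<Longrightarrow> \<omega> \<in> space M \<Longrightarrow> cmod (u i s \<omega>) = 1"
    and orth: "\<And>i s t. i < m \<Longrightarrow> s < n \<Longrightarrow> t < n \<Longrightarrow> s \<noteq> t \<Longrightarrow> (\<integral>\<omega>. u i s \<omega> * cnj (u i t \<omega>) \<partial>M) = 0"
    and "n > 0"
    and close: "\<And>i s. i < m \<Longrightarrow> s < n \<Longrightarrow> norm (e' i s - e i) \<le> \<delta>"
  shows "(\<integral>\<^sup>+\<omega>. ennreal (norm (\<Sum>i<m. \<Sum>s<n. cm (u i s \<omega> * (c i / of_nat n)) (e' i s))) \<partial>M)
    \<le> ennreal (\<Sum>i<m. cmod (c i) * (norm (e i) / sqrt n + \<delta>))"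
proof -
  interpret prob_space M by fact
  let ?S = "\<lambda>i \<omega>. \<Sum>s<n. u i s \<omega>"
  let ?g = "\<lambda>\<omega>. \<Sum>i<m. cmod (c i) * (norm (e i) / n * cmod (?S i \<omega>) + \<delta>)"
  have E: "expectation (\<lambda>\<omega>. cmod (?S i \<omega>)) \<le> sqrt n" "integrable M (\<lambda>\<omega>. cmod (?S i \<omega>))" if "i < m" for i
    using that by (intro expectation_norm_sum_orthogonal norm orth \<open>n > 0\<close>; measurable)+
  have \<delta>: "\<delta> \<ge> 0" if "0 < m" using close[of 0 0] \<open>n > 0\<close> that norm_ge_zero order_trans by blast
  have le: "norm (\<Sum>i<m. \<Sum>s<n. cm (u i s \<omega> * (c i / of_nat n)) (e' i s)) \<le> ?g \<omega>" if w: "\<omega> \<in> space M" for \<omega>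
  proof (rule sum_norm_le)
    fix i assume i: "i \<in> {..<m}"
    have "(\<Sum>s<n. cm (u i s \<omega> * (c i / of_nat n)) (e' i s))
        = cm (?S i \<omega> * (c i / of_nat n)) (e i) + (\<Sum>s<n. cm (u i s \<omega> * (c i / of_nat n)) (e' i s - e i))"
      by (simp only: cm_diff_right sum_subtractf sum_distrib_right cm_sum_left) simp
    also have "norm \<dots> \<le> norm (cm (?S i \<omega> * (c i / of_nat n)) (e i)) + (\<Sum>s<n. cmod (c i) / n * \<delta>)"
      using i w norm close
      by (intro norm_triangle_mono order_refl sum_norm_le)
        (auto simp: norm_mult norm_divide intro!: mult_left_mono divide_right_mono)
    also have "\<dots> = cmod (c i) * (norm (e i) / n * cmod (?S i \<omega>) + \<delta>)"
      using \<open>n > 0\<close> by (simp add: norm_mult norm_divide field_simps)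
    finally show "norm (\<Sum>s<n. cm (u i s \<omega> * (c i / of_nat n)) (e' i s)) \<le> cmod (c i) * (norm (e i) / n * cmod (?S i \<omega>) + \<delta>)" .
  qed
  have int: "integrable M ?g" using E(2) by auto
  have pos: "?g \<omega> \<ge> 0" for \<omega> using \<delta> by (intro sum_nonneg) auto
  have "(\<integral>\<^sup>+\<omega>. ennreal (norm (\<Sum>i<m. \<Sum>s<n. cm (u i s \<omega> * (c i / of_nat n)) (e' i s))) \<partial>M)
      \<le> (\<integral>\<^sup>+\<omega>. ennreal (?g \<omega>) \<partial>M)"
    using le by (intro nn_integral_mono ennreal_leI) auto
  also have "\<dots> = ennreal (expectation ?g)"
    using int pos by (intro nn_integral_eq_integral) auto
  also have "expectation ?g = (\<Sum>i<m. cmod (c i) * (norm (e i) / n * expectation (\<lambda>\<omega>. cmod (?S i \<omega>)) + \<delta>))"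
    using E(2) by (simp add: prob_space)
  also have "\<dots> \<le> (\<Sum>i<m. cmod (c i) * (norm (e i) / n * sqrt n + \<delta>))"
    using E(1) by (intro sum_mono mult_left_mono add_right_mono) auto
  also have "\<dots> = (\<Sum>i<m. cmod (c i) * (norm (e i) / sqrt n + \<delta>))"
    using sqrt_divide_self_eq[of "real n"]
    by (simp only: times_divide_eq_left times_divide_eq_right[symmetric] of_nat_0_le_iff divide_inverse[symmetric])
  finally show ?thesis by (simp add: ennreal_leI)
qed

end

section \<open>Periodic measures\<close>

text \<open>One space serves orbits of all periods: \<open>t\<close> selects the time index
  \<open>nat \<lfloor>real N * t\<rfloor>\<close>, and for a multiple of \<open>N\<close> the
  corresponding partition of the interval is a refinement.\<close>

definition unit_interval_measure :: "real measure" where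
  "unit_interval_measure = uniform_measure lborel {0..1}"

lemma prob_space_unit_interval_measure: "prob_space unit_interval_measure"
  unfolding unit_interval_measure_def by (rule prob_space_uniform_measure) auto

lemma sets_unit_interval_measure [measurable_cong]: "sets unit_interval_measure = sets borel"
  by (simp add: unit_interval_measure_def)

lemma space_unit_interval_measure [simp]: "space unit_interval_measure = UNIV"
  by (simp add: unit_interval_measure_def)

lemma distr_floor_uniform:
  fixes N :: nat
  assumes "N > 0"
  shows "distr unit_interval_measure (count_space UNIV) (\<lambda>t. nat \<lfloor>real N * t\<rfloor>) = measure_pmf (pmf_of_set {..<N})"
proof (rule measure_eqI_countable[of _ UNIV])
  fix i :: nat
  \<comment> \<open>The endpoint \<open>t = 1\<close> yields the index \<open>N\<close>, outside the
    range; it contributes only the null set \<open>{1}\<close>.\<close>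
  have pre: "{0..1} \<inter> (\<lambda>t. nat \<lfloor>real N * t\<rfloor>) -` {i}
      = (if i < N then {real i / N..<(real i + 1) / N} else if i = N then {1} else {})"
  proof (intro set_eqI)
    fix t :: real
    have "nat \<lfloor>real N * t\<rfloor> = i \<longleftrightarrow> real i \<le> real N * t \<and> real N * t < real i + 1" if "0 \<le> t"
    proof -
      have "nat \<lfloor>real N * t\<rfloor> = i \<longleftrightarrow> \<lfloor>real N * t\<rfloor> = int i" using that by (auto simp: nat_eq_iff)
      then show ?thesis by (simp add: floor_eq_iff)
    qed
    moreover have "real N * t \<le> N" if "t \<le> 1" using that assms by simp
    moreover have "t = 1" if "real N * t = N" using that assms by simp
    moreover have "real i \<le> real N * t \<longleftrightarrow> real i / N \<le> t" "real N * t < real i + 1 \<longleftrightarrow> t < (real i + 1) / N"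
      using assms by (auto simp: field_simps)
    moreover have "0 \<le> t" if "real i / N \<le> t"
      using that by (rule order_trans[rotated]) simp
    moreover have "t < 1" if "i < N" "t < (real i + 1) / N"
    proof -
      have "(real i + 1) / N \<le> 1" using that(1) by (simp add: divide_le_eq_1)
      then show ?thesis using that(2) by linarith
    qed
    ultimately show "t \<in> {0..1} \<inter> (\<lambda>t. nat \<lfloor>real N * t\<rfloor>) -` {i}
        \<longleftrightarrow> t \<in> (if i < N then {real i / N..<(real i + 1) / N} else if i = N then {1} else {})"
      by (cases "i < N"; cases "i = N"; force)
  qed
  have meas: "(\<lambda>t. nat \<lfloor>real N * t\<rfloor>) \<in> measurable unit_interval_measure (count_space UNIV)" by measurable
  have "emeasure (distr unit_interval_measure (count_space UNIV) (\<lambda>t. nat \<lfloor>real N * t\<rfloor>)) {i}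
      = emeasure unit_interval_measure ((\<lambda>t. nat \<lfloor>real N * t\<rfloor>) -` {i})"
    using meas by (simp add: emeasure_distr)
  also have "\<dots> = emeasure lborel ({0..1} \<inter> (\<lambda>t. nat \<lfloor>real N * t\<rfloor>) -` {i})"
    using measurable_sets[OF meas, of "{i}"]
    by (simp add: unit_interval_measure_def emeasure_uniform_measure divide_ennreal_def)
  also have "\<dots> = (if i < N then ennreal (1 / N) else 0)"
    unfolding pre using assms by (simp add: divide_right_mono diff_divide_distrib[symmetric])
  also have "\<dots> = emeasure (measure_pmf (pmf_of_set {..<N})) {i}"
    using assms by (auto simp: emeasure_pmf_single pmf_of_set indicator_def lessThan_empty_iff)
  finally show "emeasure (distr unit_interval_measure (count_space UNIV) (\<lambda>t. nat \<lfloor>real N * t\<rfloor>)) {i} = \<dots>" .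
qed (auto simp: prob_space.emeasure_le_1)

text \<open>From \<open>(T ^^ k) b\<close>, a further \<open>k * (N - 1)\<close> steps lead to time
  \<open>N * k\<close>, hence back to \<open>b\<close>. One visit at the base point thus serves the
  whole orbit.\<close>

lemma visits_of_recurrent:
  assumes "(T ^^ N) b = b" "b \<in> V" "N > 0"
  shows "(T ^^ k) b \<in> visits T V"
proof -
  have "(T ^^ (N * j)) b = b" for j
    by (induction j) (auto simp: funpow_add assms(1) add.commute)
  moreover have "k * (N - 1) + k = N * k" using \<open>N > 0\<close> by (cases N) auto
  ultimately have "(T ^^ (k * (N - 1))) ((T ^^ k) b) \<in> V"
    using assms(2) by (metis comp_apply funpow_add)
  then show ?thesis by (auto simp: visits_def)
qed

text \<open>The permutation \<open>\<sigma>\<close> is what allows the orbit of a nearby point, whose period is a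
  multiple of \<open>N\<close>, to be realised on the same probability space and close to the given one.\<close>

definition orbit_variables :: "('a::topological_space \<Rightarrow> 'a) \<Rightarrow> (real \<Rightarrow> 'a) set" where
  "orbit_variables T = {\<lambda>t. (T ^^ \<sigma> (nat \<lfloor>real N * t\<rfloor>)) b | N \<sigma> b.
     N > 0 \<and> bij_betw \<sigma> {..<N} {..<N} \<and> (T ^^ N) b = b}"

lemma measurable_orbit_variables: "Z \<in> orbit_variables T \<Longrightarrow> Z \<in> borel_measurable unit_interval_measure"
  unfolding orbit_variables_def by auto measurable

text \<open>All times of a period carry the same weight, so the law does not see the permutation
  \<open>\<sigma>\<close>; only the coupling between different orbits does.\<close>

lemma distr_orbit_variable:
  fixes T :: "'a::topological_space \<Rightarrow> 'a" and N :: nat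
  assumes "N > 0" "bij_betw \<sigma> {..<N} {..<N}"
  shows "distr unit_interval_measure borel (\<lambda>t. (T ^^ \<sigma> (nat \<lfloor>real N * t\<rfloor>)) b)
    = mixture {..<N} (\<lambda>_. 1 / real N) (\<lambda>n. return borel ((T ^^ n) b))"
proof (rule measure_eqI)
  have ret: "return borel x \<in> Pr" for x :: 'a by (simp add: Pr_def prob_space_return)
  let ?g = "\<lambda>i. (T ^^ \<sigma> i) b"
  have eq: "distr unit_interval_measure borel (\<lambda>t. ?g (nat \<lfloor>real N * t\<rfloor>)) = distr (measure_pmf (pmf_of_set {..<N})) borel ?g"
    unfolding distr_floor_uniform[OF assms(1), symmetric] by (subst distr_distr) (auto simp: comp_def)
  show "sets (distr unit_interval_measure borel (\<lambda>t. ?g (nat \<lfloor>real N * t\<rfloor>)))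
      = sets (mixture {..<N} (\<lambda>_. 1 / real N) (\<lambda>n. return borel ((T ^^ n) b)))"
    by (subst sets_mixture) (auto simp: ret)
  fix A assume "A \<in> sets (distr unit_interval_measure borel (\<lambda>t. ?g (nat \<lfloor>real N * t\<rfloor>)))"
  then have A: "A \<in> sets borel" by simp
  have "emeasure (distr (measure_pmf (pmf_of_set {..<N})) borel ?g) A
      = (\<integral>\<^sup>+i. indicator A (?g i) \<partial>measure_pmf (pmf_of_set {..<N}))"
  proof -
    have "(\<integral>\<^sup>+i. indicator A (?g i) \<partial>measure_pmf (pmf_of_set {..<N}))
        = (\<integral>\<^sup>+i. indicator (?g -` A) i \<partial>measure_pmf (pmf_of_set {..<N}))"
      by (intro nn_integral_cong) (simp add: indicator_def)
    then show ?thesis using A by (simp add: emeasure_distr)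
  qed
  also have "\<dots> = (\<Sum>i<N. indicator A (?g i) :: ennreal) / of_nat N"
    using assms(1) by (subst nn_integral_pmf_of_set) (auto simp: lessThan_empty_iff)
  also have "(\<Sum>i<N. indicator A (?g i)) = (\<Sum>n<N. indicator A ((T ^^ n) b) :: ennreal)"
    by (rule sum.reindex_bij_betw[OF assms(2)])
  also have "\<dots> / of_nat N = ennreal (1 / N) * (\<Sum>n<N. indicator A ((T ^^ n) b))"
  proof -
    have "ennreal (1 / N) = inverse (of_nat N)"
      using divide_ennreal[of 1 "real N"] assms(1) by (simp add: ennreal_of_nat_eq_real_of_nat divide_ennreal_def)
    then show ?thesis by (simp only: divide_ennreal_def mult.commute)
  qed
  also have "\<dots> = (\<Sum>n<N. ennreal (1 / N) * indicator A ((T ^^ n) b))"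
    by (rule sum_distrib_left)
  also have "\<dots> = emeasure (mixture {..<N} (\<lambda>_. 1 / real N) (\<lambda>n. return borel ((T ^^ n) b))) A"
    using A by (subst emeasure_mixture) (auto simp: ret)
  finally show "emeasure (distr unit_interval_measure borel (\<lambda>t. ?g (nat \<lfloor>real N * t\<rfloor>))) A = \<dots>"
    by (simp add: eq)
qed

lemma distr_orbit_variables:
  "distr unit_interval_measure borel ` orbit_variables T = periodic_measures T"
proof (intro equalityI subsetI)
  fix m assume "m \<in> distr unit_interval_measure borel ` orbit_variables T"
  then show "m \<in> periodic_measures T"
    by (auto simp: orbit_variables_def periodic_measures_def distr_orbit_variable) (metis Suc_leI One_nat_def)
next
  fix m assume "m \<in> periodic_measures T"
  then obtain N a where m: "m = mixture {..<N} (\<lambda>_. 1 / real N) (\<lambda>n. return borel ((T ^^ n) a))" "N \<ge> 1" "(T ^^ N) a = a"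
    by (auto simp: periodic_measures_def)
  then have "m = distr unit_interval_measure borel (\<lambda>t. (T ^^ id (nat \<lfloor>real N * t\<rfloor>)) a)"
    by (subst distr_orbit_variable) auto
  moreover have "(\<lambda>t. (T ^^ id (nat \<lfloor>real N * t\<rfloor>)) a) \<in> orbit_variables T"
    unfolding orbit_variables_def using m(2,3)
    by (intro CollectI exI[of _ N] exI[of _ id] exI[of _ a]) auto
  ultimately show "m \<in> distr unit_interval_measure borel ` orbit_variables T" by blast
qed

text \<open>The digits \<open>k div q\<close> and \<open>k mod q\<close> are recombined in base
  \<open>N\<close>, with \<open>\<sigma>\<close> applied to the first. The new time is congruent to
  \<open>\<sigma> (k div q)\<close> modulo \<open>N\<close>, so a point of period \<open>N\<close>
  is seen where it was before, while a point of period \<open>N * q\<close> runs through its full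
  period.\<close>

lemma refine_bijection:
  fixes N q :: nat
  assumes "bij_betw \<sigma> {..<N} {..<N}" "N > 0" "q > 0"
  shows "bij_betw (\<lambda>k. \<sigma> (k div q) + N * (k mod q)) {..<N * q} {..<N * q}"
proof -
  let ?\<tau> = "\<lambda>k. \<sigma> (k div q) + N * (k mod q)"
  have \<sigma>: "\<sigma> (k div q) < N" if "k < N * q" for k
    using bij_betwE[OF assms(1), rule_format, of "k div q"] less_mult_imp_div_less[OF that] by simp
  have into: "?\<tau> k < N * q" if "k < N * q" for k
  proof -
    have "?\<tau> k < N * (k mod q + 1)" using \<sigma>[OF that] by simp
    also have "\<dots> \<le> N * q" using \<open>q > 0\<close> by (intro mult_le_mono2) (simp add: Suc_leI)
    finally show ?thesis .
  qed
  have "inj_on ?\<tau> {..<N * q}"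
  proof (rule inj_onI)
    fix k l assume kl: "k \<in> {..<N * q}" "l \<in> {..<N * q}" and eq: "?\<tau> k = ?\<tau> l"
    then have s: "\<sigma> (k div q) < N" "\<sigma> (l div q) < N" using \<sigma> by auto
    have "\<sigma> (k div q) = \<sigma> (l div q)"
      using arg_cong[OF eq, of "\<lambda>x. x mod N"] s by simp
    moreover have "k mod q = l mod q"
      using arg_cong[OF eq, of "\<lambda>x. x div N"] s \<open>N > 0\<close> by simp
    moreover have "k div q \<in> {..<N}" "l div q \<in> {..<N}" using kl by (auto simp: less_mult_imp_div_less)
    ultimately have "k div q = l div q" using assms(1) by (auto simp: bij_betw_def inj_on_def)
    with \<open>k mod q = l mod q\<close> show "k = l" by (metis div_mult_mod_eq)
  qed
  moreover have "?\<tau> ` {..<N * q} \<subseteq> {..<N * q}" using into by auto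
  ultimately show ?thesis unfolding bij_betw_def using endo_inj_surj[of "{..<N * q}" ?\<tau>] by simp
qed

lemma nat_floor_refine:
  fixes q N :: nat
  assumes "q > 0"
  shows "nat \<lfloor>real (N * q) * t\<rfloor> div q = nat \<lfloor>real N * t\<rfloor>"
proof -
  have "real N * t = real (N * q) * t / real_of_int (int q)" using assms by simp
  then have "\<lfloor>real N * t\<rfloor> = \<lfloor>real (N * q) * t\<rfloor> div int q"
    by (metis floor_divide_real_eq_div of_nat_0_le_iff)
  then show ?thesis using nat_div_distrib'[of "int q" "\<lfloor>real (N * q) * t\<rfloor>"] by simp
qed

lemma sum_powers_root_of_unity:
  fixes z :: complex
  assumes "z ^ N = 1" "z \<noteq> 1"
  shows "(\<Sum>k<N. z ^ k) = 0"
  using assms geometric_sum[of z N] by simp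

section \<open>Perturbing a periodic orbit\<close>

context complex_operator
begin

text \<open>If only finitely many roots of unity occurred, the union of their eigenspaces would be
  closed and contain every periodic eigenvector in the ball, hence by density every unimodular
  eigenvector there. But uncountably many eigenvalues occur in the ball, and a nonzero vector has
  only one. The vectors produced may be 0, which is harmless as they only serve as summands of a
  periodic point.\<close>

lemma infinite_periodic_eigenvalues:
  assumes acc: "accumulating e" and dense: "unimodular_eigenvectors cm T \<subseteq> closure (periodic_eigenvectors cm T)"
    and "\<delta> > 0"
  shows "infinite {l. (\<exists>n>0. l ^ n = 1) \<and> (\<exists>x\<in>ball e \<delta>. T x = cm l x)}" (is "infinite ?F")
proof
  assume fin: "finite ?F"
  have "uncountable (eigenvalues_near (ball e \<delta>))" using acc \<open>\<delta> > 0\<close> by (auto simp: accumulating_def)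
  then have "\<not> eigenvalues_near (ball e \<delta>) \<subseteq> ?F" using fin countable_finite countable_subset by blast
  then obtain l x where l: "l \<notin> ?F" "cmod l = 1" "x \<in> ball e \<delta>" "x \<noteq> 0" "T x = cm l x"
    unfolding eigenvalues_near_def by blast
  let ?C = "\<Union>l\<in>?F. {x. T x = cm l x}"
  have "closed ?C" using fin closed_eigenspace by blast
  have "x \<in> closure (periodic_eigenvectors cm T)" using l dense by (auto simp: unimodular_eigenvectors_def)
  then have "x \<in> closure (ball e \<delta> \<inter> periodic_eigenvectors cm T)"
    using l(3) open_Int_closure_subset[OF open_ball, of e \<delta> "periodic_eigenvectors cm T"] by blast
  also have "ball e \<delta> \<inter> periodic_eigenvectors cm T \<subseteq> ?C"
    by (auto simp: periodic_eigenvectors_def)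
  then have "closure (ball e \<delta> \<inter> periodic_eigenvectors cm T) \<subseteq> ?C"
    using \<open>closed ?C\<close> by (rule closure_minimal)
  finally obtain l' where "l' \<in> ?F" "T x = cm l' x" by blast
  then show False using l cm_eq_iff[of x l l'] by auto
qed

text \<open>The new base point may be far from the old one, yet the two orbits are close on average:
  along a full period the phases of a block run through orthogonal characters of a cyclic
  group.\<close>

lemma orbit_variables_step:
  assumes span: "closure (cspan cm {e. accumulating e}) = UNIV"
    and dense: "unimodular_eigenvectors cm T \<subseteq> closure (periodic_eigenvectors cm T)"
    and Z: "Z \<in> orbit_variables T" and V: "open V" "V \<noteq> {}" and "\<epsilon> > 0"
  shows "\<exists>Z'\<in>orbit_variables T. (\<integral>\<^sup>+\<omega>. ennreal (norm (Z' \<omega> - Z \<omega>)) \<partial>unit_interval_measure) \<le> ennreal \<epsilon>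
     \<and> (AE \<omega> in unit_interval_measure. Z' \<omega> \<in> visits T V)"
proof -
  interpret U: prob_space unit_interval_measure by (rule prob_space_unit_interval_measure)
  obtain N \<sigma> b where N: "N > 0" "bij_betw \<sigma> {..<N} {..<N}" "(T ^^ N) b = b"
    and Z_eq: "Z = (\<lambda>t. (T ^^ \<sigma> (nat \<lfloor>real N * t\<rfloor>)) b)"
    using Z by (auto simp: orbit_variables_def)
  obtain v r where v: "r > 0" "ball v r \<subseteq> V" using V open_contains_ball by blast
  have r2: "r / 2 > 0" using v(1) by simp
  have fin: "finite {0::nat}" by simp
  obtain m :: nat and e c0 where e0: "\<forall>i<m. e i \<in> {e. accumulating e}"
    and approx: "\<forall>j\<in>{0::nat}. norm ((v - b) - (\<Sum>i<m. cm (c0 j i) (e i))) < r / 2"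
    using common_approximation[OF span fin r2, where x = "\<lambda>_. v - b"] by blast
  define c where "c = c0 0"
  have e: "accumulating (e i)" if "i < m" for i using e0 that by simp
  obtain n :: nat and \<delta> where n: "n > 0" "\<delta> > 0"
    and small: "(\<Sum>i<m. cmod (c i) * (norm (e i) / sqrt n + \<delta>)) \<le> min \<epsilon> (r / 4)"
      "(\<Sum>i<m. cmod (c i) * \<delta>) \<le> min \<epsilon> (r / 4)"
    using small_block_parameters[of "min \<epsilon> (r / 4)" "\<lambda>i. cmod (c i)" "\<lambda>i. norm (e i)" m] v(1) \<open>\<epsilon> > 0\<close>
    by auto
  have "\<exists>f::nat \<Rightarrow> complex. inj f \<and> range f \<subseteq> {l. (\<exists>n>0. l ^ n = 1) \<and> (\<exists>x\<in>ball (e i) \<delta>. T x = cm l x)}" if "i < m" for i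
    using infinite_countable_subset[OF infinite_periodic_eigenvalues[OF e[OF that] dense n(2)]] .
  then have "\<exists>\<mu>. \<forall>i\<in>{..<m}. inj (\<mu> i :: nat \<Rightarrow> complex) \<and>
      range (\<mu> i) \<subseteq> {l. (\<exists>n>0. l ^ n = 1) \<and> (\<exists>x\<in>ball (e i) \<delta>. T x = cm l x)}"
    by (intro bchoice) simp
  then obtain \<mu> :: "nat \<Rightarrow> nat \<Rightarrow> complex" where \<mu>0: "\<forall>i\<in>{..<m}. inj (\<mu> i) \<and>
      range (\<mu> i) \<subseteq> {l. (\<exists>n>0. l ^ n = 1) \<and> (\<exists>x\<in>ball (e i) \<delta>. T x = cm l x)}"
    by (rule exE)
  have \<mu>: "inj (\<mu> i)" "\<exists>k>0. \<mu> i s ^ k = 1" "\<exists>x\<in>ball (e i) \<delta>. T x = cm (\<mu> i s) x" if "i < m" for i s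
    using \<mu>0 that by (auto simp: image_subset_iff)
  define k where "k = (\<lambda>i s. SOME k. k > (0::nat) \<and> \<mu> i s ^ k = 1)"
  have k: "k i s > 0 \<and> \<mu> i s ^ k i s = 1" if "i < m" for i s
    unfolding k_def by (rule someI_ex) (use \<mu>(2)[OF that] in simp)
  define e' where "e' = (\<lambda>i s. SOME x. x \<in> ball (e i) \<delta> \<and> T x = cm (\<mu> i s) x)"
  have e': "e' i s \<in> ball (e i) \<delta> \<and> T (e' i s) = cm (\<mu> i s) (e' i s)" if "i < m" for i s
    unfolding e'_def by (rule someI_ex) (use \<mu>(3)[OF that] in \<open>simp add: Bex_def\<close>)
  \<comment> \<open>A common multiple of the orders of all eigenvalues used, so that
    \<open>N * q\<close> is a period of the perturbed point.\<close>
  define q where "q = (\<Prod>i<m. \<Prod>s<n. k i s)"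
  have q: "q > 0" using k by (auto simp: q_def intro!: prod_pos)
  have root: "\<mu> i s ^ (N * q) = 1" if "i < m" "s < n" for i s
  proof -
    have "k i s dvd (\<Prod>s<n. k i s)" using that by (intro dvd_prodI) auto
    also have "\<dots> dvd q" unfolding q_def using that by (intro dvd_prodI) auto
    finally have "k i s dvd N * q" by simp
    then obtain j where j: "N * q = k i s * j" by (rule dvdE)
    show ?thesis unfolding j power_mult using k[OF that(1), of s] by simp
  qed
  have uni: "cmod (\<mu> i s) = 1" if "i < m" for i s
    using k[OF that, of s] power_eq_1_iff[of "\<mu> i s" "k i s"] by auto
  define b' where "b' = b + (\<Sum>i<m. \<Sum>s<n. cm (c i / of_nat n) (e' i s))"
  have orbit: "(T ^^ j) b' = (T ^^ j) b + (\<Sum>i<m. \<Sum>s<n. cm (\<mu> i s ^ j * (c i / of_nat n)) (e' i s))" for j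
    unfolding b'_def funpow_T_add funpow_T_sum funpow_T_cm
    using e' by (simp add: funpow_T_eigenvector mult.commute)
  have per_b: "(T ^^ (N * j)) b = b" for j
    by (induction j) (auto simp: funpow_add N(3) add.commute)
  have per: "(T ^^ (N * q)) b' = b'"
  proof -
    have "(T ^^ (N * q)) b' = b + (\<Sum>i<m. \<Sum>s<n. cm (c i / of_nat n) (e' i s))"
      unfolding orbit per_b using root by simp
    then show ?thesis by (simp add: b'_def)
  qed
  have "b' \<in> V"
  proof -
    have "b' - v = - (v - b - (\<Sum>i<m. cm (c i) (e i))) + (\<Sum>i<m. \<Sum>s<n. cm (c i / of_nat n) (e' i s - e i))"
      using n(1) by (simp add: b'_def cm_diff_right sum_subtractf flip: cm_sum_left)
    \<comment> \<open>\<open>r / 2\<close> is the error of the approximation of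
      \<open>v - b\<close>; the distances to the chosen eigenvectors cost at most
      \<open>r / 4\<close>, rounded up to \<open>r / 3\<close> for a strict bound.\<close>
    also have "norm \<dots> < r / 2 + r / 3"
    proof (rule norm_add_less)
      show "norm (- (v - b - (\<Sum>i<m. cm (c i) (e i)))) < r / 2" using approx unfolding norm_minus_cancel c_def by simp
      have "norm (\<Sum>i<m. \<Sum>s<n. cm (1 * (c i / of_nat n)) (e' i s - e i)) \<le> (\<Sum>i<m. cmod (c i) * \<delta>)"
        using e' n(1) by (intro norm_blocks_le) (auto simp: dist_norm norm_minus_commute intro: less_imp_le)
      then show "norm (\<Sum>i<m. \<Sum>s<n. cm (c i / of_nat n) (e' i s - e i)) < r / 3" using small(2) v(1) by simp
    qed
    finally show "b' \<in> V" using v by (auto simp: dist_norm norm_minus_commute subset_iff)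
  qed
  define \<tau> where "\<tau> = (\<lambda>k. \<sigma> (k div q) + N * (k mod q))"
  have \<tau>: "bij_betw \<tau> {..<N * q} {..<N * q}"
    unfolding \<tau>_def by (rule refine_bijection[OF N(2,1) q])
  define Z' where "Z' = (\<lambda>t. (T ^^ \<tau> (nat \<lfloor>real (N * q) * t\<rfloor>)) b')"
  have "Z' \<in> orbit_variables T"
    unfolding Z'_def orbit_variables_def using N q \<tau> per
    by (intro CollectI exI[of _ "N * q"] exI[of _ \<tau>] exI[of _ b']) auto
  moreover have "Z' t \<in> visits T V" for t
    unfolding Z'_def by (rule visits_of_recurrent[OF per \<open>b' \<in> V\<close>]) (use N q in simp)
  moreover have "(\<integral>\<^sup>+\<omega>. ennreal (norm (Z' \<omega> - Z \<omega>)) \<partial>unit_interval_measure) \<le> ennreal \<epsilon>"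
  proof -
    have Nq: "N * q > 0" using N q by simp
    define u where "u = (\<lambda>i s t. \<mu> i s ^ \<tau> (nat \<lfloor>real (N * q) * t\<rfloor>))"
    \<comment> \<open>\<open>\<tau> k\<close> differs from \<open>\<sigma> (k div q)\<close> by a
      multiple of the period \<open>N\<close> of \<open>b\<close>.\<close>
    have "(T ^^ \<tau> (nat \<lfloor>real (N * q) * t\<rfloor>)) b = Z t" for t
      unfolding \<tau>_def nat_floor_refine[OF q] Z_eq funpow_add comp_apply per_b ..
    then have diff: "Z' t - Z t = (\<Sum>i<m. \<Sum>s<n. cm (u i s t * (c i / of_nat n)) (e' i s))" for t
      unfolding Z'_def orbit u_def by simp
    have meas: "u i s \<in> borel_measurable unit_interval_measure" for i s
      unfolding u_def by measurable
    have "(\<integral>\<omega>. u i s \<omega> * cnj (u i t \<omega>) \<partial>unit_interval_measure) = 0" if "i < m" "s < n" "t < n" "s \<noteq> t" for i s t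
    proof -
      \<comment> \<open>The quotient of two distinct unimodular eigenvalues of one block: a root of
        unity other than 1, whose powers sum to 0 over a full period. The permutation
        \<open>\<tau>\<close> merely reorders these powers.\<close>
      let ?z = "\<mu> i s * cnj (\<mu> i t)"
      have "?z ^ (N * q) = 1" using root that by (simp add: power_mult_distrib flip: complex_cnj_power)
      moreover have "?z \<noteq> 1"
      proof
        assume "?z = 1"
        then have "?z * \<mu> i t = \<mu> i t" by simp
        then have "\<mu> i s * (\<mu> i t * cnj (\<mu> i t)) = \<mu> i t" by (simp add: mult_ac)
        then have "\<mu> i s = \<mu> i t" using uni[OF that(1)] by (simp flip: complex_norm_square)
        then show False using \<mu>(1)[OF that(1)] that by (auto dest: injD)
      qed
      ultimately have z: "(\<Sum>j<N * q. ?z ^ j) = 0" by (rule sum_powers_root_of_unity)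
      have "(\<integral>\<omega>. u i s \<omega> * cnj (u i t \<omega>) \<partial>unit_interval_measure) = (\<integral>\<omega>. ?z ^ \<tau> (nat \<lfloor>real (N * q) * \<omega>\<rfloor>) \<partial>unit_interval_measure)"
        by (simp add: u_def power_mult_distrib)
      also have "\<dots> = (\<integral>j. ?z ^ \<tau> j \<partial>distr unit_interval_measure (count_space UNIV) (\<lambda>\<omega>. nat \<lfloor>real (N * q) * \<omega>\<rfloor>))"
        by (subst integral_distr) auto
      also have "\<dots> = (\<Sum>j<N * q. pmf (pmf_of_set {..<N * q}) j *\<^sub>R ?z ^ \<tau> j)"
        unfolding distr_floor_uniform[OF Nq] using Nq
        by (intro integral_measure_pmf) (auto simp: lessThan_empty_iff)
      also have "\<dots> = (\<Sum>j<N * q. (1 / real (N * q)) *\<^sub>R ?z ^ \<tau> j)"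
        using Nq by (intro sum.cong refl) (simp add: pmf_of_set lessThan_empty_iff)
      also have "\<dots> = (1 / real (N * q)) *\<^sub>R (\<Sum>j<N * q. ?z ^ \<tau> j)"
        by (rule scaleR_sum_right[symmetric])
      also have "(\<Sum>j<N * q. ?z ^ \<tau> j) = (\<Sum>j<N * q. ?z ^ j)"
        by (rule sum.reindex_bij_betw[OF \<tau>])
      finally show ?thesis using z by simp
    qed
    then have "(\<integral>\<^sup>+\<omega>. ennreal (norm (Z' \<omega> - Z \<omega>)) \<partial>unit_interval_measure) \<le> ennreal (\<Sum>i<m. cmod (c i) * (norm (e i) / sqrt n + \<delta>))"
      unfolding diff using meas n e' uni
      by (intro blocks_expected_norm_le[OF prob_space_unit_interval_measure])
        (auto simp: u_def norm_power dist_norm norm_minus_commute intro: less_imp_le)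
    also have "\<dots> \<le> ennreal \<epsilon>" using small by (intro ennreal_leI) auto
    finally show ?thesis .
  qed
  ultimately show ?thesis by (intro bexI[of _ Z']) auto
qed

text \<open>Each component of a convex combination is approximated separately and the weights are
  kept. Mixtures of the \<open>\<nu> i r s\<close> lie in \<open>FT T\<close>, so mixtures of the
  \<open>\<mu> i r\<close> lie in its closure; they give full measure to \<open>HC T\<close> because
  every component does.\<close>

theorem dense_gdelta_FT:
  assumes "perfectly_spanning cm T"
    and "unimodular_eigenvectors cm T \<subseteq> closure (periodic_eigenvectors cm T)"
  shows "dense_gdelta_in weak_top (FT_closure_on T UNIV) (FT_closure_on T (HC T))"
  unfolding FT_closure_on_def
proof (rule dense_gdelta_in_Pr_on_HC[OF continuous_T], rule subsetI)
  fix m assume "m \<in> FT T"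
  then obtain I c ms where m: "m = mixture I c ms" and I: "finite I" "\<And>i. i \<in> I \<Longrightarrow> c i \<ge> 0" "(\<Sum>i\<in>I. c i) = 1"
    and ms: "\<And>i. i \<in> I \<Longrightarrow> ms i \<in> periodic_measures T"
    by (auto simp: FT_def)
  interpret U: prob_space unit_interval_measure by (rule prob_space_unit_interval_measure)
  have per_Pr: "p \<in> Pr" if "p \<in> periodic_measures T" for p
    using that measurable_orbit_variables unfolding distr_orbit_variables[symmetric] by (auto intro: U.distr_in_Pr)
  define P where "P = (\<lambda>i \<mu> \<nu>. (\<forall>r::nat. \<mu> r \<in> Pr_on (HC T)) \<and> weak_lim \<mu> (ms i) \<and> (\<forall>r. weak_lim (\<nu> r) (\<mu> r)) \<and>
    (\<forall>r s. \<nu> r s \<in> periodic_measures T))"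
  have "\<exists>\<mu> \<nu>. P i \<mu> \<nu>" if i: "i \<in> I" for i
  proof -
    obtain Z where Z: "Z \<in> orbit_variables T" "ms i = distr unit_interval_measure borel Z"
      using ms[OF i] unfolding distr_orbit_variables[symmetric] by blast
    show ?thesis
      by (rule U.randomized_Baire_weak_lim[OF continuous_T measurable_orbit_variables
          orbit_variables_step[OF closure_cspan_accumulating[OF assms(1)] assms(2)] Z(1)])
        (auto simp: P_def Z(2) distr_orbit_variables)
  qed
  then have "\<exists>\<mu>. \<forall>i\<in>I. \<exists>\<nu>. P i (\<mu> i) \<nu>" by (intro bchoice) blast
  then obtain \<mu> where "\<forall>i\<in>I. \<exists>\<nu>. P i (\<mu> i) \<nu>" by blast
  then have "\<exists>\<nu>. \<forall>i\<in>I. P i (\<mu> i) (\<nu> i)" by (intro bchoice)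
  then obtain \<nu> where "\<forall>i\<in>I. P i (\<mu> i) (\<nu> i)" by blast
  then have P: "\<And>i r. i \<in> I \<Longrightarrow> \<mu> i r \<in> Pr_on (HC T)" "\<And>i. i \<in> I \<Longrightarrow> weak_lim (\<mu> i) (ms i)"
    "\<And>i r. i \<in> I \<Longrightarrow> weak_lim (\<nu> i r) (\<mu> i r)" "\<And>i r s. i \<in> I \<Longrightarrow> \<nu> i r s \<in> periodic_measures T"
    by (auto simp: P_def)
  have \<mu>_Pr: "\<mu> i r \<in> Pr" if "i \<in> I" for i r using P(1)[OF that] by (auto simp: Pr_on_def)
  have \<nu>_Pr: "\<nu> i r s \<in> Pr" if "i \<in> I" for i r s using per_Pr[OF P(4)[OF that]] .
  have \<mu>_cl: "mixture I c (\<lambda>i. \<mu> i r) \<in> weak_top closure_of FT T" for r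
  proof (rule weak_lim_closure_of)
    show "weak_lim (\<lambda>s. mixture I c (\<lambda>i. \<nu> i r s)) (mixture I c (\<lambda>i. \<mu> i r))"
      using I P(3) \<mu>_Pr \<nu>_Pr by (intro weak_lim_mixture)
    show "mixture I c (\<lambda>i. \<mu> i r) \<in> Pr" using I \<mu>_Pr by (intro mixture_in_Pr)
    show "mixture I c (\<lambda>i. \<nu> i r s) \<in> Pr" for s using I \<nu>_Pr by (intro mixture_in_Pr)
    show "mixture I c (\<lambda>i. \<nu> i r s) \<in> FT T" for s unfolding FT_def using I P(4) by blast
  qed
  have \<mu>_HC: "mixture I c (\<lambda>i. \<mu> i r) \<in> Pr_on (HC T)" for r
    using I \<mu>_Pr P(1) borel_HC[OF continuous_T] by (intro mixture_in_Pr_on)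
  show "m \<in> weak_top closure_of ((weak_top closure_of FT T) \<inter> Pr_on (HC T))"
  proof (rule weak_lim_closure_of)
    show "weak_lim (\<lambda>r. mixture I c (\<lambda>i. \<mu> i r)) m"
      unfolding m using I P(2) \<mu>_Pr per_Pr[OF ms] by (intro weak_lim_mixture)
    show "m \<in> Pr" unfolding m using I per_Pr[OF ms] by (intro mixture_in_Pr)
    show "mixture I c (\<lambda>i. \<mu> i r) \<in> Pr" for r using \<mu>_HC by (auto simp: Pr_on_def)
    show "mixture I c (\<lambda>i. \<mu> i r) \<in> (weak_top closure_of FT T) \<inter> Pr_on (HC T)" for r
      using \<mu>_cl \<mu>_HC by blast
  qed
qed

end

section \<open>Kronecker's theorem relative to given angles\<close>

text \<open>The reals over the rationals: choosing an angle outside a span is then the same as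
  choosing it rationally independent of the earlier ones.\<close>

interpretation rat_vs: vector_space "\<lambda>q::rat. \<lambda>x::real. of_rat q * x"
  by unfold_locales (auto simp: algebra_simps of_rat_add of_rat_mult)

text \<open>An element is determined by a finite subset of \<open>S\<close> and rational
  coefficients. An uncountable set of eigenvalues therefore always leaves the corresponding set of
  phases.\<close>

lemma countable_rat_span:
  assumes "countable S"
  shows "countable (rat_vs.span S)"
proof -
  have "rat_vs.span S \<subseteq> (\<lambda>(t, f). \<Sum>i\<in>t. of_rat (f i) * i) ` (SIGMA t:{t. finite t \<and> t \<subseteq> S}. (t \<rightarrow>\<^sub>E UNIV))"
  proof
    fix x assume "x \<in> rat_vs.span S"
    then obtain t r where t: "finite t" "t \<subseteq> S" "x = (\<Sum>a\<in>t. of_rat (r a) * a)"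
      by (auto simp: rat_vs.span_explicit)
    then have "x = (\<lambda>(t, f). \<Sum>i\<in>t. of_rat (f i) * i) (t, restrict r t)" by auto
    then show "x \<in> (\<lambda>(t, f). \<Sum>i\<in>t. of_rat (f i) * i) ` (SIGMA t:{t. finite t \<and> t \<subseteq> S}. (t \<rightarrow>\<^sub>E UNIV))"
      by (rule image_eqI) (use t in auto)
  qed
  moreover have "countable (SIGMA t:{t. finite t \<and> t \<subseteq> S}. (t \<rightarrow>\<^sub>E (UNIV :: rat set)))"
    using assms by (intro countable_SIGMA countable_Collect_finite_subset countable_PiE) auto
  ultimately show ?thesis by (rule countable_subset[OF _ countable_image])
qed

text \<open>Passes from rational scalars, where spans and bases are available, to the integer
  scalars in which \<open>Kronecker_thm_2\<close> is stated.\<close>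

lemma rat_independent_imp_int_independent:
  assumes "\<not> rat_vs.dependent S"
  shows "module.independent (\<lambda>r x. real_of_int r * x) S"
proof -
  interpret Z: Modules.module "\<lambda>r x. real_of_int r * x"
    by unfold_locales (auto simp: algebra_simps)
  show ?thesis
  proof
    assume "Z.dependent S"
    then obtain t u where t: "finite t" "t \<subseteq> S" "(\<Sum>v\<in>t. real_of_int (u v) * v) = 0" "\<exists>v\<in>t. u v \<noteq> 0"
      unfolding Z.dependent_explicit by blast
    then have "rat_vs.dependent S"
      unfolding rat_vs.dependent_explicit
      by (intro exI[of _ t] exI[of _ "\<lambda>v. rat_of_int (u v)"]) auto
    then show False using assms by blast
  qed
qed

lemma common_denominator:
  fixes r :: "'b \<Rightarrow> rat"
  assumes "finite S"
  obtains Q :: int where "Q > 0" "\<And>a. a \<in> S \<Longrightarrow> \<exists>p::int. real_of_int Q * of_rat (r a) = of_int p"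
proof -
  have "\<exists>Q::int. Q > 0 \<and> (\<forall>a\<in>S. \<exists>p::int. real_of_int Q * of_rat (r a) = of_int p)"
    using assms
  proof (induction S)
    case (insert a S)
    then obtain Q :: int where Q: "Q > 0" "\<forall>a\<in>S. \<exists>p::int. real_of_int Q * of_rat (r a) = of_int p" by blast
    obtain x y where xy: "quotient_of (r a) = (x, y)" by fastforce
    have y: "y > 0" using quotient_of_denom_pos[OF xy] .
    have ra: "of_rat (r a) = real_of_int x / of_int y"
      using quotient_of_div[OF xy] by (simp add: of_rat_divide)
    have "\<exists>p::int. real_of_int (Q * y) * of_rat (r b) = of_int p" if "b \<in> insert a S" for b
    proof (cases "b = a")
      case True
      have "real_of_int (Q * y) * of_rat (r b) = of_int (Q * x)" using y True ra by simp
      then show ?thesis by blast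
    next
      case False
      then have "b \<in> S" using that by simp
      then have "\<exists>p::int. real_of_int Q * of_rat (r b) = of_int p" by (rule bspec[OF Q(2)])
      then obtain p :: int where p: "real_of_int Q * of_rat (r b) = of_int p" by (rule exE)
      have "real_of_int (Q * y) * of_rat (r b) = of_int y * (of_int Q * of_rat (r b))" by simp
      then have "real_of_int (Q * y) * of_rat (r b) = of_int (y * p)" unfolding p by simp
      then show ?thesis by blast
    qed
    then show ?case using Q(1) y by (intro exI[of _ "Q * y"]) auto
  qed (auto intro: exI[of _ 1])
  then show thesis using that by blast
qed

text \<open>Angles are adjoined one at a time, each outside the span of what precedes it; being
  outside the span, it also differs from all of these.\<close>

lemma rat_independent_Un_sequence:
  fixes \<beta> :: "nat \<Rightarrow> real"
  assumes B: "\<not> rat_vs.dependent B"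
    and \<beta>: "\<And>k. k < K \<Longrightarrow> \<beta> k \<notin> rat_vs.span (B \<union> \<beta> ` {..<k})"
  shows "\<not> rat_vs.dependent (B \<union> \<beta> ` {..<K})" "inj_on \<beta> {..<K}" "\<beta> ` {..<K} \<inter> B = {}"
proof -
  show "\<not> rat_vs.dependent (B \<union> \<beta> ` {..<K})" using \<beta>
  proof (induction K)
    case (Suc K)
    then have "\<not> rat_vs.dependent (insert (\<beta> K) (B \<union> \<beta> ` {..<K}))"
      by (intro rat_vs.independent_insertI) auto
    then show ?case by (simp add: lessThan_Suc)
  qed (use B in simp)
  have "\<beta> k \<noteq> \<beta> l" if "k < l" "l < K" for k l
    using \<beta>[of l] that rat_vs.span_base[of "\<beta> k" "B \<union> \<beta> ` {..<l}"] by auto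
  then show "inj_on \<beta> {..<K}" by (metis inj_onI lessThan_iff nat_neq_iff)
  show "\<beta> ` {..<K} \<inter> B = {}"
    using \<beta> rat_vs.span_base by blast
qed

text \<open>The angles in \<open>A\<close> may be rationally dependent, so the classical theorem is
  applied to an independent subset \<open>B\<close> that contains 1 and spans them, together with
  the \<open>\<beta> k\<close>. The members of \<open>A\<close> are rational combinations of
  \<open>B\<close> with a common denominator \<open>Q\<close>; multiplying the integer found by
  \<open>Q\<close> makes the coefficients integral and keeps the angles in \<open>A\<close> near
  integers.\<close>

lemma Kronecker_relative_int:
  fixes \<beta> w :: "nat \<Rightarrow> real"
  assumes "finite A"
    and \<beta>: "\<And>k. k < K \<Longrightarrow> \<beta> k \<notin> rat_vs.span (insert 1 A \<union> \<beta> ` {..<k})"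
    and "\<epsilon> > 0"
  obtains n :: int where "\<And>a. a \<in> A \<Longrightarrow> \<exists>h::int. \<bar>of_int n * a - of_int h\<bar> < \<epsilon>"
    "\<And>k. k < K \<Longrightarrow> \<exists>h::int. \<bar>of_int n * \<beta> k - of_int h - w k\<bar> < \<epsilon>"
proof -
  have "\<not> rat_vs.dependent {1::real}" by simp
  then obtain B where B: "{1} \<subseteq> B" "B \<subseteq> insert 1 A" "\<not> rat_vs.dependent B" "insert 1 A \<subseteq> rat_vs.span B"
    using rat_vs.maximal_independent_subset_extend[of "{1}" "insert 1 A"] by auto
  have span_B: "rat_vs.span (B \<union> \<beta> ` {..<k}) \<subseteq> rat_vs.span (insert 1 A \<union> \<beta> ` {..<k})" for k
    using B(2) by (intro rat_vs.span_mono) auto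
  have ind: "\<not> rat_vs.dependent (B \<union> \<beta> ` {..<K})" "inj_on \<beta> {..<K}" "\<beta> ` {..<K} \<inter> B = {}"
    using rat_independent_Un_sequence[OF B(3), of K \<beta>] \<beta> span_B by blast+
  have finB: "finite B" using B(2) \<open>finite A\<close> finite_subset by blast
  obtain g where g: "bij_betw g {..<card (B - {1})} (B - {1})"
    using ex_bij_betw_nat_finite[of "B - {1}"] finB by (auto simp: atLeast0LessThan)
  define L where "L = card (B - {1})"
  \<comment> \<open>The last entry has to be 1 for \<open>Kronecker_thm_2\<close>; the other entries
    are the \<open>\<beta> k\<close>, followed by the rest of \<open>B\<close>.\<close>
  define \<theta> where "\<theta> = (\<lambda>i. if i < K then \<beta> i else if i < K + L then g (i - K) else 1)"
  have \<theta>_im: "\<theta> ` {..K + L} = B \<union> \<beta> ` {..<K}"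
  proof -
    have "{..K + L} = {..<K} \<union> (\<lambda>i. K + i) ` {..<L} \<union> {K + L}"
    proof (intro equalityI subsetI)
      fix i assume "i \<in> {..K + L}"
      then consider "i < K" | "K \<le> i" "i < K + L" | "i = K + L" by fastforce
      then show "i \<in> {..<K} \<union> (\<lambda>i. K + i) ` {..<L} \<union> {K + L}"
        by cases (auto intro!: image_eqI[of _ _ "i - K"])
    qed auto
    then have "\<theta> ` {..K + L} = \<theta> ` {..<K} \<union> \<theta> ` (\<lambda>i. K + i) ` {..<L} \<union> {\<theta> (K + L)}" by (simp add: image_Un)
    also have "\<theta> ` {..<K} = \<beta> ` {..<K}" by (auto simp: \<theta>_def)
    also have "\<theta> ` (\<lambda>i. K + i) ` {..<L} = g ` {..<L}"
      unfolding image_image by (intro image_cong) (auto simp: \<theta>_def)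
    also have "g ` {..<L} = B - {1}" using g by (simp add: bij_betw_def L_def)
    also have "\<theta> (K + L) = 1" by (simp add: \<theta>_def)
    finally show ?thesis using B(1) by auto
  qed
  have inj: "inj_on \<theta> {..K + L}"
  proof (rule eq_card_imp_inj_on)
    have "card (B \<union> \<beta> ` {..<K}) = card B + K"
      using finB ind(2,3) by (subst card_Un_disjoint) (auto simp: card_image)
    moreover have "card B = Suc L" using B(1) card_Suc_Diff1[OF finB, of 1] unfolding L_def by simp
    ultimately show "card (\<theta> ` {..K + L}) = card {..K + L}" by (simp add: \<theta>_im)
  qed simp
  have "\<exists>r. \<forall>a\<in>insert 1 A. a = (\<Sum>v\<in>B. of_rat (r a v) * v)"
  proof -
    have "\<exists>r. a = (\<Sum>v\<in>B. of_rat (r v) * v)" if "a \<in> insert 1 A" for a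
      using that B(4) rat_vs.span_finite[OF finB] by auto
    then show ?thesis by metis
  qed
  then obtain r where r: "\<And>a. a \<in> A \<Longrightarrow> a = (\<Sum>v\<in>B. of_rat (r a v) * v)" by auto
  have "finite (A \<times> B)" using finB \<open>finite A\<close> by blast
  then obtain Q :: int where Q: "Q > 0"
    "\<And>x. x \<in> A \<times> B \<Longrightarrow> \<exists>p::int. real_of_int Q * of_rat ((\<lambda>(a, v). r a v) x) = of_int p"
    using common_denominator[of "A \<times> B" "\<lambda>(a, v). r a v"] by blast
  then have "\<exists>p. \<forall>a\<in>A. \<forall>v\<in>B. real_of_int Q * of_rat (r a v) = of_int (p a v)"
    by (intro exI[of _ "\<lambda>a v. SOME p. real_of_int Q * of_rat (r a v) = of_int p"] ballI)
      (metis (mono_tags, lifting) SigmaI case_prod_conv someI_ex)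
  then obtain p :: "real \<Rightarrow> real \<Rightarrow> int" where p: "\<And>a v. a \<in> A \<Longrightarrow> v \<in> B \<Longrightarrow> real_of_int Q * of_rat (r a v) = of_int (p a v)"
    by blast
  \<comment> \<open>Bounds both amplification factors of the error: \<open>Q\<close> for the
    \<open>\<beta> k\<close>, and the total size of the integral coefficients for each angle in
    \<open>A\<close>.\<close>
  define C where "C = Q + (\<Sum>a\<in>A. \<Sum>v\<in>B. \<bar>p a v\<bar>)"
  have C: "C > 0" "Q \<le> C" "\<And>a. a \<in> A \<Longrightarrow> (\<Sum>v\<in>B. \<bar>p a v\<bar>) \<le> C"
  proof -
    have nn: "(\<Sum>a\<in>A. \<Sum>v\<in>B. \<bar>p a v\<bar>) \<ge> 0" by (intro sum_nonneg) auto
    then show "C > 0" "Q \<le> C" using Q(1) by (auto simp: C_def)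
    fix a assume "a \<in> A"
    then have "(\<Sum>v\<in>B. \<bar>p a v\<bar>) \<le> (\<Sum>a\<in>A. \<Sum>v\<in>B. \<bar>p a v\<bar>)"
      using \<open>finite A\<close> by (intro member_le_sum) (auto intro: sum_nonneg)
    then show "(\<Sum>v\<in>B. \<bar>p a v\<bar>) \<le> C" using Q(1) by (simp add: C_def)
  qed
  define \<epsilon>' where "\<epsilon>' = \<epsilon> / (2 * C)"
  have "\<epsilon>' > 0" using \<open>\<epsilon> > 0\<close> C by (simp add: \<epsilon>'_def)
  \<comment> \<open>The targets are divided by \<open>Q\<close> because the integer \<open>k\<close>
    is multiplied by \<open>Q\<close> in the end; the angles in \<open>B\<close> are to return to
    0.\<close>
  define \<alpha> where "\<alpha> = (\<lambda>i. if i < K then w i / Q else 0)"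
  obtain k h where kh: "\<And>i. i < K + L \<Longrightarrow> \<bar>of_int k * \<theta> i - of_int (h i) - \<alpha> i\<bar> < \<epsilon>'"
  proof (rule Kronecker_thm_2[of \<theta> "K + L" \<epsilon>' \<alpha>])
    show "module.independent (\<lambda>r x. real_of_int r * x) (\<theta> ` {..K + L})"
      unfolding \<theta>_im by (rule rat_independent_imp_int_independent[OF ind(1)])
  qed (use inj \<open>\<epsilon>' > 0\<close> in \<open>auto simp: \<theta>_def\<close>)
  have kB: "\<exists>m::int. \<bar>of_int k * v - of_int m\<bar> < \<epsilon>'" if "v \<in> B" for v
  proof (cases "v = 1")
    case True
    then show ?thesis using \<open>\<epsilon>' > 0\<close> by (intro exI[of _ k]) simp
  next
    case False
    then have "v \<in> g ` {..<L}" using that g by (simp add: bij_betw_def L_def)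
    then obtain i where "i < L" "g i = v" by auto
    then have "\<bar>of_int k * v - of_int (h (K + i))\<bar> < \<epsilon>'" using kh[of "K + i"] by (simp add: \<theta>_def \<alpha>_def)
    then show ?thesis by blast
  qed
  then obtain m where m: "\<And>v. v \<in> B \<Longrightarrow> \<bar>of_int k * v - real_of_int (m v)\<bar> < \<epsilon>'" by metis
  show thesis
  proof (rule that[of "Q * k"])
    fix a assume a: "a \<in> A"
    have "of_int (Q * k) * a = of_int (Q * k) * (\<Sum>v\<in>B. of_rat (r a v) * v)"
      by (rule arg_cong[OF r[OF a]])
    also have "\<dots> = (\<Sum>v\<in>B. of_int Q * of_rat (r a v) * (of_int k * v))"
      by (simp add: sum_distrib_left mult_ac)
    also have "\<dots> = (\<Sum>v\<in>B. of_int (p a v) * (of_int k * v))" using p[OF a] by simp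
    finally have eq: "of_int (Q * k) * a - of_int (\<Sum>v\<in>B. p a v * m v) = (\<Sum>v\<in>B. of_int (p a v) * (of_int k * v - of_int (m v)))"
      by (simp add: right_diff_distrib sum_subtractf)
    have "\<bar>\<Sum>v\<in>B. of_int (p a v) * (of_int k * v - of_int (m v))\<bar> \<le> (\<Sum>v\<in>B. \<bar>real_of_int (p a v)\<bar> * \<epsilon>')"
      using m by (intro order_trans[OF sum_abs] sum_mono) (auto simp: abs_mult intro!: mult_left_mono intro: less_imp_le)
    also have "\<dots> = of_int (\<Sum>v\<in>B. \<bar>p a v\<bar>) * \<epsilon>'" by (simp add: sum_distrib_right)
    also have "\<dots> \<le> of_int C * \<epsilon>'" using C(3)[OF a] \<open>\<epsilon>' > 0\<close> by (intro mult_right_mono) (simp_all only: of_int_le_iff less_imp_le)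
    also have "\<dots> < \<epsilon>" using \<open>\<epsilon> > 0\<close> C(1) by (simp add: \<epsilon>'_def)
    finally show "\<exists>h::int. \<bar>of_int (Q * k) * a - of_int h\<bar> < \<epsilon>" using eq by metis
  next
    fix i assume i: "i < K"
    have "of_int (Q * k) * \<beta> i - of_int (Q * h i) - w i = of_int Q * (of_int k * \<theta> i - of_int (h i) - \<alpha> i)"
      using i Q(1) by (simp add: \<theta>_def \<alpha>_def algebra_simps)
    then have "\<bar>of_int (Q * k) * \<beta> i - of_int (Q * h i) - w i\<bar> = of_int Q * \<bar>of_int k * \<theta> i - of_int (h i) - \<alpha> i\<bar>"
      using Q(1) by (simp add: abs_mult)
    also have "\<dots> \<le> of_int C * \<epsilon>'"
      using kh[of i] i C Q(1) by (intro mult_mono) auto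
    also have "\<dots> < \<epsilon>" using \<open>\<epsilon> > 0\<close> C(1) by (simp add: \<epsilon>'_def)
    finally show "\<exists>h::int. \<bar>of_int (Q * k) * \<beta> i - of_int h - w i\<bar> < \<epsilon>" by blast
  qed
qed

lemma Dirichlet_simultaneous_finite:
  fixes S :: "real set"
  assumes "finite S" "\<epsilon> > 0"
  obtains q :: nat where "q > 0" "\<And>a. a \<in> S \<Longrightarrow> \<exists>h::int. \<bar>real q * a - of_int h\<bar> < \<epsilon>"
proof -
  obtain g where g: "bij_betw g {..<card S} S"
    using ex_bij_betw_nat_finite[OF assms(1)] by (auto simp: atLeast0LessThan)
  obtain N :: nat where N: "N > 0" "1 / real N < \<epsilon>"
    by (metis assms(2) gr_zeroI inverse_eq_divide real_arch_inverse)
  obtain q p where q: "0 < q" "\<And>i. i < card S \<Longrightarrow> \<bar>of_int q * g i - of_int (p i)\<bar> < 1 / N"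
    using Dirichlet_approx_simult[OF N(1), of "card S" g] by blast
  show thesis
  proof (rule that[of "nat q"])
    fix a assume "a \<in> S"
    then have "a \<in> g ` {..<card S}" using g by (simp add: bij_betw_def)
    then obtain i where "i < card S" "g i = a" by auto
    then have "\<bar>real (nat q) * a - of_int (p i)\<bar> < \<epsilon>" using q N by fastforce
    then show "\<exists>h::int. \<bar>real (nat q) * a - of_int h\<bar> < \<epsilon>" by blast
  qed (use q in simp)
qed

text \<open>Iterating \<open>T\<close> requires a natural number, whereas the integer version may
  give a negative one. The precision demanded of the return time \<open>q\<close> depends on
  \<open>l\<close>, the absolute value of that integer, so that adding \<open>q\<close> up to
  \<open>l\<close> times still costs at most \<open>\<epsilon> / 2\<close>.\<close>

proposition Kronecker_relative:
  fixes \<beta> w :: "nat \<Rightarrow> real"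
  assumes "finite A"
    and \<beta>: "\<And>k. k < K \<Longrightarrow> \<beta> k \<notin> rat_vs.span (insert 1 A \<union> \<beta> ` {..<k})"
    and "\<epsilon> > 0"
  obtains n :: nat where "\<And>a. a \<in> A \<Longrightarrow> \<exists>h::int. \<bar>real n * a - of_int h\<bar> < \<epsilon>"
    "\<And>k. k < K \<Longrightarrow> \<exists>h::int. \<bar>real n * \<beta> k - of_int h - w k\<bar> < \<epsilon>"
proof -
  obtain k :: int where k: "\<And>a. a \<in> A \<Longrightarrow> \<exists>h::int. \<bar>of_int k * a - of_int h\<bar> < \<epsilon> / 2"
    "\<And>i. i < K \<Longrightarrow> \<exists>h::int. \<bar>of_int k * \<beta> i - of_int h - w i\<bar> < \<epsilon> / 2"
    using Kronecker_relative_int[OF assms(1,2), of K "\<epsilon> / 2" w] \<open>\<epsilon> > 0\<close> by auto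
  define l where "l = nat \<bar>k\<bar>"
  obtain q :: nat where q: "q > 0" "\<And>a. a \<in> A \<union> \<beta> ` {..<K} \<Longrightarrow> \<exists>h::int. \<bar>real q * a - of_int h\<bar> < \<epsilon> / (2 * (real l + 1))"
    using Dirichlet_simultaneous_finite[of "A \<union> \<beta> ` {..<K}" "\<epsilon> / (2 * (real l + 1))"] \<open>\<epsilon> > 0\<close> \<open>finite A\<close> by auto
  \<comment> \<open>a return time close to zero is added often enough to make the integer nonnegative\<close>
  define n where "n = nat (k + int (l * q))"
  have "int l * 1 \<le> int l * int q" using q(1) by (intro mult_left_mono) auto
  then have n: "int n = k + int l * int q" unfolding n_def l_def by simp
  have n': "real n = of_int k + real l * real q"
    using arg_cong[OF n, of real_of_int] by simp
  have shift: "\<exists>h::int. \<bar>real n * a - of_int h - b\<bar> < \<epsilon>"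
    if a: "a \<in> A \<union> \<beta> ` {..<K}" and h: "\<bar>of_int k * a - of_int h - b\<bar> < \<epsilon> / 2" for a b and h :: int
  proof -
    obtain j :: int where j: "\<bar>real q * a - of_int j\<bar> < \<epsilon> / (2 * (real l + 1))" using q(2)[OF a] by blast
    have "real l * \<bar>real q * a - of_int j\<bar> \<le> real l * (\<epsilon> / (2 * (real l + 1)))" using j by (intro mult_left_mono) auto
    also have "\<dots> \<le> \<epsilon> / 2" using \<open>\<epsilon> > 0\<close> by (simp add: field_simps)
    finally have "\<bar>real l * (real q * a - of_int j)\<bar> \<le> \<epsilon> / 2" by (simp add: abs_mult)
    moreover have "real n * a - of_int (h + int l * j) - b = (of_int k * a - of_int h - b) + real l * (real q * a - of_int j)"
      by (simp add: n' algebra_simps)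
    ultimately have "\<bar>real n * a - of_int (h + int l * j) - b\<bar> < \<epsilon>" using h by linarith
    then show ?thesis by blast
  qed
  show thesis
  proof (rule that[of n])
    show "\<exists>h::int. \<bar>real n * a - of_int h\<bar> < \<epsilon>" if "a \<in> A" for a
      using k(1)[OF that] shift[of a _ 0] that by auto
    show "\<exists>h::int. \<bar>real n * \<beta> i - of_int h - w i\<bar> < \<epsilon>" if "i < K" for i
      using k(2)[OF that] shift[of "\<beta> i" _ "w i"] that by auto
  qed
qed

section \<open>Steinhaus measures\<close>

text \<open>The two angles are \<open>Arg y\<close> plus and minus \<open>arccos (cmod y)\<close>.
  Thus phases alone can imitate any coefficient of modulus at most 1.\<close>

lemma unit_disc_average:
  assumes "cmod y \<le> 1"
  shows "\<exists>a b. y = (cis a + cis b) / 2"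
proof -
  define t \<phi> where "t = Arg y" and "\<phi> = arccos (cmod y)"
  have "cis (t + \<phi>) + cis (t - \<phi>) = cis t * (cis \<phi> + cis (- \<phi>))"
    by (simp add: cis_mult distrib_left)
  also have "cis \<phi> + cis (- \<phi>) = of_real (2 * cos \<phi>)"
    by (simp add: complex_eq_iff)
  also have "cos \<phi> = cmod y" unfolding \<phi>_def using assms norm_ge_zero[of y] by (intro cos_arccos) linarith+
  also have "cis t * of_real (2 * cmod y) = 2 * y"
    using rcis_cmod_Arg[of y] by (simp add: t_def rcis_def mult_ac)
  finally show ?thesis by (intro exI[of _ "t + \<phi>"] exI[of _ "t - \<phi>"]) simp
qed

lemma norm_cis_diff_le: "cmod (cis a - cis b) \<le> \<bar>a - b\<bar>"
proof -
  have "cmod (cis a - cis b) = cmod (exp (\<i> * of_real (a - b)) - 1)"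
  proof -
    have "cis a - cis b = cis b * (exp (\<i> * of_real (a - b)) - 1)"
      by (simp add: cis_conv_exp algebra_simps flip: exp_add)
    then show ?thesis by (simp add: norm_mult)
  qed
  also have "\<dots> = 2 * \<bar>sin ((a - b) / 2)\<bar>" using dist_exp_i_1[of "a - b"] by simp
  also have "\<dots> \<le> \<bar>a - b\<bar>" using abs_sin_x_le_abs_x[of "(a - b) / 2"] by simp
  finally show ?thesis .
qed

lemma cis_2pi_int: "cis (2 * pi * (x - of_int h)) = cis (2 * pi * x)"
  using cis_multiple_2pi[of "of_int h"] by (simp add: right_diff_distrib cis_divide[symmetric])

lemma integral_unit_interval_measure:
  fixes f :: "real \<Rightarrow> complex"
  assumes "continuous_on UNIV f"
  shows "(\<integral>t. f t \<partial>unit_interval_measure) = integral {0..1} f"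
proof -
  have [measurable]: "f \<in> borel_measurable borel" using assms by (rule borel_measurable_continuous_onI)
  have U: "unit_interval_measure = density lborel (\<lambda>x. ennreal (indicator {0..1} x))"
    unfolding unit_interval_measure_def uniform_measure_def
    by (intro density_cong) (auto simp: indicator_def divide_ennreal_def)
  have "(\<integral>t. f t \<partial>unit_interval_measure) = (\<integral>t. indicator {0..1} t *\<^sub>R f t \<partial>lborel)"
    unfolding U by (rule integral_density) auto
  also have "\<dots> = (LINT t:{0..1}|lborel. f t)" by (simp add: set_lebesgue_integral_def)
  also have "\<dots> = integral {0..1} f"
    by (rule set_borel_integral_eq_integral(2)[OF borel_integrable_atLeastAtMost'[OF continuous_on_subset[OF assms subset_UNIV]]])
  finally show ?thesis .
qed

lemma borel_measurable_unit_interval_measure: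
  fixes f :: "real \<Rightarrow> complex"
  assumes "continuous_on UNIV f"
  shows "f \<in> borel_measurable unit_interval_measure"
  using borel_measurable_continuous_onI[OF assms]
  by (simp add: measurable_cong_sets[OF sets_unit_interval_measure refl])

lemma measurable_cis_unit_interval_measure: "(\<lambda>t. cis (2 * pi * t)) \<in> borel_measurable unit_interval_measure"
  by (intro borel_measurable_unit_interval_measure continuous_intros)

lemma integral_cis: "(\<integral>t. cis (2 * pi * t) \<partial>unit_interval_measure) = 0"
proof -
  have eq: "cis (2 * pi * t) = exp (2 * pi * \<i> * of_real t)" for t
    by (simp add: cis_conv_exp mult_ac)
  have "(\<integral>t. cis (2 * pi * t) \<partial>unit_interval_measure) = integral {0..1} (\<lambda>t. exp (2 * pi * \<i> * of_real t))"
    unfolding eq by (intro integral_unit_interval_measure continuous_intros)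
  also have "\<dots> = (exp (2 * pi * \<i> * of_real 1) - 1) / (2 * pi * \<i>)"
    by (rule integral_exp) auto
  also have "exp (2 * pi * \<i> * of_real 1) = 1" using exp_two_pi_i by simp
  finally show ?thesis by simp
qed

text \<open>Infinitely many coordinates, so that fresh independent angles remain available after any
  finite number of perturbations.\<close>

abbreviation angle_space :: "(nat \<Rightarrow> real) measure" where
  "angle_space \<equiv> PiM UNIV (\<lambda>_. unit_interval_measure)"

lemma prob_space_angle_space: "prob_space angle_space"
  by (intro prob_space_PiM prob_space_unit_interval_measure)

lemma space_angle_space [simp]: "space angle_space = UNIV"
  by (simp add: space_PiM)

lemma distr_angle_space_restrict:
  "distr angle_space (PiM I (\<lambda>_. unit_interval_measure)) (\<lambda>\<omega>. restrict \<omega> I) = PiM I (\<lambda>_. unit_interval_measure)"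
  using distr_PiM_reindex[of UNIV "\<lambda>_. unit_interval_measure" "\<lambda>i. i" I] prob_space_unit_interval_measure
  by (simp add: restrict_def)

lemma measurable_restrict_angle_space:
  "(\<lambda>\<omega>. restrict \<omega> I) \<in> measurable angle_space (PiM I (\<lambda>_. unit_interval_measure))"
  by (rule measurable_restrict_subset) simp

lemma measurable_unit_interval_coordinate:
  fixes f :: "real \<Rightarrow> complex"
  assumes "j \<in> I" "f \<in> borel_measurable unit_interval_measure"
  shows "(\<lambda>\<omega>. f (\<omega> j)) \<in> borel_measurable (PiM I (\<lambda>_. unit_interval_measure))"
  using measurable_compose[of "\<lambda>\<omega>. \<omega> j" "PiM I (\<lambda>_. unit_interval_measure)" unit_interval_measure f borel]
    measurable_component_singleton[of j I "\<lambda>_. unit_interval_measure"] assms by simp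

lemmas measurable_cis_coordinate = measurable_unit_interval_coordinate[OF _ measurable_cis_unit_interval_measure]

text \<open>Distinct coordinates are independent, so the integral factors, and a uniform phase has
  mean 0.\<close>

lemma cis_coordinates_orthogonal:
  assumes "j \<noteq> k"
  shows "(\<integral>\<omega>. cis (2 * pi * \<omega> j) * cnj (cis (2 * pi * \<omega> k)) \<partial>angle_space) = 0"
proof -
  interpret U: prob_space unit_interval_measure by (rule prob_space_unit_interval_measure)
  interpret P: product_sigma_finite "\<lambda>_::nat. unit_interval_measure"
    by unfold_locales
  let ?f = "\<lambda>i t. if i = j then cis (2 * pi * t) else cnj (cis (2 * pi * t))"
  have "continuous_on UNIV (\<lambda>t. ?f i t)" for i
    by (cases "i = j") (auto intro!: continuous_intros)
  then have f[measurable]: "?f i \<in> borel_measurable unit_interval_measure" for i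
    by (rule borel_measurable_unit_interval_measure)
  have int: "integrable unit_interval_measure (?f i)" for i
    using f by (intro U.integrable_const_bound[of _ 1]) auto
  have "(\<integral>\<omega>. cis (2 * pi * \<omega> j) * cnj (cis (2 * pi * \<omega> k)) \<partial>angle_space)
     = (\<integral>\<omega>. (\<Prod>i\<in>{j, k}. ?f i (restrict \<omega> {j, k} i)) \<partial>angle_space)"
    using assms by simp
  also have "\<dots> = (\<integral>\<omega>. (\<Prod>i\<in>{j, k}. ?f i (\<omega> i)) \<partial>distr angle_space (PiM {j, k} (\<lambda>_. unit_interval_measure)) (\<lambda>\<omega>. restrict \<omega> {j, k}))"
    by (rule integral_distr[symmetric, OF measurable_restrict_angle_space])
      (intro borel_measurable_prod measurable_unit_interval_coordinate f)
  also have "\<dots> = (\<Prod>i\<in>{j, k}. integral\<^sup>L unit_interval_measure (?f i))"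
    unfolding distr_angle_space_restrict by (rule P.product_integral_prod) (use int in auto)
  also have "\<dots> = 0" using assms integral_cis by simp
  finally show ?thesis .
qed

lemma sum_alternating_even:
  fixes A B :: "'b::comm_semiring_1"
  shows "(\<Sum>s<2 * n. if even s then A else B) = of_nat n * (A + B)"
  by (induction n) (auto simp: algebra_simps)

lemma sum_blocks:
  fixes f :: "nat \<Rightarrow> 'b::comm_monoid_add"
  shows "(\<Sum>k<m * n. f k) = (\<Sum>i<m. \<Sum>s<n. f (i * n + s))"
proof -
  have "sum f {i * n..<i * n + n} = (\<Sum>s<n. f (i * n + s))" for i
    using sum.shift_bounds_nat_ivl[of f 0 "i * n" n] by (simp add: atLeast0LessThan add.commute)
  then show ?thesis using sum.nat_group[of f n m] by simp
qed

section \<open>Perturbing a Steinhaus variable\<close>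

context complex_operator
begin

definition steinhaus_variable :: "nat set \<Rightarrow> (nat \<Rightarrow> 'a) \<Rightarrow> (nat \<Rightarrow> real) \<Rightarrow> 'a" where
  "steinhaus_variable J x = (\<lambda>\<omega>. \<Sum>j\<in>J. cm (cis (2 * pi * \<omega> j)) (x j))"

lemma measurable_steinhaus_variable: "steinhaus_variable J x \<in> borel_measurable angle_space"
  unfolding steinhaus_variable_def by (intro borel_measurable_sum measurable_cm measurable_cis_coordinate UNIV_I)

text \<open>Forgetting the coordinates outside \<open>J\<close> and mapping angles to the circle
  coordinatewise both carry product measures to product measures.\<close>

lemma distr_steinhaus_variable:
  assumes "finite J"
  shows "distr angle_space borel (steinhaus_variable J x) = steinhaus cm J x"
proof -
  let ?U = "\<lambda>_::nat. unit_interval_measure" and ?f = "\<lambda>t. cis (2 * pi * t)"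
  let ?g = "\<lambda>z. \<Sum>j\<in>J. cm (z j) (x j)"
  have f: "?f \<in> measurable unit_interval_measure borel"
    by (rule measurable_cis_unit_interval_measure)
  have fc: "compose J ?f \<in> measurable (PiM J ?U) (PiM J (\<lambda>_. borel))"
    unfolding compose_def by (intro measurable_restrict measurable_cis_coordinate)
  have g: "?g \<in> measurable (PiM J (\<lambda>_. borel)) borel"
    by (intro borel_measurable_sum measurable_cm measurable_component_singleton)
  let ?C = "distr unit_interval_measure borel ?f"
  have prob: "prob_space ?C"
    by (intro prob_space.prob_space_distr prob_space_unit_interval_measure f)
  have C: "circle_uniform = ?C" by (simp add: circle_uniform_def unit_interval_measure_def)
  have sets_C: "sets (PiM J (\<lambda>_. ?C)) = sets (PiM J (\<lambda>_. borel :: complex measure))"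
    by (intro sets_PiM_cong) auto
  have fC: "?f \<in> measurable unit_interval_measure ?C" using f by (simp cong: measurable_cong_sets)
  have "distr unit_interval_measure ?C ?f = ?C" by (intro distr_cong) auto
  then have "distr (PiM J ?U) (PiM J (\<lambda>_. ?C)) (compose J ?f) = PiM J (\<lambda>_. ?C)"
    using distr_PiM_finite_prob_space'[OF assms, of ?U "\<lambda>_. ?C" ?f] prob_space_unit_interval_measure prob fC by simp
  then have "PiM J (\<lambda>_. circle_uniform) = distr (PiM J ?U) (PiM J (\<lambda>_. ?C)) (compose J ?f)" by (simp add: C)
  then have "steinhaus cm J x = distr (distr (PiM J ?U) (PiM J (\<lambda>_. ?C)) (compose J ?f)) borel ?g"
    unfolding steinhaus_def by simp
  also have "\<dots> = distr (PiM J ?U) borel (?g \<circ> compose J ?f)"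
    using fc g sets_C by (intro distr_distr) (simp_all cong: measurable_cong_sets)
  also have "\<dots> = distr (distr angle_space (PiM J ?U) (\<lambda>\<omega>. restrict \<omega> J)) borel (?g \<circ> compose J ?f)"
    by (simp only: distr_angle_space_restrict)
  also have "\<dots> = distr angle_space borel (?g \<circ> compose J ?f \<circ> (\<lambda>\<omega>. restrict \<omega> J))"
    by (rule distr_distr[OF measurable_comp[OF fc g] measurable_restrict_angle_space])
  also have "?g \<circ> compose J ?f \<circ> (\<lambda>\<omega>. restrict \<omega> J) = steinhaus_variable J x"
    by (auto simp: steinhaus_variable_def compose_def fun_eq_iff intro!: sum.cong)
  finally show ?thesis ..
qed

definition steinhaus_variables :: "((nat \<Rightarrow> real) \<Rightarrow> 'a) set" where
  "steinhaus_variables = {steinhaus_variable J x | J x. finite J \<and> (\<forall>j\<in>J. x j \<in> unimodular_eigenvectors cm T)}"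

lemma distr_steinhaus_variables: "distr angle_space borel ` steinhaus_variables = ST cm T"
proof (intro equalityI subsetI)
  fix m assume "m \<in> distr angle_space borel ` steinhaus_variables"
  then obtain J x where "m = steinhaus cm J x" "finite J" "\<forall>j\<in>J. x j \<in> unimodular_eigenvectors cm T"
    by (auto simp: steinhaus_variables_def distr_steinhaus_variable)
  then show "m \<in> ST cm T" unfolding ST_def by blast
next
  fix m assume "m \<in> ST cm T"
  then obtain J x where "m = steinhaus cm J x" "finite J" "\<forall>j\<in>J. x j \<in> unimodular_eigenvectors cm T"
    by (auto simp: ST_def)
  then show "m \<in> distr angle_space borel ` steinhaus_variables"
    by (intro image_eqI[of _ _ "steinhaus_variable J x"]) (auto simp: steinhaus_variables_def distr_steinhaus_variable)
qed

lemma unimodular_angle: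
  assumes "cmod l = 1"
  shows "\<exists>a. l = cis (2 * pi * a)"
proof -
  have "l \<noteq> 0" using assms by auto
  then have "cis (Arg l) = l" using cis_Arg[of l] assms by (simp add: sgn_div_norm)
  then show ?thesis by (intro exI[of _ "Arg l / (2 * pi)"]) simp
qed

lemma accumulating_avoids_span:
  assumes "accumulating e" "countable S" "\<delta> > 0"
  shows "\<exists>b x. b \<notin> rat_vs.span S \<and> x \<noteq> 0 \<and> dist e x < \<delta> \<and> T x = cm (cis (2 * pi * b)) x"
proof -
  let ?D = "(\<lambda>b. cis (2 * pi * b)) ` rat_vs.span S"
  have "countable ?D" using countable_rat_span[OF assms(2)] by simp
  moreover have "uncountable (eigenvalues_near (ball e \<delta>))" using assms(1,3) by (simp add: accumulating_def)
  ultimately have "\<not> eigenvalues_near (ball e \<delta>) \<subseteq> ?D" using countable_subset by blast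
  then obtain l where l: "l \<in> eigenvalues_near (ball e \<delta>)" "l \<notin> ?D" by blast
  then obtain x where x: "x \<in> ball e \<delta>" "x \<noteq> 0" "T x = cm l x" "cmod l = 1" by (auto simp: eigenvalues_near_def)
  obtain b where b: "l = cis (2 * pi * b)" using unimodular_angle[OF x(4)] by blast
  then show ?thesis using l(2) x by (intro exI[of _ b] exI[of _ x]) auto
qed

text \<open>At each stage the span to be avoided is generated by \<open>A\<close> and finitely many
  angles, hence countable, while uncountably many eigenvalues occur close to
  \<open>e k\<close>.\<close>

lemma independent_eigenvectors:
  fixes e :: "nat \<Rightarrow> 'a"
  assumes "countable A" "\<delta> > 0" "\<forall>k<K. accumulating (e k)"
  shows "\<exists>\<beta> e'. \<forall>k<K. \<beta> k \<notin> rat_vs.span (A \<union> \<beta> ` {..<k}) \<and> e' k \<noteq> 0 \<and> dist (e k) (e' k) < \<delta> \<and>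
    T (e' k) = cm (cis (2 * pi * \<beta> k)) (e' k)"
  using assms(3)
proof (induction K)
  case (Suc K)
  then obtain \<beta> e' where IH: "\<forall>k<K. \<beta> k \<notin> rat_vs.span (A \<union> \<beta> ` {..<k}) \<and> e' k \<noteq> 0 \<and> dist (e k) (e' k) < \<delta> \<and>
    T (e' k) = cm (cis (2 * pi * \<beta> k)) (e' k)" by fastforce
  have "countable (A \<union> \<beta> ` {..<K})" using assms(1) by simp
  then obtain b x where bx: "b \<notin> rat_vs.span (A \<union> \<beta> ` {..<K})" "x \<noteq> 0" "dist (e K) x < \<delta>" "T x = cm (cis (2 * pi * b)) x"
    using accumulating_avoids_span[of "e K" "A \<union> \<beta> ` {..<K}" \<delta>] Suc.prems assms(2) by auto
  have im: "(\<beta>(K := b)) ` {..<k} = \<beta> ` {..<k}" if "k \<le> K" for k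
    using that by (intro image_cong) auto
  show ?case
  proof (intro exI[of _ "\<beta>(K := b)"] exI[of _ "e'(K := x)"] allI impI)
    fix k assume "k < Suc K"
    then have "k \<le> K" by simp
    then show "(\<beta>(K := b)) k \<notin> rat_vs.span (A \<union> (\<beta>(K := b)) ` {..<k}) \<and> (e'(K := x)) k \<noteq> 0 \<and>
        dist (e k) ((e'(K := x)) k) < \<delta> \<and> T ((e'(K := x)) k) = cm (cis (2 * pi * (\<beta>(K := b)) k)) ((e'(K := x)) k)"
      unfolding im[OF \<open>k \<le> K\<close>] using IH bx by (cases "k = K") auto
  qed
qed simp

text \<open>The conclusion holds for every \<open>\<omega>\<close>. At a suitable time the terms in
  \<open>J\<close> are nearly back at their current values, while the phases of the new terms take
  prescribed values. These are chosen so that block \<open>i\<close> contributes the coefficient of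
  \<open>v\<close> minus that of the current sum over \<open>J\<close>; \<open>C i\<close> bounds
  this difference whatever \<open>\<omega>\<close> is.\<close>

lemma steinhaus_variable_hits:
  fixes e e' :: "nat \<Rightarrow> 'a" and c :: "nat option \<Rightarrow> nat \<Rightarrow> complex" and C :: "nat \<Rightarrow> real"
  assumes J: "finite J" and Tx: "\<And>j. j \<in> J \<Longrightarrow> T (x j) = cm (cis (2 * pi * \<alpha> j)) (x j)"
    and "n > 0" "even n" and r: "r > 0"
    and v: "norm (v - (\<Sum>i<m. cm (c None i) (e i))) < r / (4 * (real (card J) + 1))"
    and x: "\<And>j. j \<in> J \<Longrightarrow> norm (x j - (\<Sum>i<m. cm (c (Some j) i) (e i))) < r / (4 * (real (card J) + 1))"
    and C: "\<And>i. C i = cmod (c None i) + (\<Sum>j\<in>J. cmod (c (Some j) i)) + 1"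
    and \<delta>: "(\<Sum>i<m. C i * \<delta>) \<le> r / 8"
    and \<beta>: "\<And>k. k < m * n \<Longrightarrow> \<beta> k \<notin> rat_vs.span (insert 1 (\<alpha> ` J) \<union> \<beta> ` {..<k})"
    and e'_close: "\<And>k. k < m * n \<Longrightarrow> dist (e (k div n)) (e' k) < \<delta>"
    and Te': "\<And>k. k < m * n \<Longrightarrow> T (e' k) = cm (cis (2 * pi * \<beta> k)) (e' k)"
  shows "(\<Sum>j\<in>J. cm (cis (2 * pi * \<omega> j)) (x j)) +
     (\<Sum>k<m * n. cm (cis (2 * pi * \<omega> (N + k))) (cm (of_real (C (k div n)) / of_nat n) (e' k))) \<in> visits T (ball v r)"
    (is "?Z \<in> _")
proof -
  \<comment> \<open>The coefficient required at \<open>e i\<close>, relative to the fixed size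
    \<open>C i\<close> of the block; it lies in the unit disc.\<close>
  define y where "y = (\<lambda>i. (c None i - (\<Sum>j\<in>J. cis (2 * pi * \<omega> j) * c (Some j) i)) / of_real (C i))"
  have Cpos: "C i > 0" for i unfolding C by (intro add_nonneg_pos add_nonneg_nonneg sum_nonneg) auto
  have "cmod (y i) \<le> 1" for i
  proof -
    have "cmod (c None i - (\<Sum>j\<in>J. cis (2 * pi * \<omega> j) * c (Some j) i)) \<le> cmod (c None i) + (\<Sum>j\<in>J. cmod (c (Some j) i))"
      by (intro order_trans[OF norm_triangle_ineq4] add_mono order_refl sum_norm_le) (simp add: norm_mult)
    also have "\<dots> \<le> C i" by (simp add: C)
    finally show ?thesis using Cpos[of i] by (simp add: y_def norm_divide)
  qed
  then have "\<exists>a b. y i = (cis a + cis b) / 2" for i by (rule unit_disc_average)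
  then obtain a b where ab: "\<And>i. y i = (cis (a i) + cis (b i)) / 2" by metis
  \<comment> \<open>Even positions of a block receive one angle, odd positions the other; as
    \<open>n\<close> is even, the block average is exactly \<open>y i\<close>.\<close>
  define \<theta> where "\<theta> = (\<lambda>k. if even (k mod n) then a (k div n) else b (k div n))"
  define z where "z = (\<lambda>k. cis (\<theta> k))"
  have z_avg: "(\<Sum>s<n. z (i * n + s)) = of_nat n * y i" for i
  proof -
    obtain n' where n': "n = 2 * n'" using \<open>even n\<close> by (rule evenE)
    have "(\<Sum>s<n. z (i * n + s)) = (\<Sum>s<n. if even s then cis (a i) else cis (b i))"
      using \<open>n > 0\<close> by (intro sum.cong) (auto simp: z_def \<theta>_def)
    also have "\<dots> = of_nat n' * (cis (a i) + cis (b i))" unfolding n' by (rule sum_alternating_even)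
    also have "\<dots> = of_nat n * y i" by (simp add: ab n')
    finally show ?thesis .
  qed
  let ?d = "\<lambda>k. cm (of_real (C (k div n)) / of_nat n) (e' k)"
  define P where "P = (\<Sum>j\<in>J. cm (cis (2 * pi * \<omega> j)) (x j)) + (\<Sum>k<m * n. cm (z k) (?d k))"
  define G where "G = (\<Sum>j\<in>J. norm (x j)) + (\<Sum>k<m * n. norm (?d k))"
  have G: "G \<ge> 0" by (auto simp: G_def intro!: add_nonneg_nonneg sum_nonneg)
  \<comment> \<open>An error \<open>\<eta>\<close> in an angle moves its phase by at most
    \<open>2 * pi * \<eta>\<close>, and \<open>G\<close> is the total norm of all terms, so the
    whole sum moves by at most \<open>r / 8\<close>. The 1 added to \<open>G\<close> avoids division
    by 0.\<close>
  define \<eta> where "\<eta> = r / (8 * (G + 1)) / (2 * pi)"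
  have \<eta>: "\<eta> > 0" using r G by (auto simp: \<eta>_def)
  \<comment> \<open>Old angles are asked to return; each new angle is asked to advance by its
    desired value minus the one given by \<open>\<omega>\<close>.\<close>
  obtain p :: nat where p: "\<And>a. a \<in> \<alpha> ` J \<Longrightarrow> \<exists>h::int. \<bar>real p * a - of_int h\<bar> < \<eta>"
    "\<And>k. k < m * n \<Longrightarrow> \<exists>h::int. \<bar>real p * \<beta> k - of_int h - (\<theta> k / (2 * pi) - \<omega> (N + k))\<bar> < \<eta>"
    using Kronecker_relative[of "\<alpha> ` J" "m * n" \<beta> \<eta> "\<lambda>k. \<theta> k / (2 * pi) - \<omega> (N + k)"] J \<beta> \<eta> by auto
  have close_x: "cmod (cis (2 * pi * \<omega> j) * cis (2 * pi * \<alpha> j) ^ p - cis (2 * pi * \<omega> j)) \<le> 2 * pi * \<eta>" if j: "j \<in> J" for j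
  proof -
    obtain h :: int where h: "\<bar>real p * \<alpha> j - of_int h\<bar> < \<eta>" using p(1)[OF imageI[OF j]] by (rule exE)
    have eq: "cis (2 * pi * \<omega> j) * cis (2 * pi * \<alpha> j) ^ p = cis (2 * pi * (\<omega> j + real p * \<alpha> j - of_int h))"
      unfolding cis_2pi_int by (simp add: Complex.DeMoivre cis_mult algebra_simps)
    have "cmod (cis (2 * pi * \<omega> j) * cis (2 * pi * \<alpha> j) ^ p - cis (2 * pi * \<omega> j)) \<le> \<bar>2 * pi * (\<omega> j + real p * \<alpha> j - of_int h) - 2 * pi * \<omega> j\<bar>"
      unfolding eq by (rule norm_cis_diff_le)
    also have "\<dots> = 2 * pi * \<bar>real p * \<alpha> j - of_int h\<bar>" by (simp add: abs_mult flip: right_diff_distrib)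
    also have "\<dots> \<le> 2 * pi * \<eta>" using h by (intro mult_left_mono) auto
    finally show ?thesis .
  qed
  have close_z: "cmod (cis (2 * pi * \<omega> (N + k)) * cis (2 * pi * \<beta> k) ^ p - z k) \<le> 2 * pi * \<eta>" if k: "k < m * n" for k
  proof -
    obtain h :: int where h: "\<bar>real p * \<beta> k - of_int h - (\<theta> k / (2 * pi) - \<omega> (N + k))\<bar> < \<eta>" using p(2)[OF k] by (rule exE)
    have eq: "cis (2 * pi * \<omega> (N + k)) * cis (2 * pi * \<beta> k) ^ p = cis (2 * pi * (\<omega> (N + k) + real p * \<beta> k - of_int h))"
      unfolding cis_2pi_int by (simp add: Complex.DeMoivre cis_mult algebra_simps)
    have "cmod (cis (2 * pi * \<omega> (N + k)) * cis (2 * pi * \<beta> k) ^ p - z k) \<le> \<bar>2 * pi * (\<omega> (N + k) + real p * \<beta> k - of_int h) - \<theta> k\<bar>"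
      unfolding eq z_def by (rule norm_cis_diff_le)
    also have "2 * pi * (\<omega> (N + k) + real p * \<beta> k - of_int h) - \<theta> k = 2 * pi * (real p * \<beta> k - of_int h - (\<theta> k / (2 * pi) - \<omega> (N + k)))"
      by (simp add: field_simps)
    also have "\<bar>\<dots>\<bar> = 2 * pi * \<bar>real p * \<beta> k - of_int h - (\<theta> k / (2 * pi) - \<omega> (N + k))\<bar>" by (simp add: abs_mult)
    also have "\<dots> \<le> 2 * pi * \<eta>" using h by (intro mult_left_mono) auto
    finally show ?thesis .
  qed
  have Tp: "(T ^^ p) ?Z = (\<Sum>j\<in>J. cm (cis (2 * pi * \<omega> j) * cis (2 * pi * \<alpha> j) ^ p) (x j)) +
      (\<Sum>k<m * n. cm (cis (2 * pi * \<omega> (N + k)) * cis (2 * pi * \<beta> k) ^ p) (?d k))"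
    unfolding funpow_T_add funpow_T_sum funpow_T_cm
    using Tx Te' by (intro arg_cong2[where f = "(+)"] sum.cong) (simp_all add: funpow_T_eigenvector mult_ac)
  have "norm ((T ^^ p) ?Z - P) \<le> 2 * pi * \<eta> * G"
  proof -
    have diff: "(T ^^ p) ?Z - P = (\<Sum>j\<in>J. cm (cis (2 * pi * \<omega> j) * cis (2 * pi * \<alpha> j) ^ p - cis (2 * pi * \<omega> j)) (x j)) +
        (\<Sum>k<m * n. cm (cis (2 * pi * \<omega> (N + k)) * cis (2 * pi * \<beta> k) ^ p - z k) (?d k))"
      unfolding Tp P_def by (simp only: cm_diff_left sum_subtractf) (simp only: add_diff_add)
    have "norm ((T ^^ p) ?Z - P) \<le> (\<Sum>j\<in>J. 2 * pi * \<eta> * norm (x j)) + (\<Sum>k<m * n. 2 * pi * \<eta> * norm (?d k))"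
      unfolding diff by (intro norm_triangle_mono sum_norm_le norm_cm_le close_x close_z) simp_all
    also have "\<dots> = 2 * pi * \<eta> * G"
      unfolding G_def distrib_left sum_distrib_left ..
    finally show ?thesis .
  qed
  also have "\<dots> = r / 8 * (G / (G + 1))" using G by (simp add: \<eta>_def)
  also have "\<dots> \<le> r / 8 * 1" using r G by (intro mult_left_mono) auto
  also have "\<dots> = r / 8" by simp
  finally have dist1: "norm ((T ^^ p) ?Z - P) \<le> r / 8" .
  have dist2: "norm (P - v) < r / 4 + r / 8"
  proof -
    define E where "E = (\<Sum>i<m. \<Sum>s<n. cm (z (i * n + s) * (of_real (C i) / of_nat n)) (e' (i * n + s) - e i))"
    have "(\<Sum>k<m * n. cm (z k) (?d k)) = (\<Sum>i<m. \<Sum>s<n. cm (z (i * n + s) * (of_real (C i) / of_nat n)) (e' (i * n + s)))"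
      unfolding sum_blocks using \<open>n > 0\<close> by (intro sum.cong refl) auto
    also have "\<dots> = E + (\<Sum>i<m. \<Sum>s<n. cm (z (i * n + s) * (of_real (C i) / of_nat n)) (e i))"
      unfolding E_def by (simp only: cm_diff_right sum_subtractf) simp
    also have "(\<Sum>i<m. \<Sum>s<n. cm (z (i * n + s) * (of_real (C i) / of_nat n)) (e i)) = (\<Sum>i<m. cm (of_real (C i) * y i) (e i))"
    proof (intro sum.cong refl)
      fix i
      have "(\<Sum>s<n. cm (z (i * n + s) * (of_real (C i) / of_nat n)) (e i)) = cm ((\<Sum>s<n. z (i * n + s)) * (of_real (C i) / of_nat n)) (e i)"
        by (simp only: cm_sum_left sum_distrib_right)
      also have "\<dots> = cm (of_real (C i) * y i) (e i)" unfolding z_avg using \<open>n > 0\<close> by (simp add: mult.commute)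
      finally show "(\<Sum>s<n. cm (z (i * n + s) * (of_real (C i) / of_nat n)) (e i)) = cm (of_real (C i) * y i) (e i)" .
    qed
    \<comment> \<open>The factor \<open>C i\<close> cancels the denominator of \<open>y i\<close>,
      leaving the expansion of \<open>v\<close> minus that of the current sum over
      \<open>J\<close>.\<close>
    also have "\<dots> = (\<Sum>i<m. cm (c None i) (e i)) - (\<Sum>j\<in>J. cm (cis (2 * pi * \<omega> j)) (\<Sum>i<m. cm (c (Some j) i) (e i)))"
    proof -
      have "of_real (C i) * y i = c None i - (\<Sum>j\<in>J. cis (2 * pi * \<omega> j) * c (Some j) i)" for i
        using Cpos[of i] by (simp add: y_def)
      then show ?thesis
        by (simp only: cm_diff_left sum_subtractf cm_sum_left cm_sum_right cm_cm) (subst sum.swap, rule refl)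
    qed
    finally have Pv: "P - v = (E - (v - (\<Sum>i<m. cm (c None i) (e i)))) + (\<Sum>j\<in>J. cm (cis (2 * pi * \<omega> j)) (x j - (\<Sum>i<m. cm (c (Some j) i) (e i))))"
      unfolding P_def by (simp add: cm_diff_right sum_subtractf)
    have "norm (P - v) \<le> (norm E + norm (v - (\<Sum>i<m. cm (c None i) (e i)))) + (\<Sum>j\<in>J. r / (4 * (real (card J) + 1)))"
      unfolding Pv using x by (intro norm_triangle_mono norm_triangle_ineq4 sum_norm_le) (simp add: less_imp_le)
    also have "\<dots> < (r / 8 + r / (4 * (real (card J) + 1))) + (\<Sum>j\<in>J. r / (4 * (real (card J) + 1)))"
    proof (intro add_strict_right_mono add_le_less_mono v)
      have "norm E \<le> (\<Sum>i<m. cmod (of_real (C i)) * \<delta>)"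
        unfolding E_def
      proof (rule norm_blocks_le[OF \<open>n > 0\<close>])
        fix i s assume lt: "i < m" "s < n"
        have "i * n + s < (i + 1) * n" using lt by simp
        also have "\<dots> \<le> m * n" using lt by (intro mult_le_mono1) simp
        finally have "i * n + s < m * n" .
        moreover have "(i * n + s) div n = i" using lt by simp
        ultimately show "norm (e' (i * n + s) - e i) \<le> \<delta>"
          using e'_close[of "i * n + s"] by (simp add: dist_norm norm_minus_commute)
      qed (simp add: z_def)
      also have "\<dots> = (\<Sum>i<m. C i * \<delta>)" using Cpos by (simp add: less_imp_le)
      finally show "norm E \<le> r / 8" using \<delta> by linarith
    qed
    \<comment> \<open>The target and the vectors of \<open>J\<close> contribute
      \<open>card J + 1\<close> equal errors, together \<open>r / 4\<close>.\<close>
    also have "\<dots> = r / 4 + r / 8"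
    proof -
      have "r / (4 * (real (card J) + 1)) + (\<Sum>j\<in>J. r / (4 * (real (card J) + 1))) = (real (card J) + 1) * (r / (4 * (real (card J) + 1)))"
        by (simp only: sum_constant distrib_right mult_1_left add.commute)
      also have "\<dots> = r / 4"
      proof -
        have "q * (r / (4 * q)) = r / 4" if "q \<noteq> 0" for q :: real using that by simp
        from this[of "real (card J) + 1"] show ?thesis by linarith
      qed
      finally show ?thesis by linarith
    qed
    finally show ?thesis .
  qed
  have "dist v ((T ^^ p) ?Z) < r"
    using norm_triangle_ineq[of "(T ^^ p) ?Z - P" "P - v"] dist1 dist2 r by (simp add: dist_norm norm_minus_commute)
  then have "(T ^^ p) ?Z \<in> ball v r" by simp
  then show ?thesis unfolding visits_def by blast
qed

lemma steinhaus_variables_step: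
  assumes span: "closure (cspan cm {e. accumulating e}) = UNIV"
    and Z: "Z \<in> steinhaus_variables" and V: "open V" "V \<noteq> {}" and "\<epsilon> > 0"
  shows "\<exists>Z'\<in>steinhaus_variables. (\<integral>\<^sup>+\<omega>. ennreal (norm (Z' \<omega> - Z \<omega>)) \<partial>angle_space) \<le> ennreal \<epsilon>
     \<and> (AE \<omega> in angle_space. Z' \<omega> \<in> visits T V)"
proof -
  obtain J x where J: "finite J" and x: "\<forall>j\<in>J. x j \<in> unimodular_eigenvectors cm T" and Z_eq: "Z = steinhaus_variable J x"
    using Z by (auto simp: steinhaus_variables_def)
  have "\<forall>j\<in>J. \<exists>a. T (x j) = cm (cis (2 * pi * a)) (x j)"
    using x unimodular_angle by (fastforce simp: unimodular_eigenvectors_def)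
  then have "\<exists>\<alpha>. \<forall>j\<in>J. T (x j) = cm (cis (2 * pi * \<alpha> j)) (x j)" by (rule bchoice)
  then obtain \<alpha> where \<alpha>: "\<forall>j\<in>J. T (x j) = cm (cis (2 * pi * \<alpha> j)) (x j)" by (rule exE)
  obtain v r where v: "r > 0" "ball v r \<subseteq> V" using V open_contains_ball by blast
  define \<delta>1 where "\<delta>1 = r / (4 * (real (card J) + 1))"
  have \<delta>1: "\<delta>1 > 0" using v(1) by (simp add: \<delta>1_def)
  have fin: "finite (insert None (Some ` J))" using J by simp
  \<comment> \<open>\<open>None\<close> indexes the target \<open>v\<close> and
    \<open>Some j\<close> the vector \<open>x j\<close>, so that all of them share the family
    \<open>e\<close>.\<close>
  obtain m :: nat and e and c :: "nat option \<Rightarrow> nat \<Rightarrow> complex" where e: "\<forall>i<m. e i \<in> {e. accumulating e}"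
    and approx: "\<forall>j\<in>insert None (Some ` J). norm (case_option v x j - (\<Sum>i<m. cm (c j i) (e i))) < \<delta>1"
    using common_approximation[OF span fin \<delta>1, where x = "case_option v x"] by blast
  define C where "C = (\<lambda>i. cmod (c None i) + (\<Sum>j\<in>J. cmod (c (Some j) i)) + 1)"
  have Cpos: "C i > 0" for i unfolding C_def by (intro add_nonneg_pos add_nonneg_nonneg sum_nonneg) auto
  obtain n :: nat and \<delta> where n: "n > 0" "even n" "\<delta> > 0"
    and small: "(\<Sum>i<m. C i * (norm (e i) / sqrt n + \<delta>)) \<le> min \<epsilon> (r / 8)" "(\<Sum>i<m. C i * \<delta>) \<le> min \<epsilon> (r / 8)"
    using small_block_parameters[of "min \<epsilon> (r / 8)" C "\<lambda>i. norm (e i)" m] v(1) \<open>\<epsilon> > 0\<close> less_imp_le[OF Cpos]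
    by auto
  define K where "K = m * n"
  have "\<forall>k<K. accumulating (e (k div n))" using e by (auto simp: K_def less_mult_imp_div_less)
  moreover have "countable (insert 1 (\<alpha> ` J))" using J by (simp add: countable_finite)
  ultimately obtain \<beta> e' where \<beta>: "\<forall>k<K. \<beta> k \<notin> rat_vs.span (insert 1 (\<alpha> ` J) \<union> \<beta> ` {..<k}) \<and> e' k \<noteq> 0 \<and>
      dist (e (k div n)) (e' k) < \<delta> \<and> T (e' k) = cm (cis (2 * pi * \<beta> k)) (e' k)"
    using independent_eigenvectors[of "insert 1 (\<alpha> ` J)" \<delta> K "\<lambda>k. e (k div n)"] n(3) by blast
  \<comment> \<open>Indices from \<open>N\<close> on lie outside \<open>J\<close>, so the new terms
    carry fresh independent angles.\<close>
  obtain N where N: "J \<subseteq> {..<N}" using J finite_nat_iff_bounded by blast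
  define d where "d = (\<lambda>k. cm (of_real (C (k div n)) / of_nat n) (e' k))"
  define x' where "x' = (\<lambda>j. if j < N then x j else d (j - N))"
  define J' where "J' = J \<union> (\<lambda>k. N + k) ` {..<K}"
  have Z'_eq: "steinhaus_variable J' x' \<omega> = Z \<omega> + (\<Sum>k<K. cm (cis (2 * pi * \<omega> (N + k))) (d k))" for \<omega>
  proof -
    have "steinhaus_variable J' x' \<omega> = (\<Sum>j\<in>J. cm (cis (2 * pi * \<omega> j)) (x' j)) + (\<Sum>j\<in>(\<lambda>k. N + k) ` {..<K}. cm (cis (2 * pi * \<omega> j)) (x' j))"
      unfolding steinhaus_variable_def J'_def using J N by (intro sum.union_disjoint) auto
    also have "(\<Sum>j\<in>J. cm (cis (2 * pi * \<omega> j)) (x' j)) = Z \<omega>"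
      unfolding Z_eq steinhaus_variable_def x'_def using N by (intro sum.cong) auto
    also have "(\<Sum>j\<in>(\<lambda>k. N + k) ` {..<K}. cm (cis (2 * pi * \<omega> j)) (x' j)) = (\<Sum>k<K. cm (cis (2 * pi * \<omega> (N + k))) (d k))"
      by (subst sum.reindex) (auto simp: x'_def)
    finally show ?thesis .
  qed
  have "d k \<in> unimodular_eigenvectors cm T" if "k < K" for k
  proof -
    \<comment> \<open>The summand 1 in \<open>C\<close> keeps the scaled vector nonzero, as
      membership in \<open>unimodular_eigenvectors\<close> requires.\<close>
    have "norm (d k) \<noteq> 0" using \<beta> that Cpos[of "k div n"] n(1) by (auto simp: d_def norm_divide)
    moreover have "T (d k) = cm (cis (2 * pi * \<beta> k)) (d k)"
      using \<beta> that by (simp add: d_def T_cm mult.commute)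
    ultimately show ?thesis unfolding unimodular_eigenvectors_def by (auto intro!: exI[of _ "cis (2 * pi * \<beta> k)"])
  qed
  then have "\<forall>j\<in>J'. x' j \<in> unimodular_eigenvectors cm T" using x N by (auto simp: J'_def x'_def)
  then have mem: "steinhaus_variable J' x' \<in> steinhaus_variables"
    using J unfolding steinhaus_variables_def by (auto simp: J'_def)
  have hits: "steinhaus_variable J' x' \<omega> \<in> visits T V" for \<omega>
  proof -
    have "(\<Sum>j\<in>J. cm (cis (2 * pi * \<omega> j)) (x j)) +
     (\<Sum>k<m * n. cm (cis (2 * pi * \<omega> (N + k))) (cm (of_real (C (k div n)) / of_nat n) (e' k))) \<in> visits T (ball v r)"
      using J N \<alpha> n v(1) approx \<beta> small(2)
      by (intro steinhaus_variable_hits[where c = c and e = e and \<alpha> = \<alpha> and \<beta> = \<beta> and \<delta> = \<delta>])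
        (auto simp: C_def \<delta>1_def K_def)
    then have "steinhaus_variable J' x' \<omega> \<in> visits T (ball v r)"
      unfolding Z'_eq unfolding Z_eq steinhaus_variable_def K_def d_def .
    then show ?thesis using v(2) by (auto simp: visits_def)
  qed
  have "(\<integral>\<^sup>+\<omega>. ennreal (norm (steinhaus_variable J' x' \<omega> - Z \<omega>)) \<partial>angle_space) \<le> ennreal \<epsilon>"
  proof -
    define u where "u = (\<lambda>i s (\<omega> :: nat \<Rightarrow> real). cis (2 * pi * \<omega> (N + (i * n + s))))"
    have diff: "steinhaus_variable J' x' \<omega> - Z \<omega> = (\<Sum>i<m. \<Sum>s<n. cm (u i s \<omega> * (complex_of_real (C i) / of_nat n)) (e' (i * n + s)))" for \<omega>
    proof -
      have "(\<Sum>k<K. cm (cis (2 * pi * \<omega> (N + k))) (d k)) = (\<Sum>i<m. \<Sum>s<n. cm (u i s \<omega> * (complex_of_real (C i) / of_nat n)) (e' (i * n + s)))"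
        unfolding K_def sum_blocks using n(1) by (intro sum.cong refl) (auto simp: d_def u_def)
      then show ?thesis unfolding Z'_eq by simp
    qed
    have meas: "u i s \<in> borel_measurable angle_space" for i s
      unfolding u_def by (rule measurable_cis_coordinate[OF UNIV_I])
    have "(\<integral>\<^sup>+\<omega>. ennreal (norm (steinhaus_variable J' x' \<omega> - Z \<omega>)) \<partial>angle_space)
        \<le> ennreal (\<Sum>i<m. cmod (complex_of_real (C i)) * (norm (e i) / sqrt n + \<delta>))"
      unfolding diff
    proof (rule blocks_expected_norm_le[OF prob_space_angle_space meas _ _ n(1)])
      show "cmod (u i s \<omega>) = 1" for i s \<omega> by (simp add: u_def)
      show "(\<integral>\<omega>. u i s \<omega> * cnj (u i t \<omega>) \<partial>angle_space) = 0" if "s \<noteq> t" for i s t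
        unfolding u_def using that by (intro cis_coordinates_orthogonal) simp
      fix i s assume lt: "i < m" "s < n"
      have "i * n + s < (i + 1) * n" using lt by simp
      also have "\<dots> \<le> m * n" using lt by (intro mult_le_mono1) simp
      finally have "i * n + s < K" by (simp add: K_def)
      moreover have "(i * n + s) div n = i" using lt by simp
      ultimately show "norm (e' (i * n + s) - e i) \<le> \<delta>"
        using \<beta> by (metis dist_norm dist_commute less_imp_le)
    qed
    also have "(\<Sum>i<m. cmod (complex_of_real (C i)) * (norm (e i) / sqrt n + \<delta>)) = (\<Sum>i<m. C i * (norm (e i) / sqrt n + \<delta>))"
      using Cpos by (simp add: less_imp_le)
    also have "ennreal \<dots> \<le> ennreal \<epsilon>" using small(1) by (intro ennreal_leI) simp
    finally show ?thesis .
  qed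
  with mem hits show ?thesis by (intro bexI[of _ "steinhaus_variable J' x'"]) auto
qed

text \<open>The laws of \<open>steinhaus_variables\<close> are exactly the members of
  \<open>ST cm T\<close>, so the approximating sequences stay in the class without any
  mixing.\<close>

theorem dense_gdelta_ST:
  assumes "perfectly_spanning cm T"
  shows "dense_gdelta_in weak_top (ST_closure_on cm T UNIV) (ST_closure_on cm T (HC T))"
  unfolding ST_closure_on_def
proof (rule dense_gdelta_in_Pr_on_HC[OF continuous_T], rule subsetI)
  fix m assume m: "m \<in> ST cm T"
  interpret A: prob_space angle_space by (rule prob_space_angle_space)
  have meas: "Z \<in> borel_measurable angle_space" if "Z \<in> steinhaus_variables" for Z
    using that measurable_steinhaus_variable by (auto simp: steinhaus_variables_def)
  have ST_Pr: "p \<in> Pr" if "p \<in> ST cm T" for p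
    using that meas unfolding distr_steinhaus_variables[symmetric] by (auto intro: A.distr_in_Pr)
  obtain Z where Z: "Z \<in> steinhaus_variables" "m = distr angle_space borel Z"
    using m unfolding distr_steinhaus_variables[symmetric] by blast
  show "m \<in> weak_top closure_of ((weak_top closure_of ST cm T) \<inter> Pr_on (HC T))"
  proof (rule A.randomized_Baire_weak_lim[OF continuous_T meas
      steinhaus_variables_step[OF closure_cspan_accumulating[OF assms]] Z(1)])
    fix \<mu> \<nu> assume \<mu>: "\<And>r. \<mu> r \<in> Pr_on (HC T)" "weak_lim \<mu> (distr angle_space borel Z)"
      "\<And>r. weak_lim (\<nu> r) (\<mu> r)" "\<And>r s. \<nu> r s \<in> distr angle_space borel ` steinhaus_variables"
    have Pr: "\<mu> r \<in> Pr" for r using \<mu>(1)[of r] by (simp add: Pr_on_def)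
    have "\<nu> r s \<in> ST cm T" for r s using \<mu>(4) unfolding distr_steinhaus_variables .
    then have "\<mu> r \<in> weak_top closure_of ST cm T" for r
      using weak_lim_closure_of[OF \<mu>(3)[of r] Pr[of r]] ST_Pr by blast
    then show ?thesis
      using weak_lim_closure_of[OF \<mu>(2)[folded Z(2)] ST_Pr[OF m] Pr] \<mu>(1) by blast
  qed
qed

end

theorem theorem1p6:
  fixes cm :: "complex \<Rightarrow> 'a::{banach, second_countable_topology} \<Rightarrow> 'a"
    and T :: "'a \<Rightarrow> 'a"
  assumes "complex_scalar cm"
    and "complex_bounded_linear cm T"
  shows "(perfectly_spanning cm T \<and>
          unimodular_eigenvectors cm T \<subseteq> closure (periodic_eigenvectors cm T)
          \<longrightarrow> dense_gdelta_in weak_top (FT_closure_on T UNIV) (FT_closure_on T (HC T)))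
       \<and> (perfectly_spanning cm T
          \<longrightarrow> dense_gdelta_in weak_top (ST_closure_on cm T UNIV) (ST_closure_on cm T (HC T)))"
proof -
  interpret complex_operator cm T using assms by unfold_locales
  show ?thesis using dense_gdelta_FT dense_gdelta_ST by blast
qed

end
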